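(* Let $\phi\in\mathbb M(\mathcal A(\hat{\mathbf R}^d))$ and $F_\phi\in\mathbb M(\mathcal L^1(\mathbf R^d))$ the corresponding multiplier. The following are equivalent: (a) the Radon measure $\phi(t)\,dt$ on $\hat{\mathbf R}^d$ is transformable; (b) $F_\phi$ is locally bounded and its associated Radon measure $\iota F_\phi$ is translation bounded.
   Context: $G=\mathbf R^d$ with dual $\hat{\mathbf R}^d$, pairing $e^{ix\cdot t}$; $\hat f(t)=(2\pi)^{-d}\int e^{-ix\cdot t}f(x)dx$, $\check h(t)=(2\pi)^{-d}\int e^{ix\cdot t}h(x)dx$, Lebesgue measures $dx,dt$. $V=\{t:|t|<1/4\}$. For $E\subseteq\hat{\mathbf R}^d$, $\mathrm{span}(E)$ is the span of the characters $x\mapsto e^{ix\cdot s}$, $s\in E$, each $p=\sum\hat p(s)e^{ix\cdot s}$ uniquely, $\|p\|_\infty=\sup|p|$. For $\phi\in C_b(\hat{\mathbf R}^d)$: $\|\phi\|^{\bar V,s}=\sup\{|\sum_{s'\in\bar V+s}\hat p(s')\phi(s')|:p\in\mathrm{span}(\bar V+s),\|p\|_\infty\le1\}$, $\|\phi\|^{\bar V}=\sup_s\|\phi\|^{\bar V,s}$. On $M(\mathbf R^d)$ put $\|\mu\|_{\bar V}=\|\hat\mu\|^{\bar V}$; $\mathcal L^1(\mathbf R^d)$ is the closure of $L^1(\mathbf R^d)$ in the completion of $(M(\mathbf R^d),\|\cdot\|_{\bar V})$, with generalized Fourier transform $\hat f=\lim\widehat{f_n}$; $\mathcal A(\hat{\mathbf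 R}^d)$ is its image with norm $\|\cdot\|^{\bar V}$, $\mathbb M(\mathcal A(\hat{\mathbf R}^d))=\{\phi\in C_b:\phi\psi\in\mathcal A\ \forall\psi\in\mathcal A\}$, and $F_\phi$ is the multiplier of $\mathcal L^1(\mathbf R^d)$ with $\widehat{F_\phi*f}=\phi\hat f$. $f\in\mathcal L^1(\mathbf R^d)$ is locally integrable if there are $f_n\in L^1$ with $f_n\to f$ in $\|\cdot\|_{\bar V}$ and $\{hf_n\}$ Cauchy in $L^1$ for all $h\in C_c(\mathbf R^d)$; then $hf:=\lim hf_n$; $\mathcal L^1(\mathbf R^d)_{(0)}$ denotes such $f$. With $B_n=\{|x|\le1/n\}$, $e_0=c\,1_{B_4}^{*4}$ ($\|e_0\|_1=1$), $e_n(x)=n^de_0(nx)$: $F_\phi$ is locally bounded if $F_\phi*e_n\in\mathcal L^1(\mathbf R^d)_{(0)}$ for all $n$ and $\sup_n\|h(F_\phi*e_n)\|_1<\infty$ for every $h\in C_c(\mathbf R^d)$. A Radon measure $\nu$ on $\mathbf R^d$ is transformable if there is a Radon measure $\hat\nu$ on $\hat{\mathbf R}^d$ with $\int h*h^*d\nu=\int|\check h|^2d\hat\nu$ for all $h\in C_c(\mathbf R^d)$ ($h^*(x)=\overline{h(-x)}$), and analogously for Radon measures on $\hat{\mathbf R}^d$ with the roles of the groups exchanged; the transform is unique. For locally bounded $F_\phi$ there is a unique transformable Radon measure $\iota F_\phi$ on $\mathbf R^d$ with Fourier transform $\phi(t)dt$, called its associated Radon measure. A Radon measure $\nu$ is translation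 bounded if $\sup_x|\nu|(K+x)<\infty$ for every compact $K$. *)

theory Defs
  imports "HOL-Analysis.Analysis"
begin

text \<open>Both R^d and its dual are modelled by the type real^'n (d = CARD('n)),
  with pairing exp(i x.t).  Functions are complex valued.\<close>

definition ch :: "real^'n \<Rightarrow> real^'n \<Rightarrow> complex" where
  "ch x t = exp (\<i> * complex_of_real (x \<bullet> t))"

definition Cc :: "(real^'n \<Rightarrow> complex) \<Rightarrow> bool" where
  "Cc h \<longleftrightarrow> continuous_on UNIV h \<and> compact (closure {x. h x \<noteq> 0})"

definition conv :: "(real^'n \<Rightarrow> complex) \<Rightarrow> (real^'n \<Rightarrow> complex) \<Rightarrow> real^'n \<Rightarrow> complex" where
  "conv f g x = integral\<^sup>L lborel (\<lambda>y. f (x - y) * g y)"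

definition invol :: "(real^'n \<Rightarrow> complex) \<Rightarrow> real^'n \<Rightarrow> complex" where
  "invol h x = cnj (h (- x))"

text \<open>Fourier transform and inverse transform on R^d (with the factor (2 pi)^(-d)).\<close>
definition FT :: "(real^'n \<Rightarrow> complex) \<Rightarrow> real^'n \<Rightarrow> complex" where
  "FT f t = complex_of_real (inverse ((2*pi) ^ CARD('n))) *
      integral\<^sup>L lborel (\<lambda>x. cnj (ch x t) * f x)"

definition iFT :: "(real^'n \<Rightarrow> complex) \<Rightarrow> real^'n \<Rightarrow> complex" where
  "iFT h t = complex_of_real (inverse ((2*pi) ^ CARD('n))) *
      integral\<^sup>L lborel (\<lambda>x. ch x t * h x)"

text \<open>Inverse transform of a function on the dual group (roles exchanged), w.r.t. dt.\<close>
definition iFT_dual :: "(real^'n \<Rightarrow> complex) \<Rightarrow> real^'n \<Rightarrow> complex" where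
  "iFT_dual g x = integral\<^sup>L lborel (\<lambda>t. ch x t * g t)"

text \<open>The norms ||phi||^{Vbar,s} and ||phi||^{Vbar}, Vbar = closed ball of radius 1/4.
  A trigonometric polynomial in span(Vbar+s) is given by its finitely supported
  coefficient function c (c s' = hat p (s')).\<close>
definition normVs :: "(real^'n \<Rightarrow> complex) \<Rightarrow> real^'n \<Rightarrow> ereal" where
  "normVs \<phi> s = (SUP c \<in> {c :: real^'n \<Rightarrow> complex.
        finite {t. c t \<noteq> 0} \<and> {t. c t \<noteq> 0} \<subseteq> cball s (1/4) \<and>
        (\<forall>x. cmod (\<Sum>t\<in>{t. c t \<noteq> 0}. c t * ch x t) \<le> 1)}.
      ereal (cmod (\<Sum>t\<in>{t. c t \<noteq> 0}. c t * \<phi> t)))"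

definition normV :: "(real^'n \<Rightarrow> complex) \<Rightarrow> ereal" where
  "normV \<phi> = (SUP s. normVs \<phi> s)"

text \<open>A(hat R^d): generalized Fourier transforms of elements of the closure of L^1 in the
  completion of (M(R^d), ||.||_Vbar), i.e. ||.||^Vbar-limits of Fourier transforms of L^1 functions.\<close>
definition A_alg :: "(real^'n \<Rightarrow> complex) set" where
  "A_alg = {\<psi>. \<exists>f :: nat \<Rightarrow> real^'n \<Rightarrow> complex. (\<forall>k. integrable lborel (f k)) \<and>
       ((\<lambda>k. normV (\<lambda>t. FT (f k) t - \<psi> t)) \<longlonglongrightarrow> 0)}"

definition mult_A :: "(real^'n \<Rightarrow> complex) set" where
  "mult_A = {\<phi>. continuous_on UNIV \<phi> \<and> bounded (range \<phi>) \<and>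
       (\<forall>\<psi>\<in>A_alg. (\<lambda>t. \<phi> t * \<psi> t) \<in> A_alg)}"

text \<open>Local integrability of the element of L^1-calligraphic whose generalized Fourier
  transform is psi: witnessed by a sequence f_k.\<close>
definition loc_int_seq :: "(real^'n \<Rightarrow> complex) \<Rightarrow> (nat \<Rightarrow> real^'n \<Rightarrow> complex) \<Rightarrow> bool" where
  "loc_int_seq \<psi> f \<longleftrightarrow> (\<forall>k. integrable lborel (f k)) \<and>
     ((\<lambda>k. normV (\<lambda>t. FT (f k) t - \<psi> t)) \<longlonglongrightarrow> 0) \<and>
     (\<forall>h. Cc h \<longrightarrow> (\<forall>\<epsilon>>0. \<exists>N. \<forall>j\<ge>N. \<forall>k\<ge>N.
        integral\<^sup>L lborel (\<lambda>x. cmod (h x * f j x - h x * f k x)) < \<epsilon>))"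

text \<open>||h f||_1 := lim ||h f_k||_1.\<close>
definition hnorm :: "(real^'n \<Rightarrow> complex) \<Rightarrow> (real^'n \<Rightarrow> complex) \<Rightarrow> real" where
  "hnorm h \<psi> = lim (\<lambda>k. integral\<^sup>L lborel
      (\<lambda>x. cmod (h x * (SOME f. loc_int_seq \<psi> f) k x)))"

text \<open>Approximate identity: e_0 = c 1_{B_4}^{*4}, e_n(x) = n^d e_0(n x).\<close>
definition ind_B4 :: "real^'n \<Rightarrow> complex" where
  "ind_B4 x = complex_of_real (indicator (cball 0 (1/4)) x)"

definition B4conv4 :: "real^'n \<Rightarrow> complex" where
  "B4conv4 = conv (conv (conv ind_B4 ind_B4) ind_B4) ind_B4"

definition e0 :: "real^'n \<Rightarrow> complex" where
  "e0 x = complex_of_real (inverse (integral\<^sup>L lborel (\<lambda>y::real^'n. cmod (B4conv4 y)))) * B4conv4 x"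

definition en :: "nat \<Rightarrow> real^'n \<Rightarrow> complex" where
  "en n x = complex_of_real (real n ^ CARD('n)) * e0 (real n *\<^sub>R x)"

definition locally_bounded :: "(real^'n \<Rightarrow> complex) \<Rightarrow> bool" where
  "locally_bounded \<phi> \<longleftrightarrow>
     (\<forall>n\<ge>1. \<exists>f. loc_int_seq (\<lambda>t. \<phi> t * FT (en n) t) f) \<and>
     (\<forall>h. Cc h \<longrightarrow> bdd_above {hnorm h (\<lambda>t. \<phi> t * FT (en n) t) | n. n \<ge> 1})"

text \<open>Complex Radon measures, represented by their polar decomposition (|nu|, u):
  |nu| a locally finite Borel measure, u a Borel function of modulus 1, nu = u |nu|.\<close>
type_synonym 'a radon = "'a measure \<times> ('a \<Rightarrow> complex)"

definition is_radon :: "'a::euclidean_space radon \<Rightarrow> bool" where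
  "is_radon \<nu> \<longleftrightarrow> sets (fst \<nu>) = sets borel \<and>
     (\<forall>K. compact K \<longrightarrow> emeasure (fst \<nu>) K < \<infinity>) \<and>
     snd \<nu> \<in> borel_measurable borel \<and> (\<forall>x. cmod (snd \<nu> x) = 1)"

definition radon_integrable :: "'a::euclidean_space radon \<Rightarrow> ('a \<Rightarrow> complex) \<Rightarrow> bool" where
  "radon_integrable \<nu> f \<longleftrightarrow> integrable (fst \<nu>) (\<lambda>x. f x * snd \<nu> x)"

definition radon_integral :: "'a::euclidean_space radon \<Rightarrow> ('a \<Rightarrow> complex) \<Rightarrow> complex" where
  "radon_integral \<nu> f = integral\<^sup>L (fst \<nu>) (\<lambda>x. f x * snd \<nu> x)"

definition translation_bounded :: "'a::euclidean_space radon \<Rightarrow> bool" where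
  "translation_bounded \<nu> \<longleftrightarrow>
     (\<forall>K. compact K \<longrightarrow> (SUP x. emeasure (fst \<nu>) ((\<lambda>y. x + y) ` K)) < \<infinity>)"

text \<open>(a) The Radon measure phi(t) dt on the dual group is transformable.\<close>
definition density_transformable :: "(real^'n \<Rightarrow> complex) \<Rightarrow> bool" where
  "density_transformable \<phi> \<longleftrightarrow> (\<exists>\<mu> :: (real^'n) radon. is_radon \<mu> \<and>
     (\<forall>g. Cc g \<longrightarrow>
        radon_integrable \<mu> (\<lambda>x. complex_of_real ((cmod (iFT_dual g x))\<^sup>2)) \<and>
        integral\<^sup>L lborel (\<lambda>t. conv g (invol g) t * \<phi> t) =
          radon_integral \<mu> (\<lambda>x. complex_of_real ((cmod (iFT_dual g x))\<^sup>2))))"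

text \<open>nu is a transformable Radon measure on R^d with Fourier transform phi(t) dt,
  i.e. nu is the associated Radon measure iota F_phi (unique by the paper).\<close>
definition assoc_radon :: "(real^'n \<Rightarrow> complex) \<Rightarrow> (real^'n) radon \<Rightarrow> bool" where
  "assoc_radon \<phi> \<nu> \<longleftrightarrow> is_radon \<nu> \<and>
     (\<forall>h. Cc h \<longrightarrow>
        integrable lborel (\<lambda>t. complex_of_real ((cmod (iFT h t))\<^sup>2) * \<phi> t) \<and>
        radon_integral \<nu> (conv h (invol h)) =
          integral\<^sup>L lborel (\<lambda>t. complex_of_real ((cmod (iFT h t))\<^sup>2) * \<phi> t))"

end

theory Submission
  imports Defs "HOL-Probability.Probability"
begin

text \<open>The key is a duality: if two translation bounded measures satisfy
  \<open>\<integral> g * g\<^sup>* d\<mu>\<^sub>1 = \<integral> |iFT_dual g|\<^sup>2 d\<mu>\<^sub>2\<close> for all \<open>g \<in> C\<^sub>c\<close>, then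
  \<open>\<integral> |iFT_dual h|\<^sup>2 d\<mu>\<^sub>1 = C \<integral> (h * h\<^sup>*)(-x) d\<mu>\<^sub>2\<close> for all \<open>h \<in> C\<^sub>c\<close>.  It is obtained by testing the
  hypothesis with \<open>g\<^sub>1 * g\<^sub>2\<^sup>*\<close> approximating \<open>iFT_dual (h * h\<^sup>*)\<close> times a wide cutoff.  As \<open>\<phi>\<close> is bounded,
  \<open>\<phi>(t) dt\<close> is translation bounded.  Hence a translation bounded associated measure \<open>\<nu>\<close> makes
  \<open>\<phi>(t) dt\<close> transformable, with transform a multiple of the reflection of \<open>\<nu>\<close>.

  Conversely, the transform \<open>\<mu>\<close> of \<open>\<phi>(t) dt\<close> integrates every \<open>|iFT_dual g|\<^sup>2\<close> and is therefore
  translation bounded, and duality provides \<open>\<nu>\<close>.  The generalized inverse transform of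
  \<open>\<phi> FT(e\<^sub>n)\<close> is then the bounded continuous function \<open>F\<^sub>n = \<integral> e\<^sub>n(x + y) d\<mu>(y)\<close>:
  multiplying it by transforms of an approximate identity \<open>\<rho>\<^sub>k\<close> gives integrable functions
  with transforms \<open>\<rho>\<^sub>k * (\<phi> FT(e\<^sub>n))\<close>, which converge because translation is continuous on the algebra
  \<open>A\<close>.  Local limits in mean do not depend on the approximating sequence, so \<open>\<parallel>h F\<^sub>n\<parallel>\<^sub>1\<close> is the norm to
  be bounded, and it is controlled by the mass of \<open>\<mu>\<close> on a fixed ball.\<close>

section \<open>Continuous functions of compact support\<close>

text \<open>The duality is more than an exchange of the two groups. The hypothesis may only be
  tested with functions of compact support, and \<open>|iFT_dual h|^2\<close> is in general not one.
  Translation boundedness is what makes such squares integrable nevertheless, and it makes the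
  averages of a measure against translates of a \<open>Cc\<close> function bounded and continuous;
  both facts are used at every limit passage. Plancherel and inversion theorems are not presupposed.
  Gaussians give the bare finiteness of the integral of \<open>|iFT_dual g|^2\<close>; the
  normalising constant is defined as the quotient of the two sides for one fixed function; inversion
  is then recovered from the duality itself. The unnormalised \<open>iFT_dual\<close> serves as the
  only transform on both groups. \<open>FT\<close> and \<open>iFT\<close> are constant multiples of
  it, up to a reflection, so powers of 2 pi enter only where the definitions are unfolded. A further
  obstacle is that \<open>hnorm\<close> evaluates a sequence picked by choice, of which nothing but
  \<open>loc_int_seq\<close> is known. Its transforms are controlled in the uniform norm only, so
  its local convergence has to be recovered by testing against transforms of integrable
  functions.\<close>

lemma Cc_iff: "Cc h \<longleftrightarrow> continuous_on UNIV h \<and> (\<exists>R>0. \<forall>x. R < norm x \<longrightarrow> h x = 0)"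
proof
  assume h: "Cc h"
  then have "bounded (closure {x. h x \<noteq> 0})"
    by (auto simp: Cc_def compact_imp_bounded)
  then obtain R where "R > 0" "\<forall>x\<in>closure {x. h x \<noteq> 0}. norm x \<le> R"
    by (auto simp: bounded_pos)
  then show "continuous_on UNIV h \<and> (\<exists>R>0. \<forall>x. R < norm x \<longrightarrow> h x = 0)"
    using h closure_subset[of "{x. h x \<noteq> 0}"] unfolding Cc_def by force
next
  assume *: "continuous_on UNIV h \<and> (\<exists>R>0. \<forall>x. R < norm x \<longrightarrow> h x = 0)"
  then obtain R where R: "\<forall>x. R < norm x \<longrightarrow> h x = 0" by blast
  have "{x. h x \<noteq> 0} \<subseteq> cball 0 R" using R by (force simp: not_less)
  then have "bounded {x. h x \<noteq> 0}" using bounded_cball bounded_subset by blast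
  then show "Cc h" using * by (simp add: Cc_def)
qed

lemma CcI: "continuous_on UNIV h \<Longrightarrow> (\<And>x. R < norm x \<Longrightarrow> h x = 0) \<Longrightarrow> Cc h"
  unfolding Cc_iff by (intro conjI exI[of _ "max R 1"]) auto

lemma Cc_cont: "Cc h \<Longrightarrow> continuous_on UNIV h"
  by (simp add: Cc_def)

lemma Cc_supportE:
  assumes "Cc h" obtains R where "R > 0" "\<And>x. R < norm x \<Longrightarrow> h x = 0"
  using assms unfolding Cc_iff by blast

lemma Cc_boundE:
  assumes "Cc h" obtains B where "B > 0" "\<And>x. cmod (h x) \<le> B"
proof -
  obtain R where R: "R > 0" "\<And>x. R < norm x \<Longrightarrow> h x = 0" using assms by (rule Cc_supportE) blast
  have "compact (h ` cball 0 R)"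
    using assms by (intro compact_continuous_image continuous_on_subset[OF Cc_cont]) auto
  then obtain B where B: "B > 0" "\<forall>y\<in>h ` cball 0 R. cmod y \<le> B"
    using compact_imp_bounded bounded_pos by blast
  have "cmod (h x) \<le> B" for x
    using B R(2)[of x] by (cases "norm x \<le> R") auto
  then show ?thesis using B(1) that by blast
qed

lemma Cc_measurable [measurable_dest]: "Cc h \<Longrightarrow> h \<in> borel_measurable borel"
  by (simp add: Cc_cont borel_measurable_continuous_onI)

lemma integrable_bounded_support:
  fixes f :: "real^'n \<Rightarrow> complex"
  assumes [measurable]: "f \<in> borel_measurable borel" and sM [measurable_cong]: "sets M = sets borel"
    and fin: "emeasure M (cball 0 R) < \<infinity>"
    and B: "\<And>x. cmod (f x) \<le> B" and R: "\<And>x. R < norm x \<Longrightarrow> f x = 0"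
  shows "integrable M f"
proof (rule Bochner_Integration.integrable_bound)
  show "integrable M (\<lambda>x. B * indicator (cball 0 R) x)"
    using fin sM by (intro integrable_mult_right integrable_real_indicator) auto
  show "AE x in M. cmod (f x) \<le> norm (B * indicator (cball 0 R) x)"
    using B R by (intro AE_I2) (force simp: indicator_def intro: order_trans)
qed (use measurable_cong_sets[OF sM refl] in auto)

lemma Cc_integrable:
  assumes "Cc h" shows "integrable lborel h"
proof -
  obtain R where R: "R > 0" "\<And>x. R < norm x \<Longrightarrow> h x = 0" using assms by (rule Cc_supportE) blast
  obtain B where B: "B > 0" "\<And>x. cmod (h x) \<le> B" using assms by (rule Cc_boundE) blast
  show ?thesis
    using assms R B emeasure_lborel_cball_finite[of 0 R]
    by (intro integrable_bounded_support[where R=R and B=B]) (simp_all add: Cc_measurable)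
qed

lemma Cc_mult: "Cc h \<Longrightarrow> continuous_on UNIV g \<Longrightarrow> Cc (\<lambda>x. g x * h x)"
  unfolding Cc_iff by (auto intro!: continuous_intros)

lemma Cc_cmult: "Cc h \<Longrightarrow> Cc (\<lambda>x. c * h x)"
  by (rule Cc_mult) auto

lemma Cc_add: "Cc f \<Longrightarrow> Cc g \<Longrightarrow> Cc (\<lambda>x. f x + g x)"
proof -
  assume f: "Cc f" and g: "Cc g"
  obtain R where R: "R > 0" "\<And>x. R < norm x \<Longrightarrow> f x = 0" using f by (rule Cc_supportE) blast
  obtain S where S: "S > 0" "\<And>x. S < norm x \<Longrightarrow> g x = 0" using g by (rule Cc_supportE) blast
  show ?thesis
    using R S f g by (intro CcI[where R="max R S"]) (simp_all add: continuous_on_add Cc_cont)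
qed

lemma Cc_cnj: "Cc h \<Longrightarrow> Cc (\<lambda>x. cnj (h x))"
  unfolding Cc_iff by (auto intro!: continuous_intros)

lemma Cc_affine:
  fixes a :: "real^'n"
  assumes h: "Cc h" and c: "c \<noteq> 0" shows "Cc (\<lambda>x. h (a + c *\<^sub>R x))"
proof -
  obtain R where R: "R > 0" "\<And>x. R < norm x \<Longrightarrow> h x = 0" using h by (rule Cc_supportE) blast
  show ?thesis
  proof (rule CcI[where R="(R + norm a) / \<bar>c\<bar>"])
    show "continuous_on UNIV (\<lambda>x. h (a + c *\<^sub>R x))"
      by (rule continuous_on_compose2[OF Cc_cont[OF h]]) (auto intro!: continuous_intros)
    fix x :: "real^'n" assume "(R + norm a) / \<bar>c\<bar> < norm x"
    then have "R + norm a < norm (c *\<^sub>R x)" using c by (simp add: field_simps)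
    also have "\<dots> \<le> norm (a + c *\<^sub>R x) + norm a"
      using norm_triangle_ineq4[of "a + c *\<^sub>R x" a] by (simp only: add_diff_cancel_left')
    finally show "h (a + c *\<^sub>R x) = 0" using R by simp
  qed
qed

lemma Cc_reflect: "Cc h \<Longrightarrow> Cc (\<lambda>x. h (- x))"
  using Cc_affine[of h "-1" 0] by simp

lemma Cc_diff_left: "Cc h \<Longrightarrow> Cc (\<lambda>x. h (a - x))"
  using Cc_affine[of h "-1" a] by simp

lemma Cc_invol: "Cc h \<Longrightarrow> Cc (invol h)"
  unfolding invol_def by (intro Cc_cnj Cc_reflect)

section \<open>Affine substitutions and Fubini's theorem\<close>

lemma integrable_lborel_affine:
  fixes f :: "'a::euclidean_space \<Rightarrow> 'b :: {banach, second_countable_topology}"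
  assumes f: "integrable lborel f" and c: "c \<noteq> 0"
  shows "integrable lborel (\<lambda>x. f (a + c *\<^sub>R x))"
proof -
  have "integrable (density (distr lborel borel (\<lambda>x. a + c *\<^sub>R x)) (\<lambda>_. \<bar>c\<bar>^DIM('a))) f"
    using f lborel_affine[OF c, of a] by simp
  moreover have "f \<in> borel_measurable borel" using f by simp
  ultimately have "integrable lborel (\<lambda>x. \<bar>c\<bar> ^ DIM('a) *\<^sub>R f (a + c *\<^sub>R x))" using c
    by (subst (asm) integrable_density) (simp_all add: integrable_distr_eq)
  from integrable_scaleR_right[of "inverse (\<bar>c\<bar> ^ DIM('a))", OF this] show ?thesis
    using c by simp
qed

lemma integral_lborel_affine:
  fixes f :: "'a::euclidean_space \<Rightarrow> 'b :: {banach, second_countable_topology}"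
  assumes f [measurable]: "f \<in> borel_measurable borel" and c: "c \<noteq> 0"
  shows "integral\<^sup>L lborel f = \<bar>c\<bar>^DIM('a) *\<^sub>R integral\<^sup>L lborel (\<lambda>x. f (a + c *\<^sub>R x))"
proof -
  have "integral\<^sup>L lborel f = integral\<^sup>L (density (distr lborel borel (\<lambda>x. a + c *\<^sub>R x)) (\<lambda>_. \<bar>c\<bar>^DIM('a))) f"
    using lborel_affine[OF c, of a] by simp
  then show ?thesis using c
    by (subst (asm) integral_density) (auto simp: integral_distr)
qed

lemma nn_integral_lborel_affine:
  fixes f :: "'a::euclidean_space \<Rightarrow> ennreal"
  assumes f [measurable]: "f \<in> borel_measurable borel" and c: "c \<noteq> 0"
  shows "integral\<^sup>N lborel f = ennreal (\<bar>c\<bar>^DIM('a)) * integral\<^sup>N lborel (\<lambda>x. f (a + c *\<^sub>R x))"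
proof -
  have "integral\<^sup>N lborel f = integral\<^sup>N (density (distr lborel borel (\<lambda>x. a + c *\<^sub>R x)) (\<lambda>_. \<bar>c\<bar>^DIM('a))) f"
    using lborel_affine[OF c, of a] by simp
  then show ?thesis using c
    by (subst (asm) nn_integral_density) (auto simp: nn_integral_distr nn_integral_cmult)
qed

lemma integral_lborel_shift:
  fixes f :: "'a::euclidean_space \<Rightarrow> 'b :: {banach, second_countable_topology}"
  assumes [measurable]: "f \<in> borel_measurable borel"
  shows "integral\<^sup>L lborel (\<lambda>x. f (a + x)) = integral\<^sup>L lborel f"
    "integral\<^sup>L lborel (\<lambda>x. f (x + a)) = integral\<^sup>L lborel f"
    "integral\<^sup>L lborel (\<lambda>x. f (x - a)) = integral\<^sup>L lborel f"
    "integral\<^sup>L lborel (\<lambda>x. f (a - x)) = integral\<^sup>L lborel f"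
    "integral\<^sup>L lborel (\<lambda>x. f (- x)) = integral\<^sup>L lborel f"
  using integral_lborel_affine[of f 1 a] integral_lborel_affine[of f 1 "-a"]
    integral_lborel_affine[of f "-1" a] integral_lborel_affine[of f "-1" 0]
  by (simp_all add: add.commute)

lemma integrable_lborel_shift:
  fixes f :: "'a::euclidean_space \<Rightarrow> 'b :: {banach, second_countable_topology}"
  assumes "integrable lborel f"
  shows "integrable lborel (\<lambda>x. f (a + x))" "integrable lborel (\<lambda>x. f (x + a))"
    "integrable lborel (\<lambda>x. f (x - a))" "integrable lborel (\<lambda>x. f (a - x))"
    "integrable lborel (\<lambda>x. f (- x))"
  using integrable_lborel_affine[OF assms, of 1 a] integrable_lborel_affine[OF assms, of 1 "-a"]
    integrable_lborel_affine[OF assms, of "-1" a] integrable_lborel_affine[OF assms, of "-1" 0]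
  by (simp_all add: add.commute)

lemma nn_integral_lborel_shift:
  fixes f :: "'a::euclidean_space \<Rightarrow> ennreal"
  assumes [measurable]: "f \<in> borel_measurable borel"
  shows "(\<integral>\<^sup>+x. f (a + x) \<partial>lborel) = integral\<^sup>N lborel f"
    "(\<integral>\<^sup>+x. f (x - a) \<partial>lborel) = integral\<^sup>N lborel f"
    "(\<integral>\<^sup>+x. f (a - x) \<partial>lborel) = integral\<^sup>N lborel f"
    "(\<integral>\<^sup>+x. f (- x) \<partial>lborel) = integral\<^sup>N lborel f"
  using nn_integral_lborel_affine[of f 1 a] nn_integral_lborel_affine[of f 1 "-a"]
    nn_integral_lborel_affine[of f "-1" a] nn_integral_lborel_affine[of f "-1" 0]
  by (simp_all add: add.commute)

text \<open>Tonelli turns the finiteness of one iterated integral of the modulus, which can be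
  checked by estimates, into joint integrability.\<close>

lemma Fubini_nn:
  fixes f :: "'a \<Rightarrow> 'b \<Rightarrow> complex"
  assumes "sigma_finite_measure M" "sigma_finite_measure N"
    and [measurable]: "case_prod f \<in> borel_measurable (M \<Otimes>\<^sub>M N)"
    and fin: "(\<integral>\<^sup>+x. \<integral>\<^sup>+y. ennreal (cmod (f x y)) \<partial>N \<partial>M) < \<infinity>"
  shows "(\<integral>x. \<integral>y. f x y \<partial>N \<partial>M) = (\<integral>y. \<integral>x. f x y \<partial>M \<partial>N)"
    "integrable M (\<lambda>x. \<integral>y. f x y \<partial>N)" "integrable N (\<lambda>y. \<integral>x. f x y \<partial>M)"
proof -
  interpret M: sigma_finite_measure M by fact
  interpret N: sigma_finite_measure N by fact
  interpret pair_sigma_finite M N ..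
  have i: "integrable (M \<Otimes>\<^sub>M N) (case_prod f)"
  proof (rule integrableI_bounded)
    have "(\<integral>\<^sup>+z. ennreal (norm (case_prod f z)) \<partial>(M \<Otimes>\<^sub>M N)) = (\<integral>\<^sup>+x. \<integral>\<^sup>+y. ennreal (cmod (f x y)) \<partial>N \<partial>M)"
      by (subst N.nn_integral_fst[symmetric]) auto
    then show "(\<integral>\<^sup>+z. ennreal (norm (case_prod f z)) \<partial>(M \<Otimes>\<^sub>M N)) < \<infinity>" using fin by simp
  qed simp
  show "(\<integral>x. \<integral>y. f x y \<partial>N \<partial>M) = (\<integral>y. \<integral>x. f x y \<partial>M \<partial>N)"
    using Fubini_integral[OF i] by simp
  show "integrable M (\<lambda>x. \<integral>y. f x y \<partial>N)" using integrable_fst[OF i] by simp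
  show "integrable N (\<lambda>y. \<integral>x. f x y \<partial>M)" using integrable_snd[OF i] by simp
qed

section \<open>Translation bounded measures and the Fourier transform\<close>

text \<open>Balls replace compact sets and an explicit real constant replaces the supremum;
  \<open>translation_bounded_iff\<close> relates it to \<open>translation_bounded\<close>. It speaks
  of a bare measure, so that \<open>lborel\<close> and Dirac measures are covered as well.\<close>

definition trans_bounded :: "'a::euclidean_space measure \<Rightarrow> bool" where
  "trans_bounded M \<longleftrightarrow> sets M = sets borel \<and>
     (\<forall>R. \<exists>C::real. 0 \<le> C \<and> (\<forall>x. emeasure M (cball x R) \<le> ennreal C))"

lemma trans_bounded_sets: "trans_bounded M \<Longrightarrow> sets M = sets borel"
  by (simp add: trans_bounded_def)

lemma trans_boundedE:
  assumes "trans_bounded M"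
  obtains C :: real where "0 \<le> C" "\<And>x. emeasure M (cball x R) \<le> ennreal C"
  using assms unfolding trans_bounded_def by metis

lemma trans_bounded_finite: "trans_bounded M \<Longrightarrow> emeasure M (cball x R) < \<infinity>"
  by (rule trans_boundedE[of M R]) (auto intro: le_less_trans[OF _ ennreal_less_top])

lemma trans_bounded_sigma_finite:
  assumes "trans_bounded M" shows "sigma_finite_measure M"
proof
  have sM: "sets M = sets borel" "space M = UNIV"
    using trans_bounded_sets[OF assms] sets_eq_imp_space_eq[of M borel] by auto
  have "\<exists>n::nat. x \<in> cball 0 (real n)" for x :: 'a
    using real_arch_simple[of "norm x"] by auto
  then show "\<exists>A. countable A \<and> A \<subseteq> sets M \<and> \<Union> A = space M \<and> (\<forall>a\<in>A. emeasure M a \<noteq> \<infinity>)"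
    using sM trans_bounded_finite[OF assms, of 0]
    by (intro exI[of _ "range (\<lambda>n::nat. cball 0 (real n))"]) (auto simp: less_top)
qed

lemma trans_bounded_lborel: "trans_bounded lborel"
  unfolding trans_bounded_def
proof safe
  fix R :: real
  have "emeasure lborel (cball x R) = emeasure lborel (cball (0::'a) R)" for x :: 'a
  proof -
    have "indicator (cball x R) (x + y) = (indicator (cball 0 R) y :: ennreal)" for y
      by (auto simp: indicator_def dist_norm norm_minus_commute)
    moreover have "(indicator (cball x R) :: 'a \<Rightarrow> ennreal) \<in> borel_measurable borel"
      by (rule borel_measurable_indicator) simp
    ultimately show ?thesis
      using nn_integral_lborel_shift(1)[of "indicator (cball x R)" x] by simp
  qed
  then have "emeasure lborel (cball x R) \<le> ennreal (measure lborel (cball (0::'a) R))" for x :: 'a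
    using emeasure_lborel_cball_finite[of "0::'a" R]
    by (metis emeasure_eq_ennreal_measure infinity_ennreal_def less_top order_refl)
  then show "\<exists>C\<ge>0. \<forall>x::'a. emeasure lborel (cball x R) \<le> ennreal C"
    by (intro exI[of _ "measure lborel (cball (0::'a) R)"]) auto
qed auto

text \<open>The integrand lives on the ball of radius \<open>R\<close> about \<open>- z\<close>,
  whose mass is bounded independently of \<open>z\<close>.\<close>

lemma nn_integral_shift_bound:
  fixes A :: "'a::euclidean_space \<Rightarrow> real"
  assumes M: "trans_bounded M" and R: "\<And>x. R < norm x \<Longrightarrow> A x = 0" and B: "\<And>x. A x \<le> B" "0 \<le> B"
  obtains C :: real where "0 \<le> C" "\<And>z. (\<integral>\<^sup>+y. ennreal (A (z + y)) \<partial>M) \<le> ennreal C"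
proof -
  obtain C where C: "0 \<le> C" "\<And>x. emeasure M (cball x R) \<le> ennreal C"
    using trans_boundedE[OF M] by metis
  have "(\<integral>\<^sup>+y. ennreal (A (z + y)) \<partial>M) \<le> (\<integral>\<^sup>+y. ennreal B * indicator (cball (- z) R) y \<partial>M)" for z
    using B R by (intro nn_integral_mono)
      (fastforce simp: indicator_def dist_norm norm_minus_commute add.commute not_le intro: ennreal_leI)
  also have "\<dots> z \<le> ennreal B * ennreal C" for z
    using C trans_bounded_sets[OF M] by (subst nn_integral_cmult_indicator) (auto intro: mult_left_mono)
  finally have "(\<integral>\<^sup>+y. ennreal (A (z + y)) \<partial>M) \<le> ennreal (B * C)" for z
    using B C by (simp add: ennreal_mult)
  then show ?thesis using that[of "B * C"] B C by simp
qed

lemma integrable_shift: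
  fixes A :: "real^'n \<Rightarrow> complex"
  assumes M: "trans_bounded M" and A: "Cc A" and u: "u \<in> borel_measurable borel" "\<And>x. cmod (u x) \<le> b"
  shows "integrable M (\<lambda>y. A (z + y) * u y)"
proof -
  obtain R where R: "R > 0" "\<And>x. R < norm x \<Longrightarrow> A x = 0" using A by (rule Cc_supportE) blast
  obtain B where B: "B > 0" "\<And>x. cmod (A x) \<le> B" using A by (rule Cc_boundE) blast
  have [measurable]: "A \<in> borel_measurable borel" using A by (rule Cc_measurable)
  show ?thesis
  proof (rule integrable_bounded_support[where R="R + norm z" and B="B * b"])
    show "A (z + x) * u x = 0" if "R + norm z < norm x" for x
      using that R(2)[of "z + x"] norm_triangle_ineq4[of "z + x" z] by simp
  qed (use u trans_bounded_sets[OF M] trans_bounded_finite[OF M] B in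
      \<open>auto simp: norm_mult intro!: mult_mono order.trans[OF norm_ge_zero B(2)]\<close>)
qed

lemma integral_shift_bounded:
  fixes A :: "real^'n \<Rightarrow> complex"
  assumes M: "trans_bounded M" and A: "Cc A" and u: "u \<in> borel_measurable borel" "\<And>x. cmod (u x) \<le> b"
  obtains C where "0 \<le> C" "\<And>z. cmod (\<integral>y. A (z + y) * u y \<partial>M) \<le> C"
proof -
  obtain R where R: "R > 0" "\<And>x. R < norm x \<Longrightarrow> A x = 0" using A by (rule Cc_supportE) blast
  obtain B where B: "B > 0" "\<And>x. cmod (A x) \<le> B" using A by (rule Cc_boundE) blast
  have b: "b \<ge> 0" using order.trans[OF norm_ge_zero u(2)] .
  obtain C where C: "0 \<le> C" "\<And>z. (\<integral>\<^sup>+y. ennreal (cmod (A (z + y)) * b) \<partial>M) \<le> ennreal C"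
    by (rule nn_integral_shift_bound[OF M, of R "\<lambda>x. cmod (A x) * b" "B * b"])
      (use R B b in \<open>auto intro: mult_right_mono\<close>)
  have "ennreal (cmod (\<integral>y. A (z + y) * u y \<partial>M)) \<le> ennreal C" for z
  proof -
    have "ennreal (cmod (\<integral>y. A (z + y) * u y \<partial>M)) \<le> (\<integral>\<^sup>+y. ennreal (cmod (A (z + y) * u y)) \<partial>M)"
      by (rule integral_norm_bound_ennreal[OF integrable_shift[OF M A u]])
    also have "\<dots> \<le> (\<integral>\<^sup>+y. ennreal (cmod (A (z + y)) * b) \<partial>M)"
      using u by (intro nn_integral_mono ennreal_leI) (auto simp: norm_mult intro: mult_left_mono)
    also have "\<dots> \<le> ennreal C" by (rule C)
    finally show ?thesis .
  qed
  then show ?thesis using that C(1) by (simp add: ennreal_le_iff)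
qed

text \<open>A convergent sequence of points is bounded, so all the translates of \<open>A\<close>
  along it live in one ball of finite mass, and dominated convergence applies.\<close>

lemma integral_shift_continuous:
  fixes A :: "real^'n \<Rightarrow> complex"
  assumes M: "trans_bounded M" and A: "Cc A" and u: "u \<in> borel_measurable borel" "\<And>x. cmod (u x) \<le> b"
  shows "continuous_on UNIV (\<lambda>z. \<integral>y. A (z + y) * u y \<partial>M)"
proof (rule continuous_at_imp_continuous_on, safe)
  fix z0 :: "real^'n"
  obtain R where R: "R > 0" "\<And>x. R < norm x \<Longrightarrow> A x = 0" using A by (rule Cc_supportE) blast
  obtain B where B: "B > 0" "\<And>x. cmod (A x) \<le> B" using A by (rule Cc_boundE) blast
  have b: "b \<ge> 0" using order.trans[OF norm_ge_zero u(2)] .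
  have [measurable]: "A \<in> borel_measurable borel" "u \<in> borel_measurable borel" using A u by (auto intro: Cc_measurable)
  have [measurable_cong]: "sets M = sets borel" using M by (rule trans_bounded_sets)
  show "isCont (\<lambda>z. \<integral>y. A (z + y) * u y \<partial>M) z0"
    unfolding continuous_at_sequentially comp_def
  proof safe
    fix x :: "nat \<Rightarrow> real^'n" assume x: "x \<longlonglongrightarrow> z0"
    then have "bounded (range x)" using convergent_imp_bounded by blast
    then obtain S where S: "\<And>n. norm (x n) \<le> S" by (auto simp: bounded_iff)
    show "(\<lambda>n. \<integral>y. A (x n + y) * u y \<partial>M) \<longlonglongrightarrow> (\<integral>y. A (z0 + y) * u y \<partial>M)"
    proof (rule integral_dominated_convergence[where w="\<lambda>y. B * b * indicator (cball 0 (R + S)) y"])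
      show "integrable M (\<lambda>y. B * b * indicator (cball 0 (R + S)) y)"
        using trans_bounded_finite[OF M] by (intro integrable_mult_right integrable_real_indicator) auto
      have "isCont A w" for w using Cc_cont[OF A] by (simp add: continuous_on_eq_continuous_at)
      then show "AE y in M. (\<lambda>n. A (x n + y) * u y) \<longlonglongrightarrow> A (z0 + y) * u y"
        by (intro AE_I2 tendsto_mult isCont_tendsto_compose[of _ A] tendsto_add x tendsto_const)
      show "AE y in M. cmod (A (x n + y) * u y) \<le> B * b * indicator (cball 0 (R + S)) y" for n
      proof (rule AE_I2)
        fix y
        show "cmod (A (x n + y) * u y) \<le> B * b * indicator (cball 0 (R + S)) y"
        proof (cases "norm y \<le> R + S")
          case True then show ?thesis using B u(2)[of y] b by (auto simp: norm_mult intro!: mult_mono order.trans[OF norm_ge_zero B(2)])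
        next
          case False
          then have "R < norm (x n + y)" using S[of n] norm_triangle_ineq4[of "x n + y" "x n"] by simp
          then show ?thesis using R False by simp
        qed
      qed
    qed measurable
  qed
qed

text \<open>Brings a convolution into the form of the preceding lemmas, with \<open>lborel\<close>
  as the measure and the reflected second factor as the density; continuity of convolutions follows
  from there.\<close>

lemma conv_eq_shift:
  assumes [measurable]: "f \<in> borel_measurable borel" "g \<in> borel_measurable borel"
  shows "conv f g z = (\<integral>y. f (z + y) * g (- y) \<partial>lborel)"
  unfolding conv_def using integral_lborel_shift(5)[of "\<lambda>y. f (z - y) * g y"] by simp

text \<open>Only one factor has to be continuous. The outer convolutions with the indicator
  \<open>ind_B4\<close> in \<open>e0\<close> require this generality.\<close>

lemma Cc_conv_bounded:
  fixes f g :: "real^'n \<Rightarrow> complex"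
  assumes f: "Cc f" and g: "g \<in> borel_measurable borel" "\<And>x. cmod (g x) \<le> b" "\<And>x. S < norm x \<Longrightarrow> g x = 0"
  shows "Cc (conv f g)"
proof -
  obtain R where R: "R > 0" "\<And>x. R < norm x \<Longrightarrow> f x = 0" using f by (rule Cc_supportE) blast
  have [measurable]: "f \<in> borel_measurable borel" "g \<in> borel_measurable borel" using f g by (auto intro: Cc_measurable)
  show ?thesis
  proof (rule CcI[where R="R + S"])
    have "conv f g = (\<lambda>z. \<integral>y. f (z + y) * g (- y) \<partial>lborel)"
      by (rule ext, rule conv_eq_shift) auto
    then show "continuous_on UNIV (conv f g)"
      using integral_shift_continuous[OF trans_bounded_lborel f, of "\<lambda>y. g (- y)" b] g by simp
    fix x :: "real^'n" assume x: "R + S < norm x"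
    have "f (x - y) * g y = 0" for y
      using R(2)[of "x - y"] g(3)[of y] x norm_triangle_ineq[of "x - y" y] by (cases "S < norm y") auto
    then show "conv f g x = 0" unfolding conv_def by (simp only: Bochner_Integration.integral_zero)
  qed
qed

lemma Cc_conv:
  assumes f: "Cc f" and g: "Cc g" shows "Cc (conv f g)"
proof -
  obtain S where "\<And>x. S < norm x \<Longrightarrow> g x = 0" using g by (rule Cc_supportE) blast
  moreover obtain b where "\<And>x. cmod (g x) \<le> b" using g by (rule Cc_boundE) blast
  ultimately show ?thesis using Cc_conv_bounded[OF f Cc_measurable[OF g]] by blast
qed

section \<open>Characters and the unnormalised transform \<open>iFT_dual\<close>\<close>

lemma norm_ch [simp]: "cmod (ch x t) = 1"
  by (simp add: ch_def)

lemma ch_commute: "ch x t = ch t x"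
  by (simp add: ch_def inner_commute)

lemma ch_add_left: "ch (x + y) t = ch x t * ch y t"
  by (simp add: ch_def inner_add_left algebra_simps exp_add)

lemma ch_add_right: "ch x (s + t) = ch x s * ch x t"
  by (simp add: ch_def inner_add_right algebra_simps exp_add)

lemma ch_0 [simp]: "ch 0 t = 1" "ch x 0 = 1"
  by (simp_all add: ch_def)

lemma cnj_ch: "cnj (ch x t) = ch x (- t)"
  by (simp add: ch_def exp_cnj)

lemma ch_minus: "ch (- x) t = ch x (- t)"
  by (simp add: ch_def)

lemma ch_diff_left: "ch (x - y) t = ch x t * ch y (- t)"
  using ch_add_left[of x "- y" t] by (simp add: ch_minus)

lemma ch_scaleR: "ch (c *\<^sub>R x) t = ch x (c *\<^sub>R t)"
  by (simp add: ch_def)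

lemma continuous_on_ch [continuous_intros]:
  "continuous_on S f \<Longrightarrow> continuous_on S g \<Longrightarrow> continuous_on S (\<lambda>z. ch (f z) (g z))"
  unfolding ch_def by (intro continuous_intros)

lemma measurable_ch [measurable (raw)]:
  "f \<in> borel_measurable M \<Longrightarrow> g \<in> borel_measurable M \<Longrightarrow> (\<lambda>z. ch (f z) (g z)) \<in> borel_measurable M"
  unfolding ch_def by measurable

lemma integrable_ch: "integrable lborel f \<Longrightarrow> integrable lborel (\<lambda>x. ch x t * f x)"
  by (rule Bochner_Integration.integrable_bound[of _ f]) (auto simp: norm_mult)

lemma iFT_dual_eq: "iFT_dual f t = (\<integral>x. ch x t * f x \<partial>lborel)"
  unfolding iFT_dual_def by (subst ch_commute) simp

lemma norm_iFT_dual_le: "cmod (iFT_dual f t) \<le> (\<integral>x. cmod (f x) \<partial>lborel)"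
  unfolding iFT_dual_eq by (rule order.trans[OF integral_norm_bound]) (simp add: norm_mult)

lemma continuous_iFT_dual:
  assumes f: "integrable lborel f" shows "continuous_on UNIV (iFT_dual f)"
proof (rule continuous_at_imp_continuous_on, safe)
  fix t0 :: "real^'a"
  have [measurable]: "f \<in> borel_measurable borel" using f by simp
  show "isCont (iFT_dual f) t0"
    unfolding continuous_at_sequentially comp_def iFT_dual_eq[abs_def]
  proof safe
    fix t :: "nat \<Rightarrow> real^'a" assume t: "t \<longlonglongrightarrow> t0"
    show "(\<lambda>n. \<integral>x. ch x (t n) * f x \<partial>lborel) \<longlonglongrightarrow> (\<integral>x. ch x t0 * f x \<partial>lborel)"
    proof (rule integral_dominated_convergence[where w="\<lambda>y. cmod (f y)"])
      show "AE x in lborel. (\<lambda>n. ch x (t n) * f x) \<longlonglongrightarrow> ch x t0 * f x"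
        unfolding ch_def by (intro AE_I2 tendsto_intros t)
    qed (use f in \<open>auto simp: norm_mult\<close>)
  qed
qed

lemma measurable_iFT_dual [measurable]:
  assumes [measurable]: "f \<in> borel_measurable borel"
  shows "iFT_dual f \<in> borel_measurable borel"
  unfolding iFT_dual_eq[abs_def] by measurable

lemma iFT_dual_reflect:
  assumes [measurable]: "f \<in> borel_measurable borel"
  shows "iFT_dual (\<lambda>x. f (- x)) t = iFT_dual f (- t)"
  unfolding iFT_dual_eq using integral_lborel_shift(5)[of "\<lambda>x. ch x (-t) * f x"] by (simp add: ch_minus)

lemma measurable_cnj [measurable (raw)]:
  "f \<in> borel_measurable M \<Longrightarrow> (\<lambda>x. cnj (f x)) \<in> borel_measurable M"
  by (rule measurable_compose[OF _ borel_measurable_continuous_onI]) (auto intro!: continuous_intros)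

lemma iFT_dual_invol:
  assumes [measurable]: "f \<in> borel_measurable borel"
  shows "iFT_dual (invol f) t = cnj (iFT_dual f t)"
proof -
  have "cnj (iFT_dual f t) = iFT_dual (\<lambda>x. cnj (f x)) (- t)"
    unfolding iFT_dual_eq by (subst Bochner_Integration.integral_cnj[symmetric]) (simp add: cnj_ch)
  then show ?thesis
    using iFT_dual_reflect[of "\<lambda>x. cnj (f x)" t] by (simp add: measurable_cnj invol_def[abs_def])
qed

lemma iFT_dual_ch: "iFT_dual (\<lambda>x. ch x s * f x) t = iFT_dual f (t + s)"
  unfolding iFT_dual_eq by (simp add: ch_add_right mult.assoc)

lemma iFT_dual_translate:
  assumes [measurable]: "f \<in> borel_measurable borel"
  shows "iFT_dual (\<lambda>x. f (x - a)) t = ch a t * iFT_dual f t"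
  unfolding iFT_dual_eq using integral_lborel_shift(2)[of "\<lambda>x. ch x t * f (x - a)" a]
  by (simp add: ch_add_left mult_ac flip: integral_mult_right_zero)

lemma iFT_dual_scale:
  fixes w :: "real^'n \<Rightarrow> complex"
  assumes [measurable]: "w \<in> borel_measurable borel" and c: "c > 0"
  shows "iFT_dual (\<lambda>x. w (x /\<^sub>R c)) t = complex_of_real (c ^ CARD('n)) * iFT_dual w (c *\<^sub>R t)"
  unfolding iFT_dual_eq using integral_lborel_affine[of "\<lambda>x. ch x t * w (x /\<^sub>R c)" c 0] c
  by (simp add: ch_scaleR scaleR_conv_of_real[where 'a=complex])

lemma iFT_dual_conv:
  assumes f: "integrable lborel f" and g: "integrable lborel g"
  shows "iFT_dual (conv f g) t = iFT_dual f t * iFT_dual g t"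
proof -
  have [measurable]: "f \<in> borel_measurable borel" "g \<in> borel_measurable borel" using f g by auto
  have fin: "(\<integral>\<^sup>+x. ennreal (cmod (f x)) \<partial>lborel) < \<infinity>" "(\<integral>\<^sup>+x. ennreal (cmod (g x)) \<partial>lborel) < \<infinity>"
    using f g by (auto simp: integrable_iff_bounded)
  have "(\<integral>x. \<integral>y. ch x t * (f (x - y) * g y) \<partial>lborel \<partial>lborel) =
      (\<integral>y. \<integral>x. ch x t * (f (x - y) * g y) \<partial>lborel \<partial>lborel)"
  proof (rule Fubini_nn)
    have "(\<integral>\<^sup>+x. \<integral>\<^sup>+y. ennreal (cmod (ch x t * (f (x - y) * g y))) \<partial>lborel \<partial>lborel) =
        (\<integral>\<^sup>+y. \<integral>\<^sup>+x. ennreal (cmod (f (x - y))) * ennreal (cmod (g y)) \<partial>lborel \<partial>lborel)"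
      by (subst lborel_pair.Fubini') (auto simp: norm_mult ennreal_mult)
    also have "\<dots> = (\<integral>\<^sup>+x. ennreal (cmod (f x)) \<partial>lborel) * (\<integral>\<^sup>+x. ennreal (cmod (g x)) \<partial>lborel)"
      by (simp add: nn_integral_multc nn_integral_lborel_shift(2)[of "\<lambda>x. ennreal (cmod (f x))"] nn_integral_cmult)
    finally show "(\<integral>\<^sup>+x. \<integral>\<^sup>+y. ennreal (cmod (ch x t * (f (x - y) * g y))) \<partial>lborel \<partial>lborel) < \<infinity>"
      using fin by (simp add: ennreal_mult_less_top)
  qed (auto intro: sigma_finite_lborel)
  also have "\<dots> = (\<integral>y. g y * iFT_dual (\<lambda>x. f (x - y)) t \<partial>lborel)"
    unfolding iFT_dual_eq by (simp flip: integral_mult_right_zero add: mult_ac)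
  also have "\<dots> = iFT_dual f t * iFT_dual g t"
    by (simp add: iFT_dual_translate) (simp add: iFT_dual_eq flip: integral_mult_right_zero add: mult_ac)
  finally show ?thesis
    unfolding iFT_dual_eq conv_def by (simp flip: integral_mult_right_zero)
qed

lemma iFT_dual_conv_invol:
  assumes "Cc g" shows "iFT_dual (conv g (invol g)) t = complex_of_real ((cmod (iFT_dual g t))\<^sup>2)"
  using assms
  by (simp add: Cc_integrable Cc_invol Cc_measurable iFT_dual_conv iFT_dual_invol complex_norm_square
      del: of_real_power)

section \<open>Approximate identities and Gaussians\<close>

definition bump :: "real \<Rightarrow> real^'n \<Rightarrow> real" where
  "bump r x = max 0 (r - norm x)"

text \<open>A cone normalised to integral 1 when \<open>r > 0\<close>. Being even and real it equals
  its own \<open>invol\<close>, so its transform is real; smoothness is replaced by these properties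
  throughout.\<close>

definition moll :: "real \<Rightarrow> real^'n \<Rightarrow> complex" where
  "moll r x = complex_of_real (bump r x / (\<integral>y. bump r y \<partial>(lborel :: (real^'n) measure)))"

lemma bump_nonneg: "0 \<le> bump r x"
  by (simp add: bump_def)

lemma Cc_bump: "Cc (\<lambda>x. complex_of_real (bump r x))"
  by (rule CcI[where R=r]) (auto simp: bump_def intro!: continuous_intros)

lemma integrable_bump: "integrable lborel (bump r)"
  using integrable_Re[OF Cc_integrable[OF Cc_bump[of r]]] by simp

lemma integral_bump_pos:
  assumes r: "r > 0" shows "(\<integral>y. bump r y \<partial>(lborel :: (real^'n) measure)) > 0"
proof -
  have "0 < r / 2 * measure lborel (ball (0::real^'n) (r/2))"
    using content_ball_pos[of "r/2" "0::real^'n"] r by simp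
  also have "\<dots> = (\<integral>y. r / 2 * indicator (ball 0 (r/2)) y \<partial>(lborel :: (real^'n) measure))"
    by simp
  also have "\<dots> \<le> (\<integral>y. bump r y \<partial>(lborel :: (real^'n) measure))"
  proof (rule Bochner_Integration.integral_mono)
    show "integrable lborel (\<lambda>y::real^'n. r / 2 * indicat_real (ball 0 (r/2)) y)"
      using emeasure_lborel_ball_finite[of "0::real^'n" "r/2"]
      by (intro integrable_mult_right integrable_real_indicator) auto
  qed (use r in \<open>auto simp: bump_def indicator_def integrable_bump[unfolded bump_def[abs_def]]\<close>)
  finally show ?thesis .
qed

lemma Cc_moll: "Cc (moll r :: real^'a \<Rightarrow> complex)"
proof -
  have "(moll r :: real^'a \<Rightarrow> complex) = (\<lambda>x. complex_of_real (1 / (\<integral>y. bump r y \<partial>(lborel :: (real^'a) measure))) * complex_of_real (bump r x))"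
    by (simp add: moll_def fun_eq_iff)
  then show ?thesis using Cc_cmult[OF Cc_bump] by (simp only:)
qed

lemma moll_support: "r \<le> norm x \<Longrightarrow> moll r x = 0"
  by (simp add: moll_def bump_def)

lemma moll_uminus [simp]: "moll r (- x) = moll r x"
  by (simp add: moll_def bump_def)

lemma invol_moll [simp]: "invol (moll r) = moll r"
  by (rule ext) (simp add: invol_def moll_def bump_def)

lemma cmod_moll: "complex_of_real (cmod (moll r x)) = moll r (x::real^'n)"
proof -
  have "0 \<le> (\<integral>y. bump r y \<partial>(lborel :: (real^'n) measure))" by (simp add: bump_nonneg)
  then show ?thesis by (simp add: moll_def norm_divide bump_nonneg)
qed

lemma integral_moll: "r > 0 \<Longrightarrow> (\<integral>x. moll r x \<partial>(lborel :: (real^'n) measure)) = 1"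
  using integral_bump_pos[of r, where 'n='n] by (simp add: moll_def)

lemma integral_norm_moll:
  assumes "r > 0" shows "(\<integral>x. cmod (moll r x) \<partial>(lborel :: (real^'n) measure)) = 1"
proof -
  have "complex_of_real (\<integral>x. cmod (moll r x) \<partial>(lborel :: (real^'n) measure)) = (\<integral>x. moll r x \<partial>(lborel :: (real^'n) measure))"
    by (simp add: cmod_moll flip: integral_complex_of_real)
  then show ?thesis using integral_moll[OF assms, where 'n='n] by (simp only: of_real_eq_1_iff)
qed

lemma integral_norm_conv_le:
  assumes f: "integrable lborel f" and g: "integrable lborel g"
  shows "(\<integral>x. cmod (conv f g x) \<partial>lborel) \<le> (\<integral>x. cmod (f x) \<partial>lborel) * (\<integral>x. cmod (g x) \<partial>lborel)"
proof -
  have [measurable]: "f \<in> borel_measurable borel" "g \<in> borel_measurable borel" using f g by auto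
  have "(\<integral>\<^sup>+x. ennreal (cmod (conv f g x)) \<partial>lborel) \<le>
      (\<integral>\<^sup>+x. \<integral>\<^sup>+y. ennreal (cmod (f (x - y))) * ennreal (cmod (g y)) \<partial>lborel \<partial>lborel)"
  proof (rule nn_integral_mono)
    fix x
    show "ennreal (cmod (conv f g x)) \<le> (\<integral>\<^sup>+y. ennreal (cmod (f (x - y))) * ennreal (cmod (g y)) \<partial>lborel)"
    \<comment> \<open>Where the defining integral diverges, the convolution takes the default value
      0, which satisfies the bound.\<close>
    proof (cases "integrable lborel (\<lambda>y. f (x - y) * g y)")
      case True
      then show ?thesis
        unfolding conv_def using integral_norm_bound_ennreal[OF True] by (simp add: norm_mult ennreal_mult)
    qed (simp add: conv_def not_integrable_integral_eq)
  qed
  also have "\<dots> = (\<integral>\<^sup>+y. \<integral>\<^sup>+x. ennreal (cmod (f (x - y))) * ennreal (cmod (g y)) \<partial>lborel \<partial>lborel)"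
    by (rule lborel_pair.Fubini'[symmetric]) simp
  also have "\<dots> = (\<integral>\<^sup>+x. ennreal (cmod (f x)) \<partial>lborel) * (\<integral>\<^sup>+x. ennreal (cmod (g x)) \<partial>lborel)"
    by (simp add: nn_integral_multc nn_integral_lborel_shift(2)[of "\<lambda>x. ennreal (cmod (f x))"] nn_integral_cmult)
  also have "\<dots> = ennreal ((\<integral>x. cmod (f x) \<partial>lborel) * (\<integral>x. cmod (g x) \<partial>lborel))"
    using f g by (simp add: nn_integral_eq_integral ennreal_mult)
  finally show ?thesis
    by (intro integral_real_bounded) auto
qed

lemma Cc_uniformly_continuous:
  fixes f :: "real^'n \<Rightarrow> complex"
  assumes "Cc f" "\<epsilon> > 0"
  obtains \<delta> where "\<delta> > 0" "\<And>x y. norm (x - y) < \<delta> \<Longrightarrow> cmod (f x - f y) < \<epsilon>"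
proof -
  obtain R where R: "R > 0" "\<And>x. R < norm x \<Longrightarrow> f x = 0" using assms(1) by (rule Cc_supportE) blast
  have "uniformly_continuous_on (cball 0 (R + 1)) f"
    using assms by (intro compact_uniformly_continuous continuous_on_subset[OF Cc_cont]) auto
  then obtain d where d: "d > 0"
    "\<And>x y. x \<in> cball 0 (R + 1) \<Longrightarrow> y \<in> cball 0 (R + 1) \<Longrightarrow> dist y x < d \<Longrightarrow> dist (f y) (f x) < \<epsilon>"
    using assms(2) unfolding uniformly_continuous_on_def by metis
  have "cmod (f x - f y) < \<epsilon>" if xy: "norm (x - y) < min d 1" for x y
  proof (cases "norm x \<le> R + 1 \<and> norm y \<le> R + 1")
    case True then show ?thesis using d(2)[of y x] xy by (simp add: dist_norm)
  next
    case False
    then have "R < norm x" "R < norm y" using xy norm_triangle_ineq2[of x y] norm_triangle_ineq2[of y x]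
      by (auto simp: norm_minus_commute)
    then show ?thesis using R assms(2) by simp
  qed
  then show ?thesis using that[of "min d 1"] d(1) by simp
qed

text \<open>Uniform continuity of \<open>f\<close> gives one \<open>\<delta>\<close> for all kernels
  at once, so the same lemma serves \<open>moll\<close> and later \<open>moll2\<close>.\<close>

lemma conv_approx_identity:
  assumes "Cc f" "\<epsilon> > 0"
  obtains \<delta> where "\<delta> > 0"
    "\<And>q x. integrable lborel q \<Longrightarrow> (\<integral>y. q y \<partial>lborel) = 1 \<Longrightarrow> (\<integral>y. cmod (q y) \<partial>lborel) \<le> 1 \<Longrightarrow>
      (\<And>y. \<delta> \<le> norm y \<Longrightarrow> q y = 0) \<Longrightarrow> cmod (conv f q x - f x) \<le> \<epsilon>"
proof -
  obtain \<delta> where d: "\<delta> > 0" "\<And>x y. norm (x - y) < \<delta> \<Longrightarrow> cmod (f x - f y) < \<epsilon>"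
    using Cc_uniformly_continuous[OF assms] by metis
  obtain B where B: "B > 0" "\<And>x. cmod (f x) \<le> B" using assms(1) by (rule Cc_boundE) blast
  have [measurable]: "f \<in> borel_measurable borel" using assms by (auto intro: Cc_measurable)
  have "cmod (conv f q x - f x) \<le> \<epsilon>"
    if q: "integrable lborel q" "(\<integral>y. q y \<partial>lborel) = 1" "(\<integral>y. cmod (q y) \<partial>lborel) \<le> 1"
      "\<And>y. \<delta> \<le> norm y \<Longrightarrow> q y = 0" for q x
  proof -
    have i: "integrable lborel (\<lambda>y. f (x - y) * q y)"
      by (rule Bochner_Integration.integrable_bound[of _ "\<lambda>y. B * cmod (q y)"])
        (use q B in \<open>auto simp: norm_mult intro!: mult_right_mono AE_I2\<close>)
    have "conv f q x - f x = (\<integral>y. (f (x - y) - f x) * q y \<partial>lborel)"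
      unfolding conv_def using i q(1,2) by (simp add: left_diff_distrib)
    also have "cmod \<dots> \<le> (\<integral>y. \<epsilon> * cmod (q y) \<partial>lborel)"
    proof (rule Bochner_Integration.integral_norm_bound_integral)
      show "integrable lborel (\<lambda>y. (f (x - y) - f x) * q y)" using i q(1) by (simp add: left_diff_distrib)
      show "cmod ((f (x - y) - f x) * q y) \<le> \<epsilon> * cmod (q y)" for y
      proof (cases "norm y < \<delta>")
        case True
        then have "cmod (f (x - y) - f x) \<le> \<epsilon>" using d(2)[of "x - y" x] by simp
        then show ?thesis by (simp add: norm_mult mult_right_mono)
      qed (use q(4) in simp)
    qed (use q in auto)
    also have "\<dots> \<le> \<epsilon>" using q assms(2) by simp
    finally show ?thesis .
  qed
  then show ?thesis using that d(1) by blast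
qed

text \<open>The multiplication formula of Fourier analysis: the kernel \<open>ch x y\<close> is
  symmetric in its arguments, so Fubini moves the transform to the other factor.\<close>

lemma integral_iFT_dual_swap:
  assumes f: "integrable lborel f" and g: "integrable lborel g"
  shows "(\<integral>x. f x * iFT_dual g x \<partial>lborel) = (\<integral>x. iFT_dual f x * g x \<partial>lborel)"
proof -
  have [measurable]: "f \<in> borel_measurable borel" "g \<in> borel_measurable borel" using f g by auto
  have fin: "(\<integral>\<^sup>+x. ennreal (cmod (f x)) \<partial>lborel) < \<infinity>" "(\<integral>\<^sup>+x. ennreal (cmod (g x)) \<partial>lborel) < \<infinity>"
    using f g by (auto simp: integrable_iff_bounded)
  have "(\<integral>x. f x * iFT_dual g x \<partial>lborel) = (\<integral>x. \<integral>y. f x * (ch y x * g y) \<partial>lborel \<partial>lborel)"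
    by (simp add: iFT_dual_eq flip: integral_mult_right_zero)
  also have "\<dots> = (\<integral>y. \<integral>x. f x * (ch y x * g y) \<partial>lborel \<partial>lborel)"
  proof (rule Fubini_nn)
    have "(\<integral>\<^sup>+x. \<integral>\<^sup>+y. ennreal (cmod (f x * (ch y x * g y))) \<partial>lborel \<partial>lborel) =
        (\<integral>\<^sup>+x. ennreal (cmod (f x)) \<partial>lborel) * (\<integral>\<^sup>+x. ennreal (cmod (g x)) \<partial>lborel)"
      by (simp add: norm_mult ennreal_mult nn_integral_cmult nn_integral_multc)
    then show "(\<integral>\<^sup>+x. \<integral>\<^sup>+y. ennreal (cmod (f x * (ch y x * g y))) \<partial>lborel \<partial>lborel) < \<infinity>"
      using fin by (simp add: ennreal_mult_less_top)
  qed (auto intro: sigma_finite_lborel)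
  also have "\<dots> = (\<integral>x. iFT_dual f x * g x \<partial>lborel)"
    unfolding iFT_dual_def integral_mult_left_zero[symmetric] by (simp add: mult_ac)
  finally show ?thesis .
qed

definition gauss :: "real^'n \<Rightarrow> complex" where
  "gauss x = complex_of_real (exp (- (norm x)\<^sup>2 / 2))"

text \<open>Read off from the characteristic function of the standard normal distribution.\<close>

lemma gauss_1d:
  shows "integrable lborel (\<lambda>x::real. exp (\<i> * complex_of_real (x * t)) * complex_of_real (exp (- x\<^sup>2 / 2)))" (is ?A)
    and "(\<integral>x. exp (\<i> * complex_of_real (x * t)) * complex_of_real (exp (- x\<^sup>2 / 2)) \<partial>(lborel :: real measure)) =
      complex_of_real (sqrt (2 * pi) * exp (- t\<^sup>2 / 2))" (is ?B)
proof -
  let ?f = "\<lambda>x::real. exp (\<i> * complex_of_real (x * t)) * complex_of_real (exp (- x\<^sup>2 / 2))"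
  have eq: "?f x = complex_of_real (sqrt (2 * pi)) * (std_normal_density x *\<^sub>R iexp (t * x))" for x
    by (simp add: std_normal_density_def scaleR_conv_of_real mult_ac)
  have i: "integrable lborel (\<lambda>x. std_normal_density x *\<^sub>R iexp (t * x))"
    by (rule Bochner_Integration.integrable_bound[OF integrable_normal_moment[of 1 0 0]]) (auto simp: norm_mult)
  show ?A unfolding eq using i by (rule integrable_mult_right)
  have "(\<integral>x. std_normal_density x *\<^sub>R iexp (t * x) \<partial>lborel) = char std_normal_distribution t"
    unfolding char_def by (subst integral_density) auto
  also have "\<dots> = complex_of_real (exp (- t\<^sup>2 / 2))"
    by (simp add: char_std_normal_distribution)
  finally show ?B unfolding eq by (simp only: integral_mult_right_zero of_real_mult)
qed

text \<open>Both the Gaussian and the character are products over the coordinates, so the product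
  measure behind \<open>lborel\<close> reduces everything to \<open>gauss_1d\<close>.\<close>

lemma gauss_iFT_dual:
  shows "integrable lborel (gauss :: real^'n \<Rightarrow> complex)" (is ?A)
    and "iFT_dual gauss t = complex_of_real (sqrt (2 * pi) ^ CARD('n)) * gauss (t :: real^'n)" (is ?B)
proof -
  define h where "h t b x = exp (\<i> * complex_of_real (x * (t \<bullet> b))) * complex_of_real (exp (- x\<^sup>2 / 2))"
    for t b :: "real^'n" and x :: real
  have h: "integrable lborel (h t b)" "integral\<^sup>L lborel (h t b) = complex_of_real (sqrt (2 * pi) * exp (- (t \<bullet> b)\<^sup>2 / 2))" for t b
    unfolding h_def[abs_def] by (rule gauss_1d)+
  have norm2: "(norm x)\<^sup>2 = (\<Sum>b\<in>Basis. (x \<bullet> b)\<^sup>2)" for x :: "real^'n"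
    unfolding power2_norm_eq_inner by (subst euclidean_inner) (simp add: power2_eq_square)
  have prod: "ch x t * gauss x = (\<Prod>b\<in>Basis. h t b (x \<bullet> b))" for x t :: "real^'n"
    by (simp add: h_def prod.distrib ch_def gauss_def norm2 euclidean_inner[of x t]
        sum_negf sum_distrib_left sum_divide_distrib flip: exp_sum of_real_prod)
  have coord: "(\<Sum>b\<in>Basis. f b *\<^sub>R b) \<bullet> b = f b" if "b \<in> Basis" for b :: "real^'n" and f
    using that by (simp add: inner_sum_left inner_Basis if_distrib sum.delta cong: if_cong)
  interpret P: product_sigma_finite "\<lambda>_::real^'n. lborel :: real measure" ..
  have [measurable]: "h t b \<in> borel_measurable borel" for t b using h(1) by auto
  have m: "(\<lambda>f. \<Sum>b\<in>Basis. f b *\<^sub>R (b::real^'n)) \<in> (\<Pi>\<^sub>M b\<in>Basis. lborel) \<rightarrow>\<^sub>M borel" by measurable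
  have "integrable (\<Pi>\<^sub>M b\<in>Basis. lborel) (\<lambda>f. \<Prod>b\<in>Basis. h t b (f b))" for t :: "real^'n"
    by (rule P.product_integrable_prod) (auto intro: h)
  then have "integrable (\<Pi>\<^sub>M b\<in>Basis. lborel) (\<lambda>f. \<Prod>b\<in>Basis. h t b ((\<Sum>b\<in>Basis. f b *\<^sub>R b) \<bullet> b))" for t :: "real^'n"
    by (simp add: coord cong: prod.cong)
  then have int: "integrable lborel (\<lambda>x. ch x t * gauss x)" for t :: "real^'n"
    unfolding prod by (subst lborel_eq, subst integrable_distr_eq[OF m]) auto
  from int[of 0] show ?A by simp
  have "iFT_dual gauss t = integral\<^sup>L lborel (\<lambda>x. \<Prod>b\<in>Basis. h t b (x \<bullet> b))"
    unfolding iFT_dual_eq prod ..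
  also have "\<dots> = (\<integral>f. (\<Prod>b\<in>Basis. h t b ((\<Sum>b\<in>Basis. f b *\<^sub>R b) \<bullet> b)) \<partial>(\<Pi>\<^sub>M b\<in>Basis. lborel))"
    by (subst lborel_eq, subst integral_distr[OF m]) auto
  also have "\<dots> = (\<integral>f. (\<Prod>b\<in>Basis. h t b (f b)) \<partial>(\<Pi>\<^sub>M b\<in>Basis. lborel))"
    by (simp add: coord cong: prod.cong)
  also have "\<dots> = (\<Prod>b\<in>Basis. integral\<^sup>L lborel (h t b))"
    by (rule P.product_integral_prod) (auto intro: h)
  also have "\<dots> = complex_of_real (sqrt (2 * pi) ^ CARD('n)) * gauss t"
    by (simp add: h prod.distrib gauss_def norm2 sum_negf sum_divide_distrib flip: exp_sum of_real_prod)
  finally show ?B .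
qed

text \<open>Damping \<open>|iFT_dual g|\<^sup>2\<close> by wide Gaussians keeps its integral bounded, because the transforms of
  the Gaussians all have the same \<open>L\<^sup>1\<close> norm; Fatou's lemma removes the damping.\<close>

lemma square_integrable_iFT_dual:
  assumes g: "Cc g" shows "integrable lborel (\<lambda>x. (cmod (iFT_dual g x))\<^sup>2)"
proof -
  define a where "a = conv g (invol g)"
  have a: "Cc a" "\<And>t. iFT_dual a t = complex_of_real ((cmod (iFT_dual g t))\<^sup>2)"
    unfolding a_def using g Cc_conv Cc_invol iFT_dual_conv_invol by blast+
  obtain B where B: "B > 0" "\<And>x. cmod (a x) \<le> B" using a(1) by (rule Cc_boundE) blast
  define G where "G n x = gauss (x /\<^sub>R real (Suc n))" for n and x :: "real^'a"
  have [measurable]: "gauss \<in> borel_measurable (borel :: (real^'a) measure)" "g \<in> borel_measurable borel"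
    using gauss_iFT_dual(1)[where 'n='a] g Cc_measurable by auto
  have G: "integrable lborel (G n)" for n
    unfolding G_def using integrable_lborel_affine[OF gauss_iFT_dual(1), of "inverse (real (Suc n))" 0] by simp
  have Gr: "G n x = complex_of_real (cmod (G n x))" for n x by (simp add: G_def gauss_def)
  define C where "C = B * (\<integral>x. cmod (iFT_dual gauss x) \<partial>(lborel :: (real^'a) measure))"
  have Fg: "integrable lborel (iFT_dual gauss :: real^'a \<Rightarrow> complex)"
    unfolding gauss_iFT_dual(2)[abs_def] by (intro integrable_mult_right gauss_iFT_dual(1))
  have bound: "(\<integral>x. (cmod (iFT_dual g x))\<^sup>2 * cmod (G n x) \<partial>lborel) \<le> C" for n
  proof -
    have FG: "iFT_dual (G n) x = complex_of_real (real (Suc n) ^ CARD('a)) * iFT_dual gauss (real (Suc n) *\<^sub>R x)" for x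
      unfolding G_def by (rule iFT_dual_scale) auto
    have iFG: "integrable lborel (\<lambda>x. iFT_dual (G n) x)"
      unfolding FG using integrable_lborel_affine[OF Fg, of "real (Suc n)" 0] by simp
    have "complex_of_real (\<integral>x. (cmod (iFT_dual g x))\<^sup>2 * cmod (G n x) \<partial>lborel) = (\<integral>x. G n x * iFT_dual a x \<partial>lborel)"
      unfolding a(2) by (subst (2) Gr) (simp add: mult.commute flip: integral_complex_of_real del: of_real_power)
    also have "\<dots> = (\<integral>x. iFT_dual (G n) x * a x \<partial>lborel)"
      by (rule integral_iFT_dual_swap[OF G Cc_integrable[OF a(1)]])
    finally have "(\<integral>x. (cmod (iFT_dual g x))\<^sup>2 * cmod (G n x) \<partial>lborel) = cmod (\<integral>x. iFT_dual (G n) x * a x \<partial>lborel)"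
      by (metis (no_types, lifting) abs_of_nonneg integral_nonneg_AE norm_of_real AE_I2 mult_nonneg_nonneg zero_le_power2 norm_ge_zero)
    also have "\<dots> \<le> (\<integral>x. B * cmod (iFT_dual (G n) x) \<partial>lborel)"
    proof (rule Bochner_Integration.integral_norm_bound_integral)
      show "integrable lborel (\<lambda>x. iFT_dual (G n) x * a x)"
        by (rule Bochner_Integration.integrable_bound[of _ "\<lambda>x. B * cmod (iFT_dual (G n) x)"])
          (use iFG B a(1) Cc_measurable[OF a(1)] in \<open>auto simp: norm_mult mult.commute intro!: mult_right_mono AE_I2\<close>)
    qed (use iFG B in \<open>auto simp: norm_mult mult.commute intro!: mult_right_mono\<close>)
    also have "\<dots> = C"
      using integral_lborel_affine[of "\<lambda>x. cmod (iFT_dual gauss (x::real^'a))" "real (Suc n)" 0]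
      unfolding C_def FG by (simp add: norm_mult norm_power del: of_nat_Suc)
    finally show ?thesis .
  qed
  have "(\<integral>\<^sup>+x. ennreal ((cmod (iFT_dual g x))\<^sup>2) \<partial>lborel) \<le>
      (\<integral>\<^sup>+x. liminf (\<lambda>n. ennreal ((cmod (iFT_dual g x))\<^sup>2 * cmod (G n x))) \<partial>lborel)"
  proof (rule nn_integral_mono)
    fix x :: "real^'a"
    have "(\<lambda>n. inverse (real (Suc n))) \<longlonglongrightarrow> 0" using LIMSEQ_inverse_real_of_nat .
    from tendsto_scaleR[OF this tendsto_const[of x]]
    have "(\<lambda>n. x /\<^sub>R real (Suc n)) \<longlonglongrightarrow> 0" by simp
    moreover have "isCont (\<lambda>x. cmod (gauss x)) (0 :: real^'a)"
      unfolding gauss_def by (intro continuous_intros) auto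
    ultimately have "(\<lambda>n. cmod (G n x)) \<longlonglongrightarrow> cmod (gauss (0 :: real^'a))"
      unfolding G_def by (rule isCont_tendsto_compose[rotated])
    then have "(\<lambda>n. ennreal ((cmod (iFT_dual g x))\<^sup>2 * cmod (G n x))) \<longlonglongrightarrow> ennreal ((cmod (iFT_dual g x))\<^sup>2 * 1)"
      by (intro tendsto_ennrealI tendsto_mult_left) (simp add: gauss_def)
    from lim_imp_Liminf[OF _ this]
    show "ennreal ((cmod (iFT_dual g x))\<^sup>2) \<le> liminf (\<lambda>n. ennreal ((cmod (iFT_dual g x))\<^sup>2 * cmod (G n x)))"
      by simp
  qed
  also have "\<dots> \<le> liminf (\<lambda>n. \<integral>\<^sup>+x. ennreal ((cmod (iFT_dual g x))\<^sup>2 * cmod (G n x)) \<partial>lborel)"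
    by (rule nn_integral_liminf) (simp add: G_def)
  also have "\<dots> \<le> liminf (\<lambda>n. ennreal C)"
  proof (intro Liminf_mono always_eventually allI)
    fix n
    have Fb: "(cmod (iFT_dual g x))\<^sup>2 \<le> (\<integral>x. cmod (g x) \<partial>lborel)\<^sup>2" for x
      by (intro power_mono norm_iFT_dual_le) auto
    have "integrable lborel (\<lambda>x. (cmod (iFT_dual g x))\<^sup>2 * cmod (G n x))"
      by (rule Bochner_Integration.integrable_bound[of _ "\<lambda>x. (\<integral>x. cmod (g x) \<partial>lborel)\<^sup>2 * cmod (G n x)"])
        (use G Fb in \<open>auto simp: norm_mult intro!: mult_right_mono\<close>)
    then show "(\<integral>\<^sup>+x. ennreal ((cmod (iFT_dual g x))\<^sup>2 * cmod (G n x)) \<partial>lborel) \<le> ennreal C"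
      using bound[of n] by (subst nn_integral_eq_integral) (auto intro: ennreal_leI)
  qed
  also have "\<dots> < \<infinity>" by (simp add: Liminf_const)
  finally have "(\<integral>\<^sup>+x. ennreal ((cmod (iFT_dual g x))\<^sup>2) \<partial>lborel) < \<infinity>" .
  then show ?thesis by (intro integrableI_bounded) auto
qed

section \<open>Square integrability of transforms\<close>

lemma integrable_iFT_dual_scale:
  fixes w :: "real^'n \<Rightarrow> complex"
  assumes c: "0 < c" and w: "w \<in> borel_measurable borel" "integrable lborel (iFT_dual w)"
  shows "integrable lborel (iFT_dual (\<lambda>x. w (x /\<^sub>R c)))"
proof -
  have "iFT_dual (\<lambda>x. w (x /\<^sub>R c)) = (\<lambda>t. complex_of_real (c ^ CARD('n)) * iFT_dual w (c *\<^sub>R t))"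
    using iFT_dual_scale[OF w(1) c] by blast
  then show ?thesis
    using integrable_mult_right[OF integrable_lborel_affine[OF w(2), of c 0]] c by simp
qed

text \<open>A character multiplied into \<open>\<rho>\<close> shifts its transform, so this is the
  multiplication formula for \<open>A\<close> and a modulated \<open>\<rho>\<close>. It describes
  the transform of a product as an average of translates without appealing to inversion.\<close>

lemma iFT_dual_mult:
  assumes A: "integrable lborel A" and \<rho>: "integrable lborel \<rho>"
  shows "iFT_dual (\<lambda>s. iFT_dual A s * \<rho> s) y = (\<integral>x. A x * iFT_dual \<rho> (x + y) \<partial>lborel)"
  using integral_iFT_dual_swap[OF A integrable_ch[OF \<rho>, of y]]
  unfolding iFT_dual_ch by (simp add: iFT_dual_eq mult_ac)

context
  fixes N :: "(real^'n) measure" and A w v :: "real^'n \<Rightarrow> complex" and b :: real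
  assumes N: "trans_bounded N" and A: "Cc A" and w: "integrable lborel w"
    and v: "v \<in> borel_measurable borel" "\<And>x. cmod (v x) \<le> b"
begin

text \<open>With the integral over \<open>N\<close> taken first, the translate of \<open>A\<close>
  sees only a ball of uniformly bounded mass; what remains is the \<open>L^1\<close> norm of
  \<open>w\<close>. The two forms differ by the substitution that shifts \<open>x\<close> by
  \<open>y\<close>.\<close>

lemma nn_integral_shift_conv:
  "(\<integral>\<^sup>+y. \<integral>\<^sup>+x. ennreal (cmod (A x * w (x + y))) \<partial>lborel \<partial>N) < \<infinity>" (is ?th1)
  "(\<integral>\<^sup>+y. \<integral>\<^sup>+x. ennreal (cmod (A (x - y) * w x)) \<partial>lborel \<partial>N) < \<infinity>" (is ?th2)
proof -
  have [measurable]: "A \<in> borel_measurable borel" "w \<in> borel_measurable borel" using A w Cc_measurable by auto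
  have [measurable_cong]: "sets N = sets borel" using N by (rule trans_bounded_sets)
  interpret N: sigma_finite_measure N using N by (rule trans_bounded_sigma_finite)
  interpret pair_sigma_finite lborel N ..
  obtain R where R: "R > 0" "\<And>x. R < norm x \<Longrightarrow> A x = 0" using A by (rule Cc_supportE) blast
  obtain B where B: "B > 0" "\<And>x. cmod (A x) \<le> B" using A by (rule Cc_boundE) blast
  obtain C where C: "0 \<le> C" "\<And>z. (\<integral>\<^sup>+y. ennreal (cmod (A (- (z + y)))) \<partial>N) \<le> ennreal C"
    by (rule nn_integral_shift_bound[OF N, of R "\<lambda>x. cmod (A (- x))" B]) (use R B in auto)
  have "(\<integral>\<^sup>+y. \<integral>\<^sup>+x. ennreal (cmod (A (x - y) * w x)) \<partial>lborel \<partial>N) =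
      (\<integral>\<^sup>+x. \<integral>\<^sup>+y. ennreal (cmod (A (x - y) * w x)) \<partial>N \<partial>lborel)"
    by (rule Fubini') measurable
  also have "\<dots> = (\<integral>\<^sup>+x. (\<integral>\<^sup>+y. ennreal (cmod (A (- (- x + y)))) \<partial>N) * ennreal (cmod (w x)) \<partial>lborel)"
    by (simp add: norm_mult ennreal_mult nn_integral_multc)
  also have "\<dots> \<le> (\<integral>\<^sup>+x. ennreal C * ennreal (cmod (w x)) \<partial>lborel)"
    by (intro nn_integral_mono mult_right_mono C) auto
  also have "\<dots> < \<infinity>"
    using w by (simp add: nn_integral_cmult integrable_iff_bounded ennreal_mult_less_top)
  finally show ?th2 .
  moreover have "(\<integral>\<^sup>+x. ennreal (cmod (A (x - y) * w x)) \<partial>lborel) = (\<integral>\<^sup>+x. ennreal (cmod (A x * w (x + y))) \<partial>lborel)" for y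
    using nn_integral_lborel_shift(1)[of "\<lambda>x. ennreal (cmod (A (x - y) * w x))" y] by (simp add: add.commute)
  ultimately show ?th1 by simp
qed

lemma shift_conv_subst:
  "(\<integral>x. A x * w (x + y) \<partial>lborel) = (\<integral>x. A (x - y) * w x \<partial>lborel)"
proof -
  have [measurable]: "A \<in> borel_measurable borel" "w \<in> borel_measurable borel" using A w Cc_measurable by auto
  show ?thesis using integral_lborel_shift(2)[of "\<lambda>x. A (x - y) * w x" y] by simp
qed

lemma shift_conv_Fubini:
  "(\<integral>y. (\<integral>x. A x * w (x + y) \<partial>lborel) * v y \<partial>N) = (\<integral>x. w x * (\<integral>y. A (x - y) * v y \<partial>N) \<partial>lborel)" (is ?th1)
  "integrable lborel (\<lambda>x. w x * (\<integral>y. A (x - y) * v y \<partial>N))" (is ?th2)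
proof -
  have [measurable]: "A \<in> borel_measurable borel" "w \<in> borel_measurable borel" using A w Cc_measurable by auto
  note [measurable] = v(1)
  have [measurable_cong]: "sets N = sets borel" using N by (rule trans_bounded_sets)
  have b: "b \<ge> 0" using order.trans[OF norm_ge_zero v(2)] .
  have "(\<integral>\<^sup>+y. \<integral>\<^sup>+x. ennreal (cmod (A (x - y) * w x * v y)) \<partial>lborel \<partial>N) \<le>
      (\<integral>\<^sup>+y. \<integral>\<^sup>+x. ennreal b * ennreal (cmod (A (x - y) * w x)) \<partial>lborel \<partial>N)"
    using v(2) b
    by (intro nn_integral_mono) (auto simp: norm_mult mult_ac intro!: ennreal_leI mult_right_mono simp flip: ennreal_mult)
  also have "\<dots> = ennreal b * (\<integral>\<^sup>+y. \<integral>\<^sup>+x. ennreal (cmod (A (x - y) * w x)) \<partial>lborel \<partial>N)"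
    by (simp add: nn_integral_cmult)
  also have "\<dots> < \<infinity>" using nn_integral_shift_conv(2) by (simp add: ennreal_mult_less_top)
  finally have fin: "(\<integral>\<^sup>+y. \<integral>\<^sup>+x. ennreal (cmod (A (x - y) * w x * v y)) \<partial>lborel \<partial>N) < \<infinity>" .
  have m: "case_prod (\<lambda>y x. A (x - y) * w x * v y) \<in> borel_measurable (N \<Otimes>\<^sub>M lborel)" by measurable
  note F = Fubini_nn[OF trans_bounded_sigma_finite[OF N] sigma_finite_lborel m fin]
  have eq: "(\<integral>y. A (x - y) * w x * v y \<partial>N) = w x * (\<integral>y. A (x - y) * v y \<partial>N)" for x
    by (simp add: mult_ac flip: integral_mult_right_zero)
  show ?th2 using F(3) by (simp only: eq)
  show ?th1 using F(1) by (simp add: eq shift_conv_subst)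
qed

end

lemma integrable_shift_conv:
  assumes N: "trans_bounded N" and A: "Cc A" and w: "integrable lborel w"
  shows "integrable N (\<lambda>y. \<integral>x. A x * w (x + y) \<partial>lborel)"
proof -
  have [measurable]: "A \<in> borel_measurable borel" "w \<in> borel_measurable borel" using A w Cc_measurable by auto
  have [measurable_cong]: "sets N = sets borel" using N by (rule trans_bounded_sets)
  have "case_prod (\<lambda>y x. A x * w (x + y)) \<in> borel_measurable (N \<Otimes>\<^sub>M lborel)" by measurable
  then show ?thesis
    by (rule Fubini_nn(2)[OF trans_bounded_sigma_finite[OF N] sigma_finite_lborel _
          nn_integral_shift_conv(1)[OF N A w, where v="\<lambda>_. 0" and b=0]]) auto
qed

section \<open>Bounds for the transforms of mollifiers\<close>

lemma norm_iFT_dual_moll_le: "r > 0 \<Longrightarrow> cmod (iFT_dual (moll r) t) \<le> 1"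
  using norm_iFT_dual_le[of "moll r" t] by (simp add: integral_norm_moll)

lemma iFT_dual_moll_real: "iFT_dual (moll r) t = complex_of_real (Re (iFT_dual (moll r) t))"
proof -
  have "cnj (iFT_dual (moll r) t) = iFT_dual (moll r) t"
    using iFT_dual_invol[OF Cc_measurable[OF Cc_moll], of r t] by simp
  then show ?thesis by (metis Reals_cnj_iff of_real_Re)
qed

lemma cos_1_pos: "cos (1::real) > 0"
  using pi_gt3 by (intro cos_gt_zero_pi) auto

text \<open>On the support of \<open>moll r\<close> the phase has modulus at most 1, so the real
  part of the character is at least \<open>cos 1\<close> there, and averaging against a probability
  density keeps this bound.\<close>

lemma Re_iFT_dual_moll_ge:
  fixes t :: "real^'n"
  assumes r: "r > 0" and t: "r * norm t \<le> 1" shows "cos 1 \<le> Re (iFT_dual (moll r) t)"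
proof -
  have "cos 1 = (\<integral>x. cos 1 * cmod (moll r x) \<partial>(lborel :: (real^'n) measure))"
    by (simp add: integral_norm_moll r)
  also have "\<dots> \<le> (\<integral>x. Re (ch x t * moll r x) \<partial>lborel)"
  proof (rule Bochner_Integration.integral_mono)
    show "integrable lborel (\<lambda>x. cos 1 * cmod (moll r (x::real^'n)))" "integrable lborel (\<lambda>x. Re (ch x t * moll r x))"
      using Cc_integrable[OF Cc_moll[of r], where 'a='n] by (auto intro!: integrable_ch integrable_Re simp del: times_complex.sel)
    fix x :: "real^'n"
    have Re_ch: "Re (ch x t) = cos (x \<bullet> t)" by (simp add: ch_def Re_exp)
    have "cos 1 * cmod (moll r x) \<le> Re (ch x t) * cmod (moll r x)"
    proof (cases "norm x < r")
      case True
      have "\<bar>x \<bullet> t\<bar> \<le> norm x * norm t" by (rule Cauchy_Schwarz_ineq2)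
      also have "\<dots> \<le> r * norm t" using True by (intro mult_right_mono) auto
      finally have "cos 1 \<le> cos \<bar>x \<bullet> t\<bar>" using t pi_gt3 by (intro cos_monotone_0_pi_le) auto
      then show ?thesis by (intro mult_right_mono) (simp_all add: Re_ch)
    qed (simp add: moll_support)
    also have "\<dots> = Re (ch x t * moll r x)" by (subst (2) cmod_moll[symmetric]) simp
    finally show "cos 1 * cmod (moll r x) \<le> Re (ch x t * moll r x)" .
  qed
  also have "\<dots> = Re (iFT_dual (moll r) t)"
    unfolding iFT_dual_eq using integrable_ch[OF Cc_integrable[OF Cc_moll[of r]]]
    by (rule integral_Re)
  finally show ?thesis .
qed

lemma iFT_dual_moll_tendsto:
  "(\<lambda>m. iFT_dual (moll (1 / real (Suc m))) t) \<longlonglongrightarrow> 1"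
proof (rule LIMSEQ_I)
  fix e :: real assume e: "e > 0"
  have "isCont (\<lambda>x. ch x t) 0" unfolding ch_def by (intro continuous_intros)
  then obtain d where d: "d > 0" "\<And>x. norm x < d \<Longrightarrow> cmod (ch x t - 1) < e / 2"
    using e unfolding continuous_at_eps_delta by (metis ch_0(1) diff_zero dist_norm half_gt_zero)
  obtain n0 where n0: "1 / real (Suc n0) < d" using d(1) nat_approx_posE by metis
  show "\<exists>no. \<forall>n\<ge>no. norm (iFT_dual (moll (1 / real (Suc n))) t - 1) < e"
  proof (intro exI[of _ n0] allI impI)
    fix n assume n: "n0 \<le> n"
    let ?r = "1 / real (Suc n)"
    have r: "?r > 0" "?r < d" using n n0 by (auto intro: le_less_trans[rotated] simp: frac_le)
    have i: "integrable lborel (moll ?r :: real^'a \<Rightarrow> complex)" by (rule Cc_integrable[OF Cc_moll])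
    have "iFT_dual (moll ?r) t - 1 = (\<integral>x. (ch x t - 1) * moll ?r x \<partial>lborel)"
      unfolding iFT_dual_eq using integrable_ch[OF i, of t] i integral_moll[OF r(1), where 'n='a]
      by (simp add: left_diff_distrib)
    also have "cmod \<dots> \<le> (\<integral>x. e / 2 * cmod (moll ?r x) \<partial>(lborel :: (real^'a) measure))"
    proof (rule Bochner_Integration.integral_norm_bound_integral)
      show "integrable lborel (\<lambda>x. (ch x t - 1) * moll ?r x)"
        using integrable_ch[OF i, of t] i by (simp add: left_diff_distrib)
      show "cmod ((ch x t - 1) * moll ?r x) \<le> e / 2 * cmod (moll ?r x)" for x
      proof (cases "norm x < d")
        case True
        then show ?thesis unfolding norm_mult using d(2)[of x] by (intro mult_right_mono) auto
      next
        case False then have "moll ?r x = 0" using r by (intro moll_support) auto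
        then show ?thesis by simp
      qed
    qed (use i in auto)
    also have "\<dots> = e / 2" using integral_norm_moll[OF r(1), where 'n='a] by simp
    finally show "norm (iFT_dual (moll ?r) t - 1) < e" using e by simp
  qed
qed

text \<open>Writing \<open>g = iFT_dual A * g'\<close> with a small bump \<open>A\<close> bounds \<open>|iFT_dual g|\<^sup>2\<close> by local averages of
  the integrable function \<open>|iFT_dual g'|\<^sup>2\<close>.\<close>

lemma square_integrable_iFT_dual_trans_bounded:
  fixes g :: "real^'n \<Rightarrow> complex"
  assumes N: "trans_bounded N" and g: "Cc g" shows "integrable N (\<lambda>y. (cmod (iFT_dual g y))\<^sup>2)"
proof -
  have [measurable_cong]: "sets N = sets borel" using N by (rule trans_bounded_sets)
  obtain R where R: "R > 0" "\<And>x. R < norm x \<Longrightarrow> g x = 0" using g by (rule Cc_supportE) blast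
  \<comment> \<open>The radius \<open>1 / R\<close> is chosen so that \<open>iFT_dual A\<close> is
    at least \<open>cos 1\<close> on the whole ball of radius \<open>R\<close> that carries
    \<open>g\<close>.\<close>
  define A where "A = (moll (1 / R) :: real^'n \<Rightarrow> complex)"
  have A: "Cc A" "integrable lborel A" unfolding A_def using Cc_moll Cc_integrable by blast+
  \<comment> \<open>The maximum with \<open>cos 1\<close> keeps the denominator away from 0
    everywhere, hence \<open>g'\<close> continuous; where \<open>g\<close> lives it does not change
    the value of \<open>iFT_dual A\<close>.\<close>
  define g' where "g' t = inverse (complex_of_real (max (cos 1) (Re (iFT_dual A t)))) * g t" for t
  have "continuous_on UNIV (\<lambda>t. inverse (complex_of_real (max (cos 1) (Re (iFT_dual A t)))))"
    using cos_1_pos by (intro continuous_intros continuous_iFT_dual A) auto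
  then have g': "Cc g'" unfolding g'_def using g by (intro Cc_mult)
  have g_eq: "g = (\<lambda>t. iFT_dual A t * g' t)"
  proof
    fix t
    show "g t = iFT_dual A t * g' t"
    proof (cases "norm t \<le> R")
      case True
      then have "cos 1 \<le> Re (iFT_dual A t)"
        unfolding A_def using R by (intro Re_iFT_dual_moll_ge) (auto simp: field_simps)
      then show ?thesis using cos_1_pos iFT_dual_moll_real[of "1/R" t] unfolding g'_def A_def[symmetric]
        by (metis (no_types, lifting) less_le_trans max.absorb2 mult.assoc mult_1 of_real_eq_0_iff order_less_irrefl right_inverse)
    qed (use R in \<open>simp add: g'_def\<close>)
  qed
  define v where "v = iFT_dual g'"
  have v: "integrable lborel (\<lambda>x. (cmod (v x))\<^sup>2)" unfolding v_def by (rule square_integrable_iFT_dual[OF g'])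
  obtain K where K: "\<And>x. cmod (v x) \<le> K" unfolding v_def using norm_iFT_dual_le by metis
  have [measurable]: "v \<in> borel_measurable borel" "A \<in> borel_measurable borel" "g \<in> borel_measurable borel"
    unfolding v_def using g' A g Cc_measurable measurable_iFT_dual by blast+
  have bound: "ennreal ((cmod (iFT_dual g y))\<^sup>2) \<le> (\<integral>\<^sup>+x. ennreal (cmod (A x * complex_of_real ((cmod (v (x + y)))\<^sup>2))) \<partial>lborel)" for y
  proof -
    define z where "z = cmod (iFT_dual g y)"
    have "0 \<le> K" using order.trans[OF norm_ge_zero K] .
    then have i: "integrable lborel (\<lambda>x. A x * v (x + y))"
      by (intro Bochner_Integration.integrable_bound[of _ "\<lambda>x. cmod (A x) * K" "\<lambda>x. A x * v (x + y)"])
        (use A K in \<open>auto simp: norm_mult intro!: mult_left_mono AE_I2\<close>)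
    have i2: "integrable lborel (\<lambda>x. cmod (A x) * (cmod (v (x + y)))\<^sup>2)"
    proof (rule Bochner_Integration.integrable_bound[of _ "\<lambda>x. K\<^sup>2 * cmod (A x)"])
      show "AE x in lborel. norm (cmod (A x) * (cmod (v (x + y)))\<^sup>2) \<le> norm (K\<^sup>2 * cmod (A x))"
        using K by (intro AE_I2) (auto simp: mult.commute[of "cmod (A _)"] intro!: mult_right_mono power_mono)
    qed (use A in auto)
    have "iFT_dual g y = (\<integral>x. A x * v (x + y) \<partial>lborel)"
      unfolding v_def by (subst g_eq) (rule iFT_dual_mult[OF A(2) Cc_integrable[OF g']])
    \<comment> \<open>This is Cauchy-Schwarz for the probability density \<open>cmod (A x)\<close>,
      in the form \<open>2 z |v| \<le> z^2 + |v|^2\<close>: half of \<open>z^2\<close> is absorbed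
      on the left.\<close>
    then have "z * z \<le> z * (\<integral>x. cmod (A x * v (x + y)) \<partial>lborel)"
      unfolding z_def by (intro mult_left_mono) auto
    also have "\<dots> = (\<integral>x. z * cmod (A x * v (x + y)) \<partial>lborel)" by simp
    also have "\<dots> \<le> (\<integral>x. cmod (A x) * z\<^sup>2 / 2 + cmod (A x) * (cmod (v (x + y)))\<^sup>2 / 2 \<partial>lborel)"
    proof (rule Bochner_Integration.integral_mono)
      fix x
      have "z * cmod (v (x + y)) \<le> z\<^sup>2 / 2 + (cmod (v (x + y)))\<^sup>2 / 2"
        using sum_squares_bound[of z "cmod (v (x + y))"] by simp
      from mult_left_mono[OF this norm_ge_zero[of "A x"]]
      show "z * cmod (A x * v (x + y)) \<le> cmod (A x) * z\<^sup>2 / 2 + cmod (A x) * (cmod (v (x + y)))\<^sup>2 / 2"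
        by (simp add: norm_mult algebra_simps)
    qed (use i i2 A in auto)
    also have "\<dots> = z\<^sup>2 / 2 + (\<integral>x. cmod (A x) * (cmod (v (x + y)))\<^sup>2 \<partial>lborel) / 2"
      using i2 A integral_norm_moll[of "1/R", where 'n='n] R(1) by (simp add: A_def)
    finally have "z\<^sup>2 \<le> (\<integral>x. cmod (A x) * (cmod (v (x + y)))\<^sup>2 \<partial>lborel)" by (simp add: power2_eq_square)
    then show ?thesis
      using i2 by (simp add: z_def norm_mult norm_power nn_integral_eq_integral del: of_real_power ennreal_power)
  qed
  have "(\<integral>\<^sup>+y. ennreal ((cmod (iFT_dual g y))\<^sup>2) \<partial>N) \<le>
      (\<integral>\<^sup>+y. \<integral>\<^sup>+x. ennreal (cmod (A x * complex_of_real ((cmod (v (x + y)))\<^sup>2))) \<partial>lborel \<partial>N)"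
    by (intro nn_integral_mono bound)
  also have "\<dots> < \<infinity>"
    using v by (intro nn_integral_shift_conv(1)[OF N A(1), where v="\<lambda>_. 0" and b=0]) (auto simp del: of_real_power)
  finally show ?thesis by (intro integrableI_bounded) auto
qed

section \<open>Duality of transform pairs\<close>

text \<open>The measure \<open>v N\<close> is the Fourier transform of \<open>u M\<close>.  The densities are only bounded, so that
  \<open>\<phi>(t) dt\<close> is covered without a polar decomposition.\<close>

locale transform_pair =
  fixes M N :: "(real^'n) measure" and u v :: "real^'n \<Rightarrow> complex" and b :: real
  assumes M: "trans_bounded M" and N: "trans_bounded N"
    and u: "u \<in> borel_measurable borel" "\<And>x. cmod (u x) \<le> b"
    and v: "v \<in> borel_measurable borel" "\<And>x. cmod (v x) \<le> b"
    and transform: "\<And>g. Cc g \<Longrightarrow> (\<integral>x. conv g (invol g) x * u x \<partial>M) =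
      (\<integral>x. complex_of_real ((cmod (iFT_dual g x))\<^sup>2) * v x \<partial>N)"
begin

lemma b_nonneg: "0 \<le> b"
  using order.trans[OF norm_ge_zero u(2)] .

lemma meas [measurable_cong]: "sets M = sets borel" "sets N = sets borel"
  using M N trans_bounded_sets by auto

declare u(1) [measurable] v(1) [measurable]

lemma integrable_Cc: "Cc f \<Longrightarrow> integrable M (\<lambda>x. f x * u x)"
  using integrable_shift[OF M _ u, of f 0] by simp

lemma integrable_iFT_dual_product:
  assumes f: "Cc f" and g: "Cc g"
  shows "integrable N (\<lambda>x. iFT_dual f x * cnj (iFT_dual g x) * v x)"
proof (rule Bochner_Integration.integrable_bound)
  have [measurable]: "f \<in> borel_measurable borel" "g \<in> borel_measurable borel"
    using f g by (auto intro: Cc_measurable)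
  show "(\<lambda>x. iFT_dual f x * cnj (iFT_dual g x) * v x) \<in> borel_measurable N" by measurable
  show "integrable N (\<lambda>x. ((cmod (iFT_dual f x))\<^sup>2 + (cmod (iFT_dual g x))\<^sup>2) * b)"
    using square_integrable_iFT_dual_trans_bounded[OF N] f g by auto
  have "cmod (iFT_dual f x) * cmod (iFT_dual g x) \<le> (cmod (iFT_dual f x))\<^sup>2 + (cmod (iFT_dual g x))\<^sup>2" for x
    using sum_squares_bound[of "cmod (iFT_dual f x)" "cmod (iFT_dual g x)"]
      mult_nonneg_nonneg[OF norm_ge_zero norm_ge_zero, of "iFT_dual f x" "iFT_dual g x"] by linarith
  then have "cmod (iFT_dual f x * cnj (iFT_dual g x) * v x) \<le>
      ((cmod (iFT_dual f x))\<^sup>2 + (cmod (iFT_dual g x))\<^sup>2) * b" for x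
    unfolding norm_mult complex_mod_cnj using v(2) by (intro mult_mono) auto
  then show "AE x in N. cmod (iFT_dual f x * cnj (iFT_dual g x) * v x) \<le>
      norm (((cmod (iFT_dual f x))\<^sup>2 + (cmod (iFT_dual g x))\<^sup>2) * b)"
    using b_nonneg by (intro AE_I2) (simp only: real_norm_def, rule order.trans, assumption, rule abs_ge_self)
qed

text \<open>Both sides are sesquilinear and agree on the diagonal. Testing with
  \<open>f + c g\<close>, the value \<open>c = 1\<close> gives the sum of the two mixed terms and
  \<open>c = \<i>\<close> their difference.\<close>

lemma polarized_transform:
  assumes f: "Cc f" and g: "Cc g"
  shows "(\<integral>x. conv f (invol g) x * u x \<partial>M) = (\<integral>x. iFT_dual f x * cnj (iFT_dual g x) * v x \<partial>N)"
proof -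
  define L where "L f g = (\<integral>x. conv f (invol g) x * u x \<partial>M)" for f g
  define R where "R f g = (\<integral>x. iFT_dual f x * cnj (iFT_dual g x) * v x \<partial>N)" for f g
  have diag: "L h h = R h h" if "Cc h" for h
    unfolding L_def R_def transform[OF that] by (simp add: complex_norm_square del: of_real_power)
  have expand: "L (\<lambda>x. f x + c * g x) (\<lambda>x. f x + c * g x) = L f f + cnj c * L f g + c * L g f + c * cnj c * L g g"
    "R (\<lambda>x. f x + c * g x) (\<lambda>x. f x + c * g x) = R f f + cnj c * R f g + c * R g f + c * cnj c * R g g" for c
  proof -
    have i: "integrable lborel (\<lambda>y. h (x - y) * invol k y)" if "Cc h" "Cc k" for h k x
      using that by (intro Cc_integrable Cc_mult Cc_invol Cc_cont Cc_diff_left)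
    have "conv (\<lambda>x. f x + c * g x) (invol (\<lambda>x. f x + c * g x)) x =
        conv f (invol f) x + cnj c * conv f (invol g) x + c * conv g (invol f) x + c * cnj c * conv g (invol g) x" for x
    proof -
      have "(f (x - y) + c * g (x - y)) * invol (\<lambda>x. f x + c * g x) y =
          f (x - y) * invol f y + cnj c * (f (x - y) * invol g y) + c * (g (x - y) * invol f y)
            + c * cnj c * (g (x - y) * invol g y)" for y
        by (simp add: invol_def algebra_simps)
      then show ?thesis
        unfolding conv_def using i[OF f f, of x] i[OF f g, of x] i[OF g f, of x] i[OF g g, of x] by simp
    qed
    then have "(\<lambda>x. conv (\<lambda>x. f x + c * g x) (invol (\<lambda>x. f x + c * g x)) x * u x) = (\<lambda>x.
        conv f (invol f) x * u x + cnj c * (conv f (invol g) x * u x) + c * (conv g (invol f) x * u x)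
          + c * cnj c * (conv g (invol g) x * u x))"
      by (simp add: fun_eq_iff algebra_simps)
    then show "L (\<lambda>x. f x + c * g x) (\<lambda>x. f x + c * g x) = L f f + cnj c * L f g + c * L g f + c * cnj c * L g g"
      unfolding L_def using f g by (simp add: integrable_Cc Cc_conv Cc_invol)
    have "iFT_dual (\<lambda>x. f x + c * g x) t = iFT_dual f t + c * iFT_dual g t" for t
      unfolding iFT_dual_eq
      using integrable_ch[OF Cc_integrable[OF f], of t] integrable_ch[OF Cc_integrable[OF g], of t]
      by (simp add: distrib_left mult.left_commute[of _ c])
    then have "(\<lambda>x. iFT_dual (\<lambda>x. f x + c * g x) x * cnj (iFT_dual (\<lambda>x. f x + c * g x) x) * v x) = (\<lambda>x.
        iFT_dual f x * cnj (iFT_dual f x) * v x + cnj c * (iFT_dual f x * cnj (iFT_dual g x) * v x)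
        + c * (iFT_dual g x * cnj (iFT_dual f x) * v x) + c * cnj c * (iFT_dual g x * cnj (iFT_dual g x) * v x))"
      by (simp add: fun_eq_iff algebra_simps)
    then show "R (\<lambda>x. f x + c * g x) (\<lambda>x. f x + c * g x) = R f f + cnj c * R f g + c * R g f + c * cnj c * R g g"
      unfolding R_def using f g by (simp add: integrable_iFT_dual_product)
  qed
  have "cnj c * L f g + c * L g f = cnj c * R f g + c * R g f" for c
    using expand[of c] diag[of "\<lambda>x. f x + c * g x"] diag[OF f] diag[OF g] Cc_add[OF f Cc_cmult[OF g, of c]]
    by simp
  from this[of 1] this[of \<i>]
  have 1: "L f g + L g f = R f g + R g f" and "\<i> * (L g f - L f g) = \<i> * (R g f - R f g)"
    by (simp_all add: algebra_simps)
  then have 2: "L g f - L f g = R g f - R f g" by simp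
  have "2 * L f g = (L f g + L g f) - (L g f - L f g)" by simp
  also have "\<dots> = (R f g + R g f) - (R g f - R f g)" unfolding 1 2 ..
  also have "\<dots> = 2 * R f g" by simp
  finally have "L f g = R f g" by simp
  then show ?thesis by (simp add: L_def R_def)
qed

text \<open>Polarisation covers \<open>conv k (q m)\<close>, since a mollifier is its own
  \<open>invol\<close>; then the mollifiers shrink. On the side of \<open>M\<close> all functions
  stay in one ball; on the side of \<open>N\<close> the transforms of the mollifiers are bounded by
  1 and tend to 1, so the assumed integrability of \<open>iFT_dual k\<close> dominates.\<close>

lemma transform_Cc:
  assumes k: "Cc k" and Fk: "integrable N (iFT_dual k)"
  shows "(\<integral>x. k x * u x \<partial>M) = (\<integral>x. iFT_dual k x * v x \<partial>N)"
proof -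
  define q where "q m = (moll (1 / real (Suc m)) :: real^'n \<Rightarrow> complex)" for m
  have q: "Cc (q m)" "integrable lborel (q m)" "integral\<^sup>L lborel (q m) = 1" "(\<integral>x. cmod (q m x) \<partial>lborel) = 1" for m
    unfolding q_def by (auto intro!: Cc_moll Cc_integrable integral_moll integral_norm_moll simp del: of_nat_Suc)
  obtain R where R: "R > 0" "\<And>x. R < norm x \<Longrightarrow> k x = 0" using k by (rule Cc_supportE) blast
  obtain B where B: "B > 0" "\<And>x. cmod (k x) \<le> B" using k by (rule Cc_boundE) blast
  have [measurable]: "k \<in> borel_measurable borel" "q m \<in> borel_measurable borel" "conv k (q m) \<in> borel_measurable borel" for m
    using k q Cc_measurable Cc_conv by blast+
  have lim: "(\<lambda>m. conv k (q m) x) \<longlonglongrightarrow> k x" for x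
  proof (rule LIMSEQ_I)
    fix e :: real assume e: "e > 0"
    obtain d where d: "d > 0" "\<And>q x. integrable lborel q \<Longrightarrow> (\<integral>y. q y \<partial>lborel) = 1 \<Longrightarrow>
        (\<integral>y. cmod (q y) \<partial>lborel) \<le> 1 \<Longrightarrow> (\<And>y. d \<le> norm y \<Longrightarrow> q y = 0) \<Longrightarrow> cmod (conv k q x - k x) \<le> e / 2"
      by (rule conv_approx_identity[OF k, of "e / 2"]) (use e in auto)
    obtain n0 where n0: "1 / real (Suc n0) < d" using d(1) nat_approx_posE by metis
    show "\<exists>no. \<forall>n\<ge>no. norm (conv k (q n) x - k x) < e"
    proof (intro exI[of _ n0] allI impI)
      fix n assume n: "n0 \<le> n"
      have "1 / real (Suc n) < d" using n n0 by (auto intro: le_less_trans[rotated] simp: frac_le)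
      then have "q n y = 0" if "d \<le> norm y" for y unfolding q_def using that by (intro moll_support) auto
      then have "cmod (conv k (q n) x - k x) \<le> e / 2" using q by (intro d(2)) auto
      then show "norm (conv k (q n) x - k x) < e" using e by simp
    qed
  qed
  have bd: "cmod (conv k (q m) x) \<le> B * indicator (cball 0 (R + 1)) x" for m x
  proof (cases "norm x \<le> R + 1")
    case True
    have "cmod (conv k (q m) x) \<le> (\<integral>y. B * cmod (q m y) \<partial>lborel)"
      unfolding conv_def
    proof (rule Bochner_Integration.integral_norm_bound_integral)
      show "integrable lborel (\<lambda>y. k (x - y) * q m y)"
        using k q by (intro Cc_integrable Cc_mult Cc_cont Cc_diff_left)
    qed (use B q in \<open>auto simp: norm_mult intro: mult_right_mono\<close>)
    then show ?thesis using True q by simp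
  next
    case False
    have "k (x - y) * q m y = 0" for y
    proof (cases "norm y \<le> 1")
      case True
      then show ?thesis using R(2)[of "x - y"] False norm_triangle_ineq2[of x y] by simp
    next
      case False
      then have "1 / real (Suc m) \<le> norm y" by (simp add: order.trans[of _ 1])
      then show ?thesis by (simp add: q_def moll_support del: of_nat_Suc)
    qed
    then have "conv k (q m) x = 0" unfolding conv_def by (simp only: Bochner_Integration.integral_zero)
    then show ?thesis using B by simp
  qed
  have "(\<lambda>m. \<integral>x. conv k (q m) x * u x \<partial>M) \<longlonglongrightarrow> (\<integral>x. k x * u x \<partial>M)"
  proof (rule integral_dominated_convergence[where w="\<lambda>x. B * b * indicator (cball 0 (R + 1)) x"])
    show "integrable M (\<lambda>y. B * b * indicator (cball 0 (R + 1)) y)"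
      using trans_bounded_finite[OF M] by (intro integrable_mult_right integrable_real_indicator) auto
    show "AE x in M. cmod (conv k (q m) x * u x) \<le> B * b * indicator (cball 0 (R + 1)) x" for m
    proof (rule AE_I2)
      fix x
      have "cmod (conv k (q m) x * u x) \<le> B * indicator (cball 0 (R + 1)) x * b"
        unfolding norm_mult using u(2)[of x] bd[of m x] B by (intro mult_mono) auto
      then show "cmod (conv k (q m) x * u x) \<le> B * b * indicator (cball 0 (R + 1)) x" by (simp add: mult_ac)
    qed
  qed (auto intro!: tendsto_mult lim)
  moreover have "(\<integral>x. conv k (q m) x * u x \<partial>M) = (\<integral>x. iFT_dual k x * cnj (iFT_dual (q m) x) * v x \<partial>N)" for m
    using polarized_transform[OF k q(1)[of m]] by (simp add: q_def)
  moreover have "(\<lambda>m. \<integral>x. iFT_dual k x * cnj (iFT_dual (q m) x) * v x \<partial>N) \<longlonglongrightarrow> (\<integral>x. iFT_dual k x * v x \<partial>N)"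
  proof (rule integral_dominated_convergence[where w="\<lambda>x. cmod (iFT_dual k x) * b"])
    show "AE x in N. (\<lambda>m. iFT_dual k x * cnj (iFT_dual (q m) x) * v x) \<longlonglongrightarrow> iFT_dual k x * v x"
    proof (rule AE_I2)
      fix x
      have "(\<lambda>m. iFT_dual k x * cnj (iFT_dual (q m) x) * v x) \<longlonglongrightarrow> iFT_dual k x * cnj 1 * v x"
        unfolding q_def by (intro tendsto_intros iFT_dual_moll_tendsto)
      then show "(\<lambda>m. iFT_dual k x * cnj (iFT_dual (q m) x) * v x) \<longlonglongrightarrow> iFT_dual k x * v x" by simp
    qed
    show "AE x in N. cmod (iFT_dual k x * cnj (iFT_dual (q m) x) * v x) \<le> cmod (iFT_dual k x) * b" for m
    proof (rule AE_I2)
      fix x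
      have "cmod (iFT_dual (q m) x) \<le> 1" unfolding q_def by (rule norm_iFT_dual_moll_le) simp
      then have "cmod (iFT_dual k x) * cmod (iFT_dual (q m) x) * cmod (v x) \<le> cmod (iFT_dual k x) * 1 * b"
        using v(2)[of x] by (intro mult_mono) auto
      then show "cmod (iFT_dual k x * cnj (iFT_dual (q m) x) * v x) \<le> cmod (iFT_dual k x) * b" by (simp add: norm_mult)
    qed
  qed (use Fk in auto)
  ultimately show ?thesis by (simp add: LIMSEQ_unique)
qed

text \<open>The cutoff \<open>\<rho>\<close> makes \<open>iFT_dual A\<close> an admissible test
  function. The transform of the product is an average of translates of
  \<open>iFT_dual \<rho>\<close> against \<open>A\<close>, which is integrable for the translation
  bounded \<open>N\<close>; Fubini then carries the translates over to \<open>A\<close>.\<close>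

lemma transform_product:
  assumes A: "Cc A" and \<rho>: "Cc \<rho>" and F\<rho>: "integrable lborel (iFT_dual \<rho>)"
  shows "(\<integral>s. iFT_dual A s * \<rho> s * u s \<partial>M) = (\<integral>x. iFT_dual \<rho> x * (\<integral>y. A (x - y) * v y \<partial>N) \<partial>lborel)"
proof -
  have k: "Cc (\<lambda>s. iFT_dual A s * \<rho> s)" using \<rho> continuous_iFT_dual[OF Cc_integrable[OF A]] by (rule Cc_mult)
  have F: "iFT_dual (\<lambda>s. iFT_dual A s * \<rho> s) = (\<lambda>y. \<integral>x. A x * iFT_dual \<rho> (x + y) \<partial>lborel)"
    using iFT_dual_mult[OF Cc_integrable[OF A] Cc_integrable[OF \<rho>]] by blast
  show ?thesis
    using transform_Cc[OF k] integrable_shift_conv[OF N A F\<rho>] shift_conv_Fubini(1)[OF N A F\<rho> v]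
    unfolding F by simp
qed

end

text \<open>The value is \<open>(2\<pi>)\<^sup>n\<close>, but only its positivity matters here.\<close>

definition inversion_const :: "'n::finite itself \<Rightarrow> real" where
  "inversion_const _ = (\<integral>x. (cmod (iFT_dual (moll 1) x))\<^sup>2 \<partial>(lborel :: (real^'n) measure)) /
     (\<integral>x. (cmod (moll 1 x))\<^sup>2 \<partial>(lborel :: (real^'n) measure))"

lemma integral_square_moll_pos: "(\<integral>x. (cmod (moll 1 x))\<^sup>2 \<partial>(lborel :: (real^'n) measure)) > 0"
proof -
  let ?q = "moll 1 :: real^'n \<Rightarrow> complex"
  have "Cc (\<lambda>x. ?q x * ?q x)" by (intro Cc_mult Cc_moll Cc_cont)
  then have "integrable lborel (\<lambda>x. cmod (?q x * ?q x))" by (intro integrable_norm Cc_integrable)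
  then have i: "integrable lborel (\<lambda>x. (cmod (?q x))\<^sup>2)" by (simp add: norm_mult power2_eq_square)
  have "(\<integral>x. (cmod (?q x))\<^sup>2 \<partial>lborel) \<noteq> 0"
  proof
    assume "(\<integral>x. (cmod (?q x))\<^sup>2 \<partial>lborel) = 0"
    then have "AE x in lborel. ?q x = 0" using integral_nonneg_eq_0_iff_AE[OF i] by simp
    then have "(\<integral>x. ?q x \<partial>lborel) = 0" by (intro integral_eq_zero_AE)
    then show False using integral_moll[of 1, where 'n='n] by simp
  qed
  then show ?thesis by (simp add: less_le)
qed

lemma inversion_const_pos: "inversion_const TYPE('n::finite) > 0"
proof -
  let ?F = "\<lambda>x::real^'n. (cmod (iFT_dual (moll 1) x))\<^sup>2"
  have "0 < (cos 1)\<^sup>2 * measure lborel (ball (0::real^'n) 1)"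
    using content_ball_pos[of 1 "0::real^'n"] cos_1_pos by simp
  also have "\<dots> = (\<integral>x. (cos 1)\<^sup>2 * indicator (ball 0 1) x \<partial>(lborel :: (real^'n) measure))" by simp
  also have "\<dots> \<le> (\<integral>x. ?F x \<partial>lborel)"
  proof (rule Bochner_Integration.integral_mono)
    show "integrable lborel (\<lambda>x::real^'n. (cos 1)\<^sup>2 * indicat_real (ball 0 1) x)"
      using emeasure_lborel_ball_finite[of "0::real^'n" 1]
      by (intro integrable_mult_right integrable_real_indicator) auto
    show "integrable lborel ?F" by (rule square_integrable_iFT_dual[OF Cc_moll])
    show "(cos 1)\<^sup>2 * indicat_real (ball 0 1) x \<le> ?F x" for x
    proof (cases "norm x < 1")
      case True
      then have "cos 1 \<le> Re (iFT_dual (moll 1) x)" by (intro Re_iFT_dual_moll_ge) auto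
      also have "\<dots> \<le> cmod (iFT_dual (moll 1) x)" by (rule complex_Re_le_cmod)
      finally show ?thesis using cos_1_pos by (auto simp: indicator_def intro!: power_mono)
    qed (simp add: indicator_def)
  qed
  finally show ?thesis using integral_square_moll_pos[where 'n='n] by (simp add: inversion_const_def)
qed

context transform_pair
begin

text \<open>The dilates \<open>\<rho> n\<close> of one function \<open>w\<close> tend to the
  constant \<open>w 0\<close>, which recovers the full integral over \<open>M\<close>. Their
  transforms concentrate at 0 with fixed total mass, so the other side tends to that mass times the
  value at 0 of the continuous function \<open>H\<close>.\<close>

theorem dual_transform:
  assumes h: "Cc h"
  shows "(\<integral>x. complex_of_real ((cmod (iFT_dual h x))\<^sup>2) * u x \<partial>M) =
    complex_of_real (inversion_const TYPE('n)) * (\<integral>x. conv h (invol h) (- x) * v x \<partial>N)"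
proof -
  let ?q = "moll 1 :: real^'n \<Rightarrow> complex"
  \<comment> \<open>As a convolution square, \<open>w\<close> has the integrable transform
    \<open>|iFT_dual (moll 1)|^2\<close>, and \<open>w 0\<close> is the squared \<open>L^2\<close>
    norm of \<open>moll 1\<close>, hence positive.\<close>
  define w where "w = conv ?q (invol ?q)"
  have w: "Cc w" unfolding w_def by (intro Cc_conv Cc_invol Cc_moll)
  have Fw: "iFT_dual w = (\<lambda>t. complex_of_real ((cmod (iFT_dual ?q t))\<^sup>2))"
    unfolding w_def using iFT_dual_conv_invol[OF Cc_moll] by blast
  have Fwi: "integrable lborel (iFT_dual w)"
    unfolding Fw by (intro integrable_of_real square_integrable_iFT_dual Cc_moll)
  have w0: "w 0 = complex_of_real (\<integral>x. (cmod (?q x))\<^sup>2 \<partial>lborel)"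
    unfolding w_def conv_def by (simp add: complex_norm_square cmod_moll del: of_real_power flip: integral_complex_of_real) (simp add: moll_def)
  define A where "A = conv h (invol h)"
  have A: "Cc A" unfolding A_def using h by (intro Cc_conv Cc_invol)
  have FA: "iFT_dual A = (\<lambda>t. complex_of_real ((cmod (iFT_dual h t))\<^sup>2))"
    unfolding A_def using iFT_dual_conv_invol[OF h] by blast
  have FAi: "integrable M (iFT_dual A)"
    unfolding FA by (intro integrable_of_real square_integrable_iFT_dual_trans_bounded M h)
  \<comment> \<open>Only \<open>H 0\<close> is wanted. Translation boundedness of \<open>N\<close>
    makes \<open>H\<close> continuous and bounded, which the limit at 0 requires.\<close>
  define H where "H z = (\<integral>y. A (z - y) * v y \<partial>N)" for z
  have H_eq: "H z = (\<integral>y. A (- (- z + y)) * v y \<partial>N)" for z by (simp add: H_def)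
  have "continuous_on UNIV (\<lambda>z. \<integral>y. A (- (z + y)) * v y \<partial>N)"
    by (rule integral_shift_continuous[OF N Cc_reflect[OF A] v])
  then have Hc: "continuous_on UNIV H"
    unfolding H_eq[abs_def] by (rule continuous_on_compose2) (auto intro!: continuous_intros)
  obtain C where C: "0 \<le> C" "\<And>z. cmod (\<integral>y. A (- (z + y)) * v y \<partial>N) \<le> C"
    using integral_shift_bounded[OF N Cc_reflect[OF A] v] by metis
  have HC: "cmod (H z) \<le> C" for z unfolding H_eq by (rule C)
  have [measurable]: "H \<in> borel_measurable borel" "w \<in> borel_measurable borel" "A \<in> borel_measurable borel"
    using Hc w A by (auto intro: borel_measurable_continuous_onI Cc_measurable)
  obtain B where B: "B > 0" "\<And>x. cmod (w x) \<le> B" using w by (rule Cc_boundE) blast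
  define \<rho> where "\<rho> n s = w (s /\<^sub>R real (Suc n))" for n s
  have \<rho>: "Cc (\<rho> n)" "integrable lborel (iFT_dual (\<rho> n))" for n
    unfolding \<rho>_def[abs_def] using Cc_affine[OF w, of "inverse (real (Suc n))" 0] Fwi
    by (auto intro!: integrable_iFT_dual_scale simp del: of_nat_Suc)
  have to0: "(\<lambda>n. x /\<^sub>R real (Suc n)) \<longlonglongrightarrow> 0" for x :: "real^'n"
    using tendsto_scaleR[OF LIMSEQ_inverse_real_of_nat tendsto_const[of x]] by simp
  \<comment> \<open>Substituting \<open>x / (n + 1)\<close> moves the dilation from the transform of
    \<open>w\<close> to the argument of \<open>H\<close>, leaving a fixed integrable
    majorant.\<close>
  have eq: "(\<integral>s. iFT_dual A s * \<rho> n s * u s \<partial>M) = (\<integral>x. iFT_dual w x * H (x /\<^sub>R real (Suc n)) \<partial>lborel)" for n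
  proof -
    have "(\<integral>s. iFT_dual A s * \<rho> n s * u s \<partial>M) = (\<integral>x. iFT_dual (\<rho> n) x * H x \<partial>lborel)"
      unfolding H_def by (rule transform_product[OF A \<rho>])
    also have "\<dots> = (\<integral>x. complex_of_real (real (Suc n) ^ CARD('n)) * iFT_dual w (real (Suc n) *\<^sub>R x) * H x \<partial>lborel)"
      unfolding \<rho>_def[abs_def] by (subst iFT_dual_scale) auto
    also have "\<dots> = (\<integral>x. iFT_dual w x * H (x /\<^sub>R real (Suc n)) \<partial>lborel)"
      using integral_lborel_affine[of "\<lambda>x. iFT_dual w x * H (x /\<^sub>R real (Suc n))" "real (Suc n)" 0]
      by (simp add: scaleR_conv_of_real[where 'a=complex] mult.assoc del: of_nat_Suc)
    finally show ?thesis .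
  qed
  have "(\<lambda>n. \<integral>s. iFT_dual A s * \<rho> n s * u s \<partial>M) \<longlonglongrightarrow> (\<integral>s. iFT_dual A s * w 0 * u s \<partial>M)"
  proof (rule integral_dominated_convergence[where w="\<lambda>s. cmod (iFT_dual A s) * B * b"])
    have "isCont w 0" using Cc_cont[OF w] by (simp add: continuous_on_eq_continuous_at)
    then show "AE s in M. (\<lambda>n. iFT_dual A s * \<rho> n s * u s) \<longlonglongrightarrow> iFT_dual A s * w 0 * u s"
      unfolding \<rho>_def by (intro AE_I2 tendsto_intros isCont_tendsto_compose[of _ w] to0)
    show "AE s in M. cmod (iFT_dual A s * \<rho> n s * u s) \<le> cmod (iFT_dual A s) * B * b" for n
      using B u(2) by (intro AE_I2) (auto simp: norm_mult \<rho>_def intro!: mult_mono)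
  qed (use FAi in \<open>auto simp: \<rho>_def\<close>)
  moreover have "(\<lambda>n. \<integral>x. iFT_dual w x * H (x /\<^sub>R real (Suc n)) \<partial>lborel) \<longlonglongrightarrow> (\<integral>x. iFT_dual w x * H 0 \<partial>lborel)"
  proof (rule integral_dominated_convergence[where w="\<lambda>x. cmod (iFT_dual w x) * C"])
    have "isCont H 0" using Hc by (simp add: continuous_on_eq_continuous_at)
    then show "AE x in lborel. (\<lambda>n. iFT_dual w x * H (x /\<^sub>R real (Suc n))) \<longlonglongrightarrow> iFT_dual w x * H 0"
      by (intro AE_I2 tendsto_intros isCont_tendsto_compose[of _ H] to0)
    show "AE x in lborel. cmod (iFT_dual w x * H (x /\<^sub>R real (Suc n))) \<le> cmod (iFT_dual w x) * C" for n
      using HC by (intro AE_I2) (auto simp: norm_mult intro!: mult_left_mono)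
  qed (use Fwi in auto)
  ultimately have lim: "(\<integral>s. iFT_dual A s * w 0 * u s \<partial>M) = (\<integral>x. iFT_dual w x * H 0 \<partial>lborel)"
    unfolding eq by (rule LIMSEQ_unique)
  \<comment> \<open>The integral of \<open>iFT_dual w\<close> divided by \<open>w 0\<close> is
    \<open>inversion_const\<close> by definition.\<close>
  have "w 0 * (\<integral>s. iFT_dual A s * u s \<partial>M) = (\<integral>s. iFT_dual A s * w 0 * u s \<partial>M)"
    by (simp add: mult_ac flip: integral_mult_right_zero)
  also have "\<dots> = (\<integral>x. iFT_dual w x \<partial>lborel) * H 0" unfolding lim by simp
  also have "(\<integral>x. iFT_dual w x \<partial>lborel) = complex_of_real (\<integral>x. (cmod (iFT_dual ?q x))\<^sup>2 \<partial>lborel)"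
    unfolding Fw by (rule integral_complex_of_real)
  also have "H 0 = (\<integral>x. A (- x) * v x \<partial>N)" by (simp add: H_def)
  finally show ?thesis
    unfolding w0 FA unfolding A_def inversion_const_def using integral_square_moll_pos[where 'n='n] by (simp add: field_simps del: of_real_power)
qed

end

section \<open>Transformability\<close>

lemma trans_bounded_compact:
  assumes M: "trans_bounded M" and K: "compact K" shows "emeasure M K < \<infinity>"
proof -
  obtain R where "K \<subseteq> cball 0 R"
    using compact_imp_bounded[OF K] by (auto simp: bounded_iff subset_iff)
  then have "emeasure M K \<le> emeasure M (cball 0 R)"
    using trans_bounded_sets[OF M] by (intro emeasure_mono) auto
  then show ?thesis using trans_bounded_finite[OF M] by (rule le_less_trans)
qed

lemma translation_bounded_iff:
  assumes s: "sets (fst \<nu>) = sets borel"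
  shows "translation_bounded \<nu> \<longleftrightarrow> trans_bounded (fst \<nu>)"
proof
  assume t: "translation_bounded \<nu>"
  have "\<exists>C\<ge>0. \<forall>x. emeasure (fst \<nu>) (cball x R) \<le> ennreal C" for R
  proof -
    define S where "S = (SUP x. emeasure (fst \<nu>) ((\<lambda>y. x + y) ` cball 0 R))"
    have "S < \<infinity>" using t compact_cball unfolding translation_bounded_def S_def by blast
    moreover have "emeasure (fst \<nu>) (cball x R) \<le> S" for x
      unfolding S_def using cball_translation[of x 0 R] by (intro SUP_upper2[of x]) auto
    ultimately show ?thesis by (intro exI[of _ "enn2real S"]) (auto simp: less_top)
  qed
  then show "trans_bounded (fst \<nu>)" using s by (simp add: trans_bounded_def)
next
  assume t: "trans_bounded (fst \<nu>)"
  show "translation_bounded \<nu>" unfolding translation_bounded_def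
  proof safe
    fix K :: "'a set" assume "compact K"
    then obtain R where R: "K \<subseteq> cball 0 R"
      using compact_imp_bounded by (force simp: bounded_iff subset_iff)
    obtain C where C: "0 \<le> C" "\<And>x. emeasure (fst \<nu>) (cball x R) \<le> ennreal C"
      using trans_boundedE[OF t] by metis
    have "(\<lambda>y. x + y) ` K \<subseteq> cball x R" for x using R by (auto simp: dist_norm)
    then have "emeasure (fst \<nu>) ((\<lambda>y. x + y) ` K) \<le> ennreal C" for x
      using s by (intro order.trans[OF emeasure_mono C(2)]) auto
    then have "(SUP x. emeasure (fst \<nu>) ((\<lambda>y. x + y) ` K)) \<le> ennreal C" by (intro SUP_least)
    then show "(SUP x. emeasure (fst \<nu>) ((\<lambda>y. x + y) ` K)) < \<infinity>" by (rule le_less_trans) simp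
  qed
qed

text \<open>The positive factor goes into the variation measure, because the second component has to
  keep modulus 1.\<close>

definition reflect_radon :: "real \<Rightarrow> (real^'n) radon \<Rightarrow> (real^'n) radon" where
  "reflect_radon r \<nu> = (density (distr (fst \<nu>) borel uminus) (\<lambda>_. ennreal r), \<lambda>x. snd \<nu> (- x))"

lemma reflect_radon:
  assumes r: "r > 0" and t: "trans_bounded (fst \<nu>)"
    and u: "snd \<nu> \<in> borel_measurable borel" "\<And>x. cmod (snd \<nu> x) = 1"
  shows "is_radon (reflect_radon r \<nu>)" "trans_bounded (fst (reflect_radon r \<nu>))"
    and "f \<in> borel_measurable borel \<Longrightarrow>
      radon_integral (reflect_radon r \<nu>) f = complex_of_real r * radon_integral \<nu> (\<lambda>x. f (- x))"
    and "f \<in> borel_measurable borel \<Longrightarrow> radon_integrable \<nu> (\<lambda>x. f (- x)) \<Longrightarrow>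
      radon_integrable (reflect_radon r \<nu>) f"
proof -
  have [measurable_cong]: "sets (fst \<nu>) = sets borel" using t by (rule trans_bounded_sets)
  note [measurable] = u(1)
  show tb: "trans_bounded (fst (reflect_radon r \<nu>))"
    unfolding trans_bounded_def
  proof safe
    fix R
    obtain C where C: "0 \<le> C" "\<And>x. emeasure (fst \<nu>) (cball x R) \<le> ennreal C"
      using trans_boundedE[OF t] by metis
    have "emeasure (fst (reflect_radon r \<nu>)) (cball x R) \<le> ennreal (r * C)" for x
    proof -
      have "uminus -` cball x R \<inter> space (fst \<nu>) = cball (- x) R"
        using sets_eq_imp_space_eq[OF trans_bounded_sets[OF t]]
        by (auto simp: dist_norm norm_minus_commute add.commute)
      then show ?thesis using C r
        by (simp add: reflect_radon_def emeasure_density_const emeasure_distr ennreal_mult mult_left_mono)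
    qed
    then show "\<exists>C\<ge>0. \<forall>x. emeasure (fst (reflect_radon r \<nu>)) (cball x R) \<le> ennreal C"
      using C r by (intro exI[of _ "r * C"]) auto
  qed (auto simp: reflect_radon_def)
  show "is_radon (reflect_radon r \<nu>)"
    unfolding is_radon_def using trans_bounded_compact[OF tb] u(2) by (auto simp: reflect_radon_def)
  assume [measurable]: "f \<in> borel_measurable borel"
  show "radon_integral (reflect_radon r \<nu>) f = complex_of_real r * radon_integral \<nu> (\<lambda>x. f (- x))"
    unfolding radon_integral_def reflect_radon_def using r
    by (simp add: integral_density integral_distr scaleR_conv_of_real)
  show "radon_integrable (reflect_radon r \<nu>) f" if "radon_integrable \<nu> (\<lambda>x. f (- x))"
    using that r unfolding radon_integrable_def reflect_radon_def
    by (simp add: integrable_density integrable_distr_eq)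
qed

text \<open>If the unit balls around \<open>x\<^sub>n\<close> have measure at least \<open>8\<^sup>n\<close>, then \<open>g = \<Sum> 2\<^sup>-\<^sup>n ch(-x\<^sub>n) w\<close>, whose
  transform is a sum of nonnegative translates of \<open>iFT_dual w\<close>, violates the hypothesis.\<close>

lemma trans_boundedI_square_integrable:
  fixes M :: "(real^'n) measure"
  assumes s: "sets M = sets borel"
    and int: "\<And>g. Cc g \<Longrightarrow> integrable M (\<lambda>x. (cmod (iFT_dual g x))\<^sup>2)"
  shows "trans_bounded M"
proof -
  \<comment> \<open>A convolution square again: its transform is a square of a modulus, hence
    nonnegative, so the translates summed below cannot cancel, and on the unit ball it is at least
    \<open>c\<close>.\<close>
  define w where "w = conv (moll 1) (invol (moll 1 :: real^'n \<Rightarrow> complex))"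
  have w: "Cc w" unfolding w_def by (intro Cc_conv Cc_invol Cc_moll)
  have Fw: "iFT_dual w t = complex_of_real ((cmod (iFT_dual (moll 1) t))\<^sup>2)" for t
    unfolding w_def by (rule iFT_dual_conv_invol[OF Cc_moll])
  define c where "c = (cos (1::real))\<^sup>2"
  have c: "c > 0" using cos_1_pos by (simp add: c_def)
  have Fw_ge: "c \<le> Re (iFT_dual w t)" if "norm t \<le> 1" for t
  proof -
    have "cos 1 \<le> Re (iFT_dual (moll 1) t)" using that by (intro Re_iFT_dual_moll_ge) auto
    also have "\<dots> \<le> cmod (iFT_dual (moll 1) t)" by (rule complex_Re_le_cmod)
    finally show ?thesis using cos_1_pos unfolding Fw c_def by (auto intro: power_mono)
  qed
  have unit: "\<exists>C\<ge>0. \<forall>x. emeasure M (cball x 1) \<le> ennreal C"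
  proof (rule ccontr)
    assume "\<not> ?thesis"
    then have "\<forall>n. \<exists>x. ennreal (8 ^ n) < emeasure M (cball x 1)"
      by (metis not_le zero_le_power zero_le_numeral)
    then obtain x where x: "\<And>n. ennreal (8 ^ n) < emeasure M (cball (x n) 1)" by metis
    define S where "S t = (\<Sum>n. (1/2) ^ n * ch (- x n) t)" for t
    have sm: "summable (\<lambda>n. (1/2::real) ^ n)" by (rule summable_geometric) simp
    have "uniform_limit UNIV (\<lambda>N t. \<Sum>n<N. (1/2) ^ n * ch (- x n) t) S sequentially"
      unfolding S_def by (rule Weierstrass_m_test[OF _ sm]) (simp add: norm_mult norm_power)
    then have "continuous_on UNIV S"
      by (rule uniform_limit_theorem[rotated]) (auto intro!: always_eventually continuous_intros)
    then have g: "Cc (\<lambda>t. S t * w t)" using w by (intro Cc_mult)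
    have Fg: "iFT_dual (\<lambda>t. S t * w t) y = (\<Sum>n. (1/2) ^ n * iFT_dual w (y - x n))"
      and sFg: "summable (\<lambda>n. (1/2) ^ n * iFT_dual w (y - x n))" for y
    proof -
      define f where "f n t = (1/2) ^ n * (ch (y - x n) t * w t)" for n t
      have i: "integrable lborel (f n)" for n
        unfolding f_def ch_commute[of "y - x n"] by (intro integrable_mult_right integrable_ch Cc_integrable w)
      have nf: "norm (f n t) = (1/2) ^ n * cmod (w t)" for n t by (simp add: f_def norm_mult norm_power)
      have s1: "AE t in lborel. summable (\<lambda>n. norm (f n t))"
        unfolding nf by (intro AE_I2 summable_mult2 sm)
      have s2: "summable (\<lambda>n. \<integral>t. norm (f n t) \<partial>lborel)"
        unfolding nf by (simp add: summable_mult2 sm)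
      have If: "integral\<^sup>L lborel (f n) = (1/2) ^ n * iFT_dual w (y - x n)" for n
        by (simp add: f_def[abs_def] iFT_dual_def)
      have "S t * w t * ch y t = (\<Sum>n. f n t)" for t
      proof -
        have "summable (\<lambda>n. (1/2) ^ n * ch (- x n) t)"
          by (rule summable_norm_cancel) (simp add: norm_mult norm_power sm)
        from suminf_mult2[OF this, of "w t * ch y t"] show ?thesis
          unfolding S_def f_def by (simp add: mult_ac diff_conv_add_uminus[of y] ch_add_left del: add_uminus_conv_diff)
      qed
      then have "iFT_dual (\<lambda>t. S t * w t) y = (\<integral>t. (\<Sum>n. f n t) \<partial>lborel)"
        unfolding iFT_dual_def by (simp add: mult_ac)
      also have "\<dots> = (\<Sum>n. integral\<^sup>L lborel (f n))" by (rule integral_suminf[OF i s1 s2])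
      finally show "iFT_dual (\<lambda>t. S t * w t) y = (\<Sum>n. (1/2) ^ n * iFT_dual w (y - x n))" unfolding If .
      show "summable (\<lambda>n. (1/2) ^ n * iFT_dual w (y - x n))"
        using summable_integral[OF i s1 s2] unfolding If .
    qed
    have Fg_ge: "c / 2 ^ n \<le> cmod (iFT_dual (\<lambda>t. S t * w t) y)" if y: "y \<in> cball (x n) 1" for n y
    proof -
      have s: "summable (\<lambda>n. (1/2) ^ n * Re (iFT_dual w (y - x n)))"
        using summable_Re[OF sFg, of y] by (simp add: Re_power_real Fw)
      have "c / 2 ^ n \<le> (1/2) ^ n * Re (iFT_dual w (y - x n))"
        using Fw_ge[of "y - x n"] y by (simp add: dist_norm norm_minus_commute field_simps)
      also have "\<dots> \<le> (\<Sum>n. (1/2) ^ n * Re (iFT_dual w (y - x n)))"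
        using sum_le_suminf[OF s, of "{n}"] by (simp add: Fw)
      also have "\<dots> = Re (iFT_dual (\<lambda>t. S t * w t) y)"
        unfolding Fg using bounded_linear.suminf[OF bounded_linear_Re sFg, of y] by (simp add: Fw)
      also have "\<dots> \<le> cmod (iFT_dual (\<lambda>t. S t * w t) y)" by (rule complex_Re_le_cmod)
      finally show ?thesis .
    qed
    define I where "I = (\<integral>y. (cmod (iFT_dual (\<lambda>t. S t * w t) y))\<^sup>2 \<partial>M)"
    \<comment> \<open>A squared height of at least \<open>c^2 / 4^n\<close> on a ball of mass more
      than \<open>8^n\<close> contributes at least \<open>c^2 2^n\<close>, which no finite
      \<open>I\<close> bounds for all \<open>n\<close>.\<close>
    have "c\<^sup>2 * 2 ^ n \<le> I" for n
    proof -
      have "ennreal (c\<^sup>2 / 4 ^ n) * ennreal (8 ^ n) \<le> ennreal (c\<^sup>2 / 4 ^ n) * emeasure M (cball (x n) 1)"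
        using x[of n] by (intro mult_left_mono) auto
      also have "\<dots> = (\<integral>\<^sup>+y. ennreal (c\<^sup>2 / 4 ^ n) * indicator (cball (x n) 1) y \<partial>M)"
        using s by (subst nn_integral_cmult_indicator) auto
      also have "\<dots> \<le> (\<integral>\<^sup>+y. ennreal ((cmod (iFT_dual (\<lambda>t. S t * w t) y))\<^sup>2) \<partial>M)"
      proof (rule nn_integral_mono)
        fix y
        have "c\<^sup>2 / 4 ^ n \<le> (cmod (iFT_dual (\<lambda>t. S t * w t) y))\<^sup>2" if "y \<in> cball (x n) 1"
        proof -
          have "(c / 2 ^ n)\<^sup>2 \<le> (cmod (iFT_dual (\<lambda>t. S t * w t) y))\<^sup>2"
            using Fg_ge[OF that] c by (intro power_mono) auto
          moreover have "(c / 2 ^ n)\<^sup>2 = c\<^sup>2 / 4 ^ n"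
            by (simp add: power_divide power2_eq_square flip: power_mult_distrib)
          ultimately show ?thesis by simp
        qed
        then show "ennreal (c\<^sup>2 / 4 ^ n) * indicator (cball (x n) 1) y \<le> ennreal ((cmod (iFT_dual (\<lambda>t. S t * w t) y))\<^sup>2)"
          by (auto simp: indicator_def intro: ennreal_leI)
      qed
      also have "\<dots> = ennreal I"
        unfolding I_def by (rule nn_integral_eq_integral[OF int[OF g]]) auto
      finally have "ennreal (c\<^sup>2 / 4 ^ n * 8 ^ n) \<le> ennreal I" by (subst ennreal_mult) auto
      moreover have "c\<^sup>2 / 4 ^ n * 8 ^ n = c\<^sup>2 * 2 ^ n"
        by (simp add: field_simps flip: power_mult_distrib)
      ultimately show ?thesis by (simp add: I_def ennreal_le_iff)
    qed
    then have "2 ^ n \<le> I / c\<^sup>2" for n using c by (simp add: field_simps)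
    moreover obtain n where "I / c\<^sup>2 < 2 ^ n" using real_arch_pow[of 2 "I / c\<^sup>2"] by auto
    ultimately show False by (meson not_le)
  qed
  then obtain C where C: "C \<ge> 0" "\<And>x. emeasure M (cball x 1) \<le> ennreal C" by auto
  \<comment> \<open>A ball of radius \<open>R\<close> is covered by translates of unit balls whose
    number depends on \<open>R\<close> but not on the centre.\<close>
  show ?thesis unfolding trans_bounded_def
  proof (intro conjI s allI)
    fix R :: real
    obtain K where K: "finite K" "cball (0::real^'n) R \<subseteq> (\<Union>k\<in>K. ball k 1)"
      using compact_cball[of "0::real^'n" R] unfolding compact_eq_totally_bounded by (meson zero_less_one)
    have "emeasure M (cball x R) \<le> ennreal (real (card K) * C)" for x
    proof -
      have "cball x R \<subseteq> (\<Union>k\<in>K. cball (x + k) 1)"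
      proof
        fix y assume "y \<in> cball x R"
        then have "y - x \<in> cball 0 R" by (simp add: dist_norm norm_minus_commute)
        then obtain k where "k \<in> K" "y - x \<in> ball k 1" using K(2) by blast
        then show "y \<in> (\<Union>k\<in>K. cball (x + k) 1)"
          by (intro UN_I[of k]) (auto simp: dist_norm algebra_simps)
      qed
      then have "emeasure M (cball x R) \<le> emeasure M (\<Union>k\<in>K. cball (x + k) 1)"
        using s K(1) by (intro emeasure_mono) auto
      also have "\<dots> \<le> (\<Sum>k\<in>K. emeasure M (cball (x + k) 1))"
        by (rule emeasure_subadditive_finite[OF K(1)]) (auto simp: s)
      also have "\<dots> \<le> (\<Sum>k\<in>K. ennreal C)" by (intro sum_mono C)
      also have "\<dots> = ennreal (real (card K) * C)"
        using C by (simp add: ennreal_mult ennreal_of_nat_eq_real_of_nat)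
      finally show ?thesis .
    qed
    then show "\<exists>C\<ge>0. \<forall>x. emeasure M (cball x R) \<le> ennreal C"
      using C by (intro exI[of _ "real (card K) * C"]) auto
  qed
qed

section \<open>From the associated measure to transformability and back\<close>

lemma iFT_eq: "iFT h t = complex_of_real (inverse ((2*pi) ^ CARD('n))) * iFT_dual h (t::real^'n)"
  by (simp add: iFT_def iFT_dual_eq)

lemma cmod_iFT_square:
  "(cmod (iFT h t))\<^sup>2 = (inverse ((2*pi) ^ CARD('n)))\<^sup>2 * (cmod (iFT_dual h (t::real^'n)))\<^sup>2"
  by (simp add: iFT_eq norm_mult power_mult_distrib norm_inverse norm_power)

lemma conv_invol_reflect:
  fixes g :: "real^'n \<Rightarrow> complex"
  assumes [measurable]: "g \<in> borel_measurable borel"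
  shows "conv (\<lambda>x. g (- x)) (invol (\<lambda>x. g (- x))) (- t) = conv g (invol g) t"
proof -
  have "conv (\<lambda>x. g (- x)) (invol (\<lambda>x. g (- x))) (- t) = (\<integral>y. g (t + y) * cnj (g y) \<partial>lborel)"
    by (simp add: conv_def invol_def add.commute)
  also have "\<dots> = conv g (invol g) t"
    unfolding conv_def invol_def
    using integral_lborel_shift(5)[of "\<lambda>y. g (t + y) * cnj (g y)"] by simp
  finally show ?thesis .
qed

lemma radon_integrable_square_iFT_dual:
  assumes "trans_bounded (fst \<nu>)" and u: "snd \<nu> \<in> borel_measurable borel" "\<And>x. cmod (snd \<nu> x) = 1"
    and g: "Cc g"
  shows "radon_integrable \<nu> (\<lambda>x. complex_of_real ((cmod (iFT_dual g x))\<^sup>2))"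
  unfolding radon_integrable_def
proof (rule Bochner_Integration.integrable_bound)
  show "integrable (fst \<nu>) (\<lambda>x. (cmod (iFT_dual g x))\<^sup>2)"
    by (rule square_integrable_iFT_dual_trans_bounded) fact+
  have [measurable_cong]: "sets (fst \<nu>) = sets borel" using assms(1) by (rule trans_bounded_sets)
  have [measurable]: "g \<in> borel_measurable borel" using g by (rule Cc_measurable)
  note [measurable] = u(1)
  show "(\<lambda>x. complex_of_real ((cmod (iFT_dual g x))\<^sup>2) * snd \<nu> x) \<in> borel_measurable (fst \<nu>)" by measurable
qed (simp add: norm_mult u del: of_real_power)

text \<open>The pair has \<open>\<nu>\<close> on its first side and a multiple of
  \<open>\<phi>\<close> against \<open>lborel\<close> on its second. Since
  \<open>dual_transform\<close> evaluates the convolution at \<open>- x\<close>, it is applied to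
  the reflected test function, and \<open>\<nu>\<close> has to be reflected in turn.\<close>

lemma assoc_radon_imp_density_transformable:
  fixes \<phi> :: "real^'n \<Rightarrow> complex"
  assumes \<phi>: "continuous_on UNIV \<phi>" "bounded (range \<phi>)"
    and \<nu>: "assoc_radon \<phi> \<nu>" "translation_bounded \<nu>"
  shows "density_transformable \<phi>"
proof -
  define c where "c = (inverse ((2*pi) ^ CARD('n)) :: real)"
  have c: "c > 0" by (simp add: c_def)
  obtain B where B: "\<And>x. cmod (\<phi> x) \<le> B" using \<phi>(2) by (auto simp: bounded_iff)
  have B0: "0 \<le> B" using order.trans[OF norm_ge_zero B] .
  have rad: "is_radon \<nu>" using \<nu>(1) by (simp add: assoc_radon_def)
  then have s: "sets (fst \<nu>) = sets borel" and unit: "snd \<nu> \<in> borel_measurable borel" "\<And>x. cmod (snd \<nu> x) = 1"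
    by (auto simp: is_radon_def)
  have tb: "trans_bounded (fst \<nu>)" using \<nu>(2) translation_bounded_iff[OF s] by simp
  have [measurable]: "\<phi> \<in> borel_measurable borel" using \<phi>(1) by (rule borel_measurable_continuous_onI)
  \<comment> \<open>The factor \<open>c^2\<close> is the square of the normalisation in
    \<open>iFT\<close>. One bound has to cover both densities, and that of \<open>\<nu>\<close> has
    modulus 1, whence the maximum.\<close>
  interpret transform_pair "fst \<nu>" lborel "snd \<nu>" "\<lambda>t. complex_of_real (c\<^sup>2) * \<phi> t" "max 1 (c\<^sup>2 * B)"
  proof
    show "cmod (complex_of_real (c\<^sup>2) * \<phi> t) \<le> max 1 (c\<^sup>2 * B)" for t
      using B[of t] by (auto simp: norm_mult norm_power intro!: max.coboundedI2 mult_left_mono)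
    fix g :: "real^'n \<Rightarrow> complex" assume "Cc g"
    then have "radon_integral \<nu> (conv g (invol g)) = (\<integral>t. complex_of_real ((cmod (iFT g t))\<^sup>2) * \<phi> t \<partial>lborel)"
      using \<nu>(1) by (simp add: assoc_radon_def)
    then show "(\<integral>x. conv g (invol g) x * snd \<nu> x \<partial>fst \<nu>) =
        (\<integral>x. complex_of_real ((cmod (iFT_dual g x))\<^sup>2) * (complex_of_real (c\<^sup>2) * \<phi> x) \<partial>lborel)"
      unfolding radon_integral_def cmod_iFT_square c_def by (simp add: mult_ac)
  qed (use tb unit in \<open>auto intro: trans_bounded_lborel\<close>)
  \<comment> \<open>Cancels the inversion constant and the factor \<open>c^2\<close> put into the
    density above.\<close>
  define r where "r = inverse (inversion_const TYPE('n) * c\<^sup>2)"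
  have r: "r > 0" using c inversion_const_pos[where 'n='n] by (simp add: r_def)
  note R = reflect_radon[OF r tb unit]
  show ?thesis unfolding density_transformable_def
  proof (intro exI[of _ "reflect_radon r \<nu>"] conjI allI impI R(1))
    fix g :: "real^'n \<Rightarrow> complex" assume g: "Cc g"
    have [measurable]: "g \<in> borel_measurable borel" using g by (rule Cc_measurable)
    have m: "(\<lambda>x. complex_of_real ((cmod (iFT_dual g x))\<^sup>2)) \<in> borel_measurable borel" by measurable
    have refl: "iFT_dual g (- x) = iFT_dual (\<lambda>x. g (- x)) x" for x by (simp add: iFT_dual_reflect)
    show "radon_integrable (reflect_radon r \<nu>) (\<lambda>x. complex_of_real ((cmod (iFT_dual g x))\<^sup>2))"
      using radon_integrable_square_iFT_dual[OF tb unit Cc_reflect[OF g]] by (intro R(4)[OF m]) (simp only: refl)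
    have "radon_integral (reflect_radon r \<nu>) (\<lambda>x. complex_of_real ((cmod (iFT_dual g x))\<^sup>2)) =
        complex_of_real r * (\<integral>x. complex_of_real ((cmod (iFT_dual (\<lambda>x. g (- x)) x))\<^sup>2) * snd \<nu> x \<partial>fst \<nu>)"
      unfolding R(3)[OF m] unfolding radon_integral_def refl ..
    also have "\<dots> = complex_of_real (r * inversion_const TYPE('n) * c\<^sup>2) * (\<integral>x. conv g (invol g) x * \<phi> x \<partial>lborel)"
      unfolding dual_transform[OF Cc_reflect[OF g]] by (simp add: conv_invol_reflect mult.left_commute[of _ "_\<^sup>2"])
    also have "r * inversion_const TYPE('n) * c\<^sup>2 = 1"
      using c inversion_const_pos[where 'n='n] unfolding r_def by (simp add: field_simps)
    finally show "(\<integral>t. conv g (invol g) t * \<phi> t \<partial>lborel) =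
        radon_integral (reflect_radon r \<nu>) (\<lambda>x. complex_of_real ((cmod (iFT_dual g x))\<^sup>2))" by simp
  qed
qed

text \<open>Now \<open>\<phi>\<close> against \<open>lborel\<close> is the first side of the pair
  and \<open>\<mu>\<close> the second, opposite to the preceding lemma. The integrability demanded
  of \<open>\<mu>\<close> is what yields its translation boundedness.\<close>

lemma density_transformableE:
  fixes \<phi> :: "real^'n \<Rightarrow> complex"
  assumes \<phi>: "continuous_on UNIV \<phi>" "bounded (range \<phi>)" and "density_transformable \<phi>"
  obtains \<mu> B where "trans_bounded (fst \<mu>)" "snd \<mu> \<in> borel_measurable borel" "\<And>x. cmod (snd \<mu> x) = 1"
    "transform_pair lborel (fst \<mu>) \<phi> (snd \<mu>) B"
proof -
  obtain \<mu> where \<mu>: "is_radon \<mu>" and int: "\<And>g. Cc g \<Longrightarrow> radon_integrable \<mu> (\<lambda>x. complex_of_real ((cmod (iFT_dual g x))\<^sup>2))"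
    and eq: "\<And>g. Cc g \<Longrightarrow> (\<integral>t. conv g (invol g) t * \<phi> t \<partial>lborel) =
          radon_integral \<mu> (\<lambda>x. complex_of_real ((cmod (iFT_dual g x))\<^sup>2))"
    using assms(3) unfolding density_transformable_def by blast
  obtain B where B: "\<And>x. cmod (\<phi> x) \<le> B" using \<phi>(2) by (auto simp: bounded_iff)
  have s: "sets (fst \<mu>) = sets borel" and unit: "snd \<mu> \<in> borel_measurable borel" "\<And>x. cmod (snd \<mu> x) = 1"
    using \<mu> by (auto simp: is_radon_def)
  have tb: "trans_bounded (fst \<mu>)"
  proof (rule trans_boundedI_square_integrable[OF s])
    fix g :: "real^'n \<Rightarrow> complex" assume "Cc g"
    from integrable_norm[OF int[OF this, unfolded radon_integrable_def]]
    show "integrable (fst \<mu>) (\<lambda>x. (cmod (iFT_dual g x))\<^sup>2)" by (simp add: norm_mult unit del: of_real_power)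
  qed
  have "transform_pair lborel (fst \<mu>) \<phi> (snd \<mu>) (max 1 B)"
  proof
    show "cmod (\<phi> x) \<le> max 1 B" for x using B[of x] by simp
  qed (use tb unit \<phi> eq in \<open>auto intro: trans_bounded_lborel borel_measurable_continuous_onI simp: radon_integral_def\<close>)
  then show ?thesis using that tb unit by blast
qed

lemma density_transformable_imp_assoc_radon:
  fixes \<phi> :: "real^'n \<Rightarrow> complex"
  assumes \<phi>: "continuous_on UNIV \<phi>" "bounded (range \<phi>)" and "density_transformable \<phi>"
  obtains \<nu> where "assoc_radon \<phi> \<nu>" "translation_bounded \<nu>"
proof -
  obtain \<mu> B where tb: "trans_bounded (fst \<mu>)" and unit: "snd \<mu> \<in> borel_measurable borel" "\<And>x. cmod (snd \<mu> x) = 1"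
    and "transform_pair lborel (fst \<mu>) \<phi> (snd \<mu>) B"
    using assms by (rule density_transformableE) blast
  then interpret transform_pair lborel "fst \<mu>" \<phi> "snd \<mu>" B by simp
  define c where "c = (inverse ((2*pi) ^ CARD('n)) :: real)"
  \<comment> \<open>The inversion constant undoes the factor in \<open>dual_transform\<close>, and
    \<open>c^2\<close> supplies the normalisation of \<open>iFT\<close>.\<close>
  define r where "r = c\<^sup>2 * inversion_const TYPE('n)"
  have r: "r > 0" unfolding r_def c_def
    by (intro mult_pos_pos zero_less_power positive_imp_inverse_positive inversion_const_pos) auto
  note R = reflect_radon[OF r tb unit]
  have "assoc_radon \<phi> (reflect_radon r \<mu>)"
    unfolding assoc_radon_def
  proof (intro conjI allI impI R(1))
    fix h :: "real^'n \<Rightarrow> complex" assume h: "Cc h"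
    have [measurable]: "h \<in> borel_measurable borel" "conv h (invol h) \<in> borel_measurable borel"
      using h Cc_measurable Cc_conv Cc_invol by blast+
    have eq: "complex_of_real ((cmod (iFT h t))\<^sup>2) * \<phi> t =
        complex_of_real (c\<^sup>2) * (complex_of_real ((cmod (iFT_dual h t))\<^sup>2) * \<phi> t)" for t
      by (simp add: cmod_iFT_square c_def)
    have "integrable lborel (\<lambda>t. complex_of_real ((cmod (iFT_dual h t))\<^sup>2) * \<phi> t)"
      by (rule Bochner_Integration.integrable_bound[of _ "\<lambda>t. (cmod (iFT_dual h t))\<^sup>2 * B"])
        (use square_integrable_iFT_dual[OF h] b_nonneg u in
          \<open>auto simp: norm_mult norm_power intro!: AE_I2 mult_left_mono\<close>)
    then show "integrable lborel (\<lambda>t. complex_of_real ((cmod (iFT h t))\<^sup>2) * \<phi> t)"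
      unfolding eq by (rule integrable_mult_right)
    have "radon_integral (reflect_radon r \<mu>) (conv h (invol h)) =
        complex_of_real (c\<^sup>2) * (\<integral>t. complex_of_real ((cmod (iFT_dual h t))\<^sup>2) * \<phi> t \<partial>lborel)"
      unfolding dual_transform[OF h] R(3)[OF \<open>conv h (invol h) \<in> borel_measurable borel\<close>]
      by (simp add: radon_integral_def r_def)
    also have "\<dots> = (\<integral>t. complex_of_real ((cmod (iFT h t))\<^sup>2) * \<phi> t \<partial>lborel)"
      unfolding eq by (simp only: integral_mult_right_zero)
    finally show "radon_integral (reflect_radon r \<mu>) (conv h (invol h)) =
        (\<integral>t. complex_of_real ((cmod (iFT h t))\<^sup>2) * \<phi> t \<partial>lborel)" .
  qed
  moreover have "translation_bounded (reflect_radon r \<mu>)"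
    using R(2) by (subst translation_bounded_iff) (auto simp: trans_bounded_sets)
  ultimately show ?thesis using that by blast
qed

section \<open>Local convergence in mean\<close>

text \<open>The norm is attained by the conjugate sign of \<open>p\<close>, which is almost
  everywhere a limit of continuous functions; these are pulled into the unit disc and cut off, and
  dominated convergence finishes.\<close>

lemma L1_duality:
  fixes p :: "real^'n \<Rightarrow> complex"
  assumes p: "integrable lborel p" and e: "e > 0"
  obtains \<eta> where "Cc \<eta>" "\<And>x. cmod (\<eta> x) \<le> 1" "(\<integral>x. cmod (p x) \<partial>lborel) - e < cmod (\<integral>x. p x * \<eta> x \<partial>lborel)"
proof -
  define f where "f x = cnj (sgn (p x))" for x
  have [measurable]: "p \<in> borel_measurable borel" using p by simp
  have pf: "p x * f x = complex_of_real (cmod (p x))" for x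
    by (simp add: f_def sgn_eq complex_norm_square[symmetric] power2_eq_square)
  have f1: "cmod (f x) \<le> 1" for x by (simp add: f_def norm_sgn)
  have "f \<in> borel_measurable borel" unfolding f_def sgn_eq by measurable
  then have "f \<in> borel_measurable lebesgue" by (simp add: measurable_completion)
  then have "f measurable_on UNIV" by (rule lebesgue_measurable_imp_measurable_on) simp
  then obtain N g where N: "negligible N" and g: "\<And>n. continuous_on UNIV (g n)"
    and lim: "\<And>x. x \<notin> N \<Longrightarrow> (\<lambda>n. g n x) \<longlonglongrightarrow> f x"
    unfolding measurable_on_def by auto
  \<comment> \<open>The quotient projects \<open>g n x\<close> to the closed unit disc and fixes the
    limit, which already lies there; the last factor is a continuous cutoff at radius
    \<open>n\<close>.\<close>
  define \<eta> where "\<eta> n x = g n x / complex_of_real (max 1 (cmod (g n x))) * complex_of_real (max 0 (min 1 (real n - norm x)))"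
    for n :: nat and x
  have \<eta>: "Cc (\<eta> n)" for n
  proof (rule CcI[where R="real n"])
    show "continuous_on UNIV (\<eta> n)" unfolding \<eta>_def by (intro continuous_intros g) auto
  qed (simp add: \<eta>_def)
  have \<eta>1: "cmod (\<eta> n x) \<le> 1" for n x
  proof -
    have "cmod (\<eta> n x) = cmod (g n x) / max 1 (cmod (g n x)) * max 0 (min 1 (real n - norm x))"
      by (simp add: \<eta>_def norm_mult norm_divide)
    also have "\<dots> \<le> 1 * 1" by (intro mult_mono) auto
    finally show ?thesis by simp
  qed
  have \<eta>lim: "(\<lambda>n. \<eta> n x) \<longlonglongrightarrow> f x" if "x \<notin> N" for x
  proof -
    have "(\<lambda>n. max 0 (min 1 (real n - norm x))) \<longlonglongrightarrow> 1"
    proof (rule tendsto_eventually, rule eventually_mono[OF eventually_ge_at_top])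
      fix n :: nat assume "nat \<lceil>norm x + 1\<rceil> \<le> n"
      then have "norm x + 1 \<le> real n" by linarith
      then show "max 0 (min 1 (real n - norm x)) = 1" by simp
    qed
    then have "(\<lambda>n. \<eta> n x) \<longlonglongrightarrow> f x / complex_of_real (max 1 (cmod (f x))) * complex_of_real 1"
      unfolding \<eta>_def by (intro tendsto_intros lim that) auto
    then show ?thesis using f1[of x] by (simp add: max_absorb1)
  qed
  have "(\<lambda>n. \<integral>x. p x * \<eta> n x \<partial>lborel) \<longlonglongrightarrow> (\<integral>x. p x * f x \<partial>lborel)"
  proof (rule integral_dominated_convergence[where w="\<lambda>x. cmod (p x)"])
    have "AE x in lebesgue. x \<notin> N" using N by (simp add: negligible_iff_null_sets AE_not_in)
    then have "AE x in lborel. x \<notin> N" by (simp add: AE_completion_iff)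
    then show "AE x in lborel. (\<lambda>n. p x * \<eta> n x) \<longlonglongrightarrow> p x * f x"
      by eventually_elim (intro tendsto_intros \<eta>lim)
    show "AE x in lborel. cmod (p x * \<eta> n x) \<le> cmod (p x)" for n
      using mult_left_mono[OF \<eta>1 norm_ge_zero] by (intro AE_I2) (simp add: norm_mult)
  qed (use p Cc_measurable[OF \<eta>] in \<open>auto simp: f_def sgn_eq\<close>)
  also have "(\<integral>x. p x * f x \<partial>lborel) = complex_of_real (\<integral>x. cmod (p x) \<partial>lborel)"
    unfolding pf by (rule integral_complex_of_real)
  finally have "(\<lambda>n. cmod (\<integral>x. p x * \<eta> n x \<partial>lborel)) \<longlonglongrightarrow> cmod (complex_of_real (\<integral>x. cmod (p x) \<partial>lborel))"
    by (rule tendsto_norm)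
  moreover have "cmod (complex_of_real (\<integral>x. cmod (p x) \<partial>lborel)) = (\<integral>x. cmod (p x) \<partial>lborel)" by simp
  ultimately have "eventually (\<lambda>n. (\<integral>x. cmod (p x) \<partial>lborel) - e < cmod (\<integral>x. p x * \<eta> n x \<partial>lborel)) sequentially"
    using e by (intro order_tendstoD(1)) auto
  then obtain n where "(\<integral>x. cmod (p x) \<partial>lborel) - e < cmod (\<integral>x. p x * \<eta> n x \<partial>lborel)"
    unfolding eventually_sequentially by blast
  then show ?thesis using that \<eta> \<eta>1 by blast
qed

section \<open>The doubled mollifier and Fourier inversion\<close>

definition moll2 :: "real \<Rightarrow> real^'n \<Rightarrow> complex" where
  "moll2 r = conv (moll r) (moll r)"

lemma Cc_moll2: "Cc (moll2 r)"
  unfolding moll2_def by (intro Cc_conv Cc_moll)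

text \<open>The reason for doubling: the transform of \<open>moll r\<close> is only known to be
  square integrable, whereas that of \<open>moll2 r\<close> is its squared modulus, nonnegative and
  integrable.\<close>

lemma iFT_dual_moll2: "iFT_dual (moll2 r) t = complex_of_real ((cmod (iFT_dual (moll r) t))\<^sup>2)"
  using iFT_dual_conv_invol[OF Cc_moll, of r t] by (simp add: moll2_def)

lemma integral_moll2:
  assumes "r > 0" shows "(\<integral>x. moll2 r x \<partial>(lborel :: (real^'n) measure)) = 1"
proof -
  have "iFT_dual (moll2 r) (0::real^'n) = iFT_dual (moll r) (0::real^'n) * iFT_dual (moll r) (0::real^'n)"
    unfolding moll2_def by (intro iFT_dual_conv Cc_integrable Cc_moll)
  then show ?thesis using integral_moll[OF assms, where 'n='n] by (simp add: iFT_dual_def)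
qed

lemma integral_norm_moll2:
  assumes "r > 0" shows "(\<integral>x. cmod (moll2 r x) \<partial>(lborel :: (real^'n) measure)) \<le> 1"
  using integral_norm_conv_le[of "moll r :: real^'n \<Rightarrow> complex" "moll r"] Cc_integrable[OF Cc_moll[of r], where 'a='n]
    integral_norm_moll[OF assms, where 'n='n]
  by (simp add: moll2_def)

lemma moll2_support: "2 * r \<le> norm x \<Longrightarrow> moll2 r x = 0"
proof -
  assume x: "2 * r \<le> norm x"
  have "moll r (x - y) * moll r y = 0" for y
    using x norm_triangle_ineq[of "x - y" y] by (cases "r \<le> norm y") (auto simp: moll_support)
  then show ?thesis unfolding moll2_def conv_def by (simp only: Bochner_Integration.integral_zero)
qed

lemma trans_bounded_return: "trans_bounded (return borel s)"
  unfolding trans_bounded_def by (auto intro!: exI[of _ 1] simp: indicator_def)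

text \<open>Fourier inversion for \<open>moll2\<close>: the character \<open>ch s\<close> and the Dirac measure at \<open>s\<close> form a
  transform pair.\<close>

lemma iFT_dual_square_moll:
  fixes s :: "real^'n"
  shows "iFT_dual (\<lambda>x. complex_of_real ((cmod (iFT_dual (moll r) x))\<^sup>2)) s =
    complex_of_real (inversion_const TYPE('n)) * moll2 r (- s)"
proof -
  interpret transform_pair lborel "return borel s" "ch s" "\<lambda>_. 1" 1
  proof
    show "ch s \<in> borel_measurable borel" by measurable
    fix g :: "real^'n \<Rightarrow> complex" assume g: "Cc g"
    have "(\<integral>x. conv g (invol g) x * ch s x \<partial>lborel) = iFT_dual (conv g (invol g)) s"
      by (simp add: iFT_dual_def mult.commute)
    also have "\<dots> = (\<integral>x. complex_of_real ((cmod (iFT_dual g x))\<^sup>2) * 1 \<partial>return borel s)"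
      using Cc_measurable[OF g] by (subst integral_return) (auto simp: iFT_dual_conv_invol[OF g])
    finally show "(\<integral>x. conv g (invol g) x * ch s x \<partial>lborel) =
      (\<integral>x. complex_of_real ((cmod (iFT_dual g x))\<^sup>2) * 1 \<partial>return borel s)" .
  qed (auto intro: trans_bounded_lborel trans_bounded_return)
  have [measurable]: "moll2 r \<in> borel_measurable borel" by (rule Cc_measurable[OF Cc_moll2])
  have "(\<integral>x. moll2 r (- x) * 1 \<partial>return borel s) = moll2 r (- s)" by (subst integral_return) auto
  then show ?thesis using dual_transform[OF Cc_moll[of r]] by (simp add: iFT_dual_def moll2_def[symmetric] mult.commute del: of_real_power)
qed

text \<open>By inversion \<open>moll2 r\<close> is itself the transform of an integrable function,
  so the multiplication formula turns the convolution into the transform of a product. Such smoothed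
  test functions can be paired with any sequence whose transforms are small in the uniform
  norm.\<close>

lemma conv_moll2_eq_iFT_dual:
  fixes \<eta> :: "real^'n \<Rightarrow> complex"
  assumes \<eta>: "Cc \<eta>"
  obtains b where "integrable lborel b" "\<And>x. conv \<eta> (moll2 r) x = iFT_dual b x"
proof -
  define g where "g t = complex_of_real ((cmod (iFT_dual (moll r) (t::real^'n)))\<^sup>2)" for t
  define \<kappa> where "\<kappa> = complex_of_real (inversion_const TYPE('n))"
  have \<kappa>: "\<kappa> \<noteq> 0" using inversion_const_pos[where 'n='n] by (simp add: \<kappa>_def)
  have g: "integrable lborel g" unfolding g_def by (intro integrable_of_real square_integrable_iFT_dual Cc_moll)
  have [measurable]: "\<eta> \<in> borel_measurable borel" "moll2 r \<in> borel_measurable borel" "g \<in> borel_measurable borel"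
    using Cc_measurable[OF \<eta>] Cc_measurable[OF Cc_moll2] g by auto
  define b' where "b' t = inverse \<kappa> * (iFT_dual \<eta> t * g t)" for t
  have b': "integrable lborel b'" unfolding b'_def
  proof (intro integrable_mult_right, rule Bochner_Integration.integrable_bound)
    show "integrable lborel (\<lambda>t. (\<integral>x. cmod (\<eta> x) \<partial>lborel) * cmod (g t))" using g by auto
    show "AE t in lborel. cmod (iFT_dual \<eta> t * g t) \<le> norm ((\<integral>x. cmod (\<eta> x) \<partial>lborel) * cmod (g t))"
      using norm_iFT_dual_le[of \<eta>] by (intro AE_I2) (auto simp: norm_mult intro!: mult_right_mono)
  qed simp
  have "conv \<eta> (moll2 r) x = iFT_dual (\<lambda>t. b' (- t)) x" for x
  proof -
    have "\<kappa> * conv \<eta> (moll2 r) x = (\<integral>y. \<eta> (x + y) * (\<kappa> * moll2 r (- y)) \<partial>lborel)"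
      by (simp add: conv_eq_shift mult.left_commute[of _ \<kappa>])
    also have "\<dots> = (\<integral>y. \<eta> (x + y) * iFT_dual g y \<partial>lborel)"
      unfolding g_def \<kappa>_def iFT_dual_square_moll ..
    also have "\<dots> = (\<integral>t. iFT_dual (\<lambda>y. \<eta> (x + y)) t * g t \<partial>lborel)"
      by (intro integral_iFT_dual_swap g integrable_lborel_shift(1) Cc_integrable \<eta>)
    also have "\<dots> = (\<integral>t. ch (- x) t * iFT_dual \<eta> t * g t \<partial>lborel)"
      using iFT_dual_translate[of \<eta> "- x"] by (simp add: add.commute)
    also have "ch (- x) t * iFT_dual \<eta> t * g t = \<kappa> * (ch (- x) t * b' t)" for t
      using \<kappa> by (simp add: b'_def)
    then have "(\<integral>t. ch (- x) t * iFT_dual \<eta> t * g t \<partial>lborel) = \<kappa> * iFT_dual b' (- x)"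
      by (simp only: iFT_dual_def[of b'] integral_mult_right_zero)
    finally show ?thesis using \<kappa> b' by (simp add: iFT_dual_reflect)
  qed
  moreover have "integrable lborel (\<lambda>t. b' (- t))" using b' by (rule integrable_lborel_shift(5))
  ultimately show ?thesis using that by blast
qed

lemma integrable_Cc_mult:
  assumes "Cc h" "integrable lborel f" shows "integrable lborel (\<lambda>x. h x * f x)"
proof -
  have [measurable]: "h \<in> borel_measurable borel" "f \<in> borel_measurable borel"
    using assms by (auto intro: Cc_measurable)
  obtain B where B: "B > 0" "\<And>x. cmod (h x) \<le> B" using assms(1) by (rule Cc_boundE) blast
  show ?thesis
    by (rule Bochner_Integration.integrable_bound[of _ "\<lambda>x. B * cmod (f x)"])
      (use assms(2) B in \<open>auto simp: norm_mult intro!: AE_I2 mult_right_mono\<close>)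
qed

section \<open>Uniformly vanishing transforms and local Cauchy sequences\<close>

context
  fixes d :: "nat \<Rightarrow> real^'n \<Rightarrow> complex"
  assumes d: "\<And>k. integrable lborel (d k)"
    and F: "\<And>e. e > 0 \<Longrightarrow> \<exists>K. \<forall>k\<ge>K. \<forall>t. cmod (iFT_dual (d k) t) \<le> e"
    and Cauchy: "\<And>h e. Cc h \<Longrightarrow> e > 0 \<Longrightarrow> \<exists>K. \<forall>j\<ge>K. \<forall>k\<ge>K. (\<integral>x. cmod (h x * d j x - h x * d k x) \<partial>lborel) < e"
begin

lemma d_measurable [measurable]: "d k \<in> borel_measurable borel"
  using d[of k] by simp

lemmas integrable_Cc_mult_d = integrable_Cc_mult[OF _ d]

text \<open>Replace \<open>\<eta>\<close> by \<open>conv \<eta> (moll2 r) = iFT_dual b\<close>: its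
  integral against \<open>d k\<close> equals that of \<open>b\<close> against
  \<open>iFT_dual (d k)\<close>, which is uniformly small. The replacement error is small and lives
  near the support of \<open>\<eta>\<close>, where the local Cauchy property keeps the
  \<open>L^1\<close> norms of \<open>d k\<close> bounded.\<close>

lemma test_function_tendsto_0:
  assumes \<eta>: "Cc \<eta>" and e: "e > 0"
  shows "\<exists>K. \<forall>k\<ge>K. cmod (\<integral>x. \<eta> x * d k x \<partial>lborel) \<le> e"
proof -
  obtain R where R: "R > 0" "\<And>x. R < norm x \<Longrightarrow> \<eta> x = 0" using \<eta> by (rule Cc_supportE) blast
  \<comment> \<open>Radius \<open>R + 2\<close> makes the bump at least 1 on the ball of radius
    \<open>R + 1\<close>, which contains the support of the smoothing error.\<close>
  define h where "h x = complex_of_real (bump (R + 2) (x::real^'n))" for x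
  have h: "Cc h" unfolding h_def by (rule Cc_bump)
  obtain K0 where K0: "\<And>k. k \<ge> K0 \<Longrightarrow> (\<integral>x. cmod (h x * d k x - h x * d K0 x) \<partial>lborel) < 1"
    using Cauchy[OF h, of 1] by fastforce
  define L where "L = 1 + (\<integral>x. cmod (h x * d K0 x) \<partial>lborel)"
  have L0: "L \<ge> 1" by (simp add: L_def)
  have L: "(\<integral>x. cmod (h x * d k x) \<partial>lborel) \<le> L" if "k \<ge> K0" for k
  proof -
    have "(\<integral>x. cmod (h x * d k x) \<partial>lborel) \<le>
        (\<integral>x. cmod (h x * d k x - h x * d K0 x) + cmod (h x * d K0 x) \<partial>lborel)"
    proof (rule Bochner_Integration.integral_mono)
      show "cmod (h x * d k x) \<le> cmod (h x * d k x - h x * d K0 x) + cmod (h x * d K0 x)" for x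
        using norm_triangle_ineq[of "h x * d k x - h x * d K0 x" "h x * d K0 x"] by simp
    qed (use integrable_Cc_mult_d[OF h] in auto)
    also have "\<dots> \<le> L" unfolding L_def using K0[OF that] integrable_Cc_mult_d[OF h] by simp
    finally show ?thesis .
  qed
  obtain \<delta> where \<delta>: "\<delta> > 0" "\<And>q x. integrable lborel q \<Longrightarrow> (\<integral>y. q y \<partial>lborel) = 1 \<Longrightarrow>
      (\<integral>y. cmod (q y) \<partial>lborel) \<le> 1 \<Longrightarrow> (\<And>y. \<delta> \<le> norm y \<Longrightarrow> q y = 0) \<Longrightarrow> cmod (conv \<eta> q x - \<eta> x) \<le> e / (2 * L)"
    by (rule conv_approx_identity[OF \<eta>, of "e / (2 * L)"]) (use e L0 in auto)
  \<comment> \<open>\<open>moll2 r\<close> vanishes outside the ball of radius \<open>2 * r\<close>;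
    this must not exceed \<open>\<delta>\<close> for the approximation, nor 1 for the support of the
    error.\<close>
  define r where "r = min (1/2) (\<delta> / 2)"
  have r: "r > 0" "2 * r \<le> \<delta>" "2 * r \<le> 1" using \<delta>(1) by (auto simp: r_def)
  have close: "cmod (conv \<eta> (moll2 r) x - \<eta> x) \<le> e / (2 * L)" for x
    using r by (intro \<delta>(2) Cc_integrable Cc_moll2 integral_moll2 integral_norm_moll2 moll2_support) auto
  have supp: "conv \<eta> (moll2 r) x - \<eta> x = 0" if x: "R + 1 < norm x" for x
  proof -
    have "\<eta> (x - y) * moll2 r y = 0" for y
      using x r R(2)[of "x - y"] norm_triangle_ineq[of "x - y" y] by (cases "2 * r \<le> norm y") (auto simp: moll2_support)
    then have "conv \<eta> (moll2 r) x = 0" unfolding conv_def by (simp only: Bochner_Integration.integral_zero)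
    then show ?thesis using R x by simp
  qed
  have bd: "cmod ((conv \<eta> (moll2 r) x - \<eta> x) * d k x) \<le> e / (2 * L) * cmod (h x * d k x)" for x k
  proof (cases "norm x \<le> R + 1")
    case True
    then have "1 \<le> cmod (h x)" unfolding h_def norm_of_real by (simp add: bump_def)
    then have "cmod (conv \<eta> (moll2 r) x - \<eta> x) * 1 \<le> e / (2 * L) * cmod (h x)"
      using close[of x] e L0 by (intro mult_mono) auto
    from mult_right_mono[OF this norm_ge_zero[of "d k x"]] show ?thesis by (simp add: norm_mult mult_ac)
  qed (use supp[of x] e L0 in auto)
  obtain b where b: "integrable lborel b" "\<And>x. conv \<eta> (moll2 r) x = iFT_dual b x"
    using conv_moll2_eq_iFT_dual[OF \<eta>] by metis
  define Ib where "Ib = (\<integral>x. cmod (b x) \<partial>lborel) + 1"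
  have Ib: "Ib > 0" "(\<integral>x. cmod (b x) \<partial>lborel) \<le> Ib" unfolding Ib_def by (auto intro: add_nonneg_pos)
  obtain K1 where K1: "\<And>k t. k \<ge> K1 \<Longrightarrow> cmod (iFT_dual (d k) t) \<le> e / (2 * Ib)"
    using F[of "e / (2 * Ib)"] e Ib by auto
  have \<eta>': "Cc (conv \<eta> (moll2 r))" by (intro Cc_conv \<eta> Cc_moll2)
  show ?thesis
  proof (intro exI[of _ "max K0 K1"] allI impI)
    fix k assume k: "max K0 K1 \<le> k"
    have i: "integrable lborel (\<lambda>x. (conv \<eta> (moll2 r) x - \<eta> x) * d k x)"
      using integrable_Cc_mult_d[OF \<eta>'] integrable_Cc_mult_d[OF \<eta>] by (simp add: left_diff_distrib)
    have "(\<integral>x. (conv \<eta> (moll2 r) x - \<eta> x) * d k x \<partial>lborel) =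
        (\<integral>x. conv \<eta> (moll2 r) x * d k x \<partial>lborel) - (\<integral>x. \<eta> x * d k x \<partial>lborel)"
      using integrable_Cc_mult_d[OF \<eta>'] integrable_Cc_mult_d[OF \<eta>] by (simp add: left_diff_distrib)
    then have "(\<integral>x. \<eta> x * d k x \<partial>lborel) = (\<integral>x. d k x * iFT_dual b x \<partial>lborel) - (\<integral>x. (conv \<eta> (moll2 r) x - \<eta> x) * d k x \<partial>lborel)"
      by (simp add: b(2) mult.commute)
    also have "(\<integral>x. d k x * iFT_dual b x \<partial>lborel) = (\<integral>x. iFT_dual (d k) x * b x \<partial>lborel)"
      by (rule integral_iFT_dual_swap[OF d b(1)])
    finally have eq: "(\<integral>x. \<eta> x * d k x \<partial>lborel) =
        (\<integral>x. iFT_dual (d k) x * b x \<partial>lborel) - (\<integral>x. (conv \<eta> (moll2 r) x - \<eta> x) * d k x \<partial>lborel)" .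
    have "cmod (\<integral>x. \<eta> x * d k x \<partial>lborel) \<le>
        cmod (\<integral>x. iFT_dual (d k) x * b x \<partial>lborel) + cmod (\<integral>x. (conv \<eta> (moll2 r) x - \<eta> x) * d k x \<partial>lborel)"
      unfolding eq by (rule norm_triangle_ineq4)
    also have "cmod (\<integral>x. iFT_dual (d k) x * b x \<partial>lborel) \<le> (\<integral>x. e / (2 * Ib) * cmod (b x) \<partial>lborel)"
    proof (rule Bochner_Integration.integral_norm_bound_integral)
      show le: "cmod (iFT_dual (d k) x * b x) \<le> e / (2 * Ib) * cmod (b x)" for x
        unfolding norm_mult using k by (intro mult_right_mono K1) auto
      show "integrable lborel (\<lambda>x. e / (2 * Ib) * cmod (b x))" using b(1) by simp
      then show "integrable lborel (\<lambda>x. iFT_dual (d k) x * b x)"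
        by (rule Bochner_Integration.integrable_bound) (use b(1) e Ib(1) in \<open>auto simp: abs_mult intro!: AE_I2 order.trans[OF le]\<close>)
    qed
    also have "\<dots> \<le> e / 2" using b(1) Ib e by (simp add: field_simps)
    also have "cmod (\<integral>x. (conv \<eta> (moll2 r) x - \<eta> x) * d k x \<partial>lborel) \<le> (\<integral>x. e / (2 * L) * cmod (h x * d k x) \<partial>lborel)"
      by (rule Bochner_Integration.integral_norm_bound_integral[OF i _ bd])
        (use integrable_Cc_mult_d[OF h] in \<open>intro integrable_mult_right integrable_norm\<close>)
    also have "\<dots> = e / (2 * L) * (\<integral>x. cmod (h x * d k x) \<partial>lborel)" by (rule integral_mult_right_zero)
    also have "\<dots> \<le> e / (2 * L) * L" using L[of k] k e L0 by (intro mult_left_mono) auto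
    also have "\<dots> = e / 2" using L0 by simp
    finally show "cmod (\<integral>x. \<eta> x * d k x \<partial>lborel) \<le> e" by simp
  qed
qed

text \<open>Duality turns the norm of \<open>h\<close> times \<open>d k\<close> into a test
  integral, but its test function \<open>\<eta>\<close> depends on \<open>k\<close>. The local
  Cauchy property allows \<open>d k\<close> to be exchanged for \<open>d j\<close>, with
  \<open>j\<close> chosen after \<open>\<eta>\<close> and as large as \<open>\<eta>\<close>
  demands.\<close>

lemma local_L1_tendsto_0:
  assumes h: "Cc h" shows "(\<lambda>k. \<integral>x. cmod (h x * d k x) \<partial>lborel) \<longlonglongrightarrow> 0"
proof (rule LIMSEQ_I)
  fix e :: real assume e: "e > 0"
  obtain K where K: "\<And>j k. j \<ge> K \<Longrightarrow> k \<ge> K \<Longrightarrow> (\<integral>x. cmod (h x * d j x - h x * d k x) \<partial>lborel) < e / 4"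
    using Cauchy[OF h, of "e / 4"] e by auto
  note i = integrable_Cc_mult_d[OF h]
  have "(\<integral>x. cmod (h x * d k x) \<partial>lborel) < e" if k: "k \<ge> K" for k
  proof -
    obtain \<eta> where \<eta>: "Cc \<eta>" "\<And>x. cmod (\<eta> x) \<le> 1"
      "(\<integral>x. cmod (h x * d k x) \<partial>lborel) - e / 4 < cmod (\<integral>x. h x * d k x * \<eta> x \<partial>lborel)"
      by (rule L1_duality[OF i, of "e / 4"]) (use e in auto)
    have "Cc (\<lambda>x. h x * \<eta> x)" using \<eta>(1) h by (intro Cc_mult Cc_cont)
    from test_function_tendsto_0[OF this, of "e / 4"] e
    obtain K' where K': "\<And>j. j \<ge> K' \<Longrightarrow> cmod (\<integral>x. h x * \<eta> x * d j x \<partial>lborel) \<le> e / 4" by auto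
    define j where "j = max K K'"
    have [measurable]: "\<eta> \<in> borel_measurable borel" "h \<in> borel_measurable borel" using \<eta> h by (auto intro: Cc_measurable)
    have i\<eta>: "integrable lborel (\<lambda>x. h x * d m x * \<eta> x)" for m
      by (rule Bochner_Integration.integrable_bound[OF i[of m]])
        (use \<eta>(2) in \<open>auto simp: norm_mult intro!: AE_I2 mult_right_le_one_le\<close>)
    have "(\<integral>x. (h x * d k x - h x * d j x) * \<eta> x \<partial>lborel) =
        (\<integral>x. h x * d k x * \<eta> x \<partial>lborel) - (\<integral>x. h x * d j x * \<eta> x \<partial>lborel)"
      using i\<eta>[of k] i\<eta>[of j] by (simp add: left_diff_distrib)
    moreover have "(\<integral>x. h x * d j x * \<eta> x \<partial>lborel) = (\<integral>x. h x * \<eta> x * d j x \<partial>lborel)"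
      by (simp add: mult_ac)
    ultimately have "(\<integral>x. h x * d k x * \<eta> x \<partial>lborel) =
        (\<integral>x. (h x * d k x - h x * d j x) * \<eta> x \<partial>lborel) + (\<integral>x. h x * \<eta> x * d j x \<partial>lborel)"
      by (simp only: diff_add_cancel)
    then have "cmod (\<integral>x. h x * d k x * \<eta> x \<partial>lborel) \<le>
        cmod (\<integral>x. (h x * d k x - h x * d j x) * \<eta> x \<partial>lborel) + cmod (\<integral>x. h x * \<eta> x * d j x \<partial>lborel)"
      by (simp add: norm_triangle_ineq)
    also have "cmod (\<integral>x. (h x * d k x - h x * d j x) * \<eta> x \<partial>lborel) \<le> (\<integral>x. cmod (h x * d k x - h x * d j x) \<partial>lborel)"
    proof (rule Bochner_Integration.integral_norm_bound_integral)
      show "integrable lborel (\<lambda>x. (h x * d k x - h x * d j x) * \<eta> x)"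
        using i\<eta>[of k] i\<eta>[of j] by (simp add: left_diff_distrib)
      show "cmod ((h x * d k x - h x * d j x) * \<eta> x) \<le> cmod (h x * d k x - h x * d j x)" for x
        using mult_left_mono[OF \<eta>(2) norm_ge_zero[of "h x * d k x - h x * d j x"]] by (simp only: norm_mult mult_1_right)
    qed (use i in auto)
    also have "\<dots> \<le> e / 4" using K[OF k, of j] by (simp add: j_def)
    also have "cmod (\<integral>x. h x * \<eta> x * d j x \<partial>lborel) \<le> e / 4" by (rule K') (simp add: j_def)
    finally show ?thesis using \<eta>(3) e by simp
  qed
  then show "\<exists>no. \<forall>n\<ge>no. norm ((\<integral>x. cmod (h x * d n x) \<partial>lborel) - 0) < e"
    by (intro exI[of _ K]) auto
qed

end

section \<open>Local boundedness\<close>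

text \<open>The index sets of all \<open>normVs\<close> united over the centres \<open>s\<close>, so
  that a bound on the double supremum \<open>normV\<close> becomes one universally quantified
  inequality between reals.\<close>

definition unit_trig_coeffs :: "(real^'n \<Rightarrow> complex) set" where
  "unit_trig_coeffs = {c. finite {t. c t \<noteq> 0} \<and> (\<exists>s. {t. c t \<noteq> 0} \<subseteq> cball s (1/4)) \<and>
        (\<forall>x. cmod (\<Sum>t\<in>{t. c t \<noteq> 0}. c t * ch x t) \<le> 1)}"

lemma normV_le_iff:
  "normV f \<le> ereal e \<longleftrightarrow> (\<forall>c\<in>unit_trig_coeffs. cmod (\<Sum>t\<in>{t. c t \<noteq> 0}. c t * f t) \<le> e)"
  unfolding normV_def normVs_def unit_trig_coeffs_def by (auto simp: SUP_le_iff)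

lemma normV_add:
  assumes "normV f \<le> ereal a" "normV g \<le> ereal b"
  shows "normV (\<lambda>t. f t + g t) \<le> ereal (a + b)"
  unfolding normV_le_iff
proof
  fix c :: "real^'a \<Rightarrow> complex" assume c: "c \<in> unit_trig_coeffs"
  have "(\<Sum>t\<in>{t. c t \<noteq> 0}. c t * (f t + g t)) = (\<Sum>t\<in>{t. c t \<noteq> 0}. c t * f t) + (\<Sum>t\<in>{t. c t \<noteq> 0}. c t * g t)"
    by (simp add: distrib_left sum.distrib)
  also have "cmod \<dots> \<le> a + b"
    using assms c unfolding normV_le_iff by (intro norm_triangle_le add_mono) auto
  finally show "cmod (\<Sum>t\<in>{t. c t \<noteq> 0}. c t * (f t + g t)) \<le> a + b" .
qed

lemma normV_minus_commute: "normV (\<lambda>t. f t - g t) \<le> ereal e \<longleftrightarrow> normV (\<lambda>t. g t - f t) \<le> ereal e"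
proof -
  have "cmod (\<Sum>t\<in>S. c t * (f t - g t)) = cmod (\<Sum>t\<in>S. c t * (g t - f t))" for S c
    by (simp add: right_diff_distrib sum_subtractf norm_minus_commute)
  then show ?thesis unfolding normV_le_iff by (simp only:)
qed

text \<open>Tested on the single character at \<open>t\<close>, whose modulus is 1. Thus convergence
  in \<open>normV\<close> implies uniform convergence.\<close>

lemma cmod_le_normV:
  assumes "normV f \<le> ereal e" shows "cmod (f t) \<le> e"
proof -
  define c :: "real^'a \<Rightarrow> complex" where "c s = (if s = t then 1 else 0)" for s
  have s: "{s. c s \<noteq> 0} = {t}" by (auto simp: c_def)
  have "c \<in> unit_trig_coeffs"
    unfolding unit_trig_coeffs_def using s by (auto simp: c_def intro!: exI[of _ t])
  with assms have "cmod (\<Sum>t\<in>{t. c t \<noteq> 0}. c t * f t) \<le> e" unfolding normV_le_iff by blast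
  then show ?thesis unfolding s by (simp add: c_def)
qed

lemma normV_tendsto_0_iff:
  "((\<lambda>k. normV (g k)) \<longlonglongrightarrow> 0) \<longleftrightarrow> (\<forall>e>0. \<exists>K. \<forall>k\<ge>K. normV (g k) \<le> ereal e)"
proof
  assume l: "(\<lambda>k. normV (g k)) \<longlonglongrightarrow> 0"
  show "\<forall>e>0. \<exists>K. \<forall>k\<ge>K. normV (g k) \<le> ereal e"
  proof (intro allI impI)
    fix e :: real assume "e > 0"
    then have "eventually (\<lambda>k. normV (g k) < ereal e) sequentially" by (intro order_tendstoD(2)[OF l]) auto
    then show "\<exists>K. \<forall>k\<ge>K. normV (g k) \<le> ereal e" unfolding eventually_sequentially by (meson less_imp_le)
  qed
next
  assume *: "\<forall>e>0. \<exists>K. \<forall>k\<ge>K. normV (g k) \<le> ereal e"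
  have nonneg: "0 \<le> normV (g k)" for k
  proof (rule ccontr)
    assume "\<not> 0 \<le> normV (g k)"
    then obtain r where "normV (g k) < ereal r" "ereal r < 0"
      using ereal_dense2[of "normV (g k)" 0] by (auto simp: not_le)
    then have "cmod (g k 0) \<le> r" "r < 0" by (auto intro: cmod_le_normV less_imp_le)
    then show False using norm_ge_zero[of "g k 0"] by linarith
  qed
  show "(\<lambda>k. normV (g k)) \<longlonglongrightarrow> 0"
  proof (rule order_tendstoI)
    fix a :: ereal assume "a < 0"
    then show "\<forall>\<^sub>F k in sequentially. a < normV (g k)"
      using nonneg by (intro always_eventually allI) (rule less_le_trans)
  next
    fix a :: ereal assume "0 < a"
    then obtain e where e: "0 < ereal e" "ereal e < a" using ereal_dense2 by blast
    with * obtain K where "\<forall>k\<ge>K. normV (g k) \<le> ereal e" by auto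
    then show "\<forall>\<^sub>F k in sequentially. normV (g k) < a"
      unfolding eventually_sequentially using e(2) by (meson le_less_trans)
  qed
qed

text \<open>Shifting the coefficients multiplies the trigonometric polynomial by a character, which
  preserves its sup norm, and moves the ball of frequencies, over whose centre the supremum runs
  anyway.\<close>

lemma normV_translate:
  assumes "normV f \<le> ereal e" shows "normV (\<lambda>t. f (t - s)) \<le> ereal e"
  unfolding normV_le_iff
proof
  fix c :: "real^'a \<Rightarrow> complex" assume c: "c \<in> unit_trig_coeffs"
  define c' where "c' t = c (t + s)" for t
  have supp: "{t. c t \<noteq> 0} = (\<lambda>t. t + s) ` {t. c' t \<noteq> 0}"
    by (auto simp: c'_def image_iff intro!: exI[of _ "_ - s"])
  have inj: "inj_on (\<lambda>t. t + s) A" for A by (simp add: inj_on_def)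
  have "c' \<in> unit_trig_coeffs"
    unfolding unit_trig_coeffs_def
  proof (intro CollectI conjI allI)
    show "finite {t. c' t \<noteq> 0}"
      by (rule finite_imageD[OF _ inj]) (use c in \<open>simp add: unit_trig_coeffs_def flip: supp\<close>)
    obtain r where "{t. c t \<noteq> 0} \<subseteq> cball r (1/4)" using c by (auto simp: unit_trig_coeffs_def)
    then have "{t. c' t \<noteq> 0} \<subseteq> cball (r - s) (1/4)"
      by (auto simp: c'_def subset_iff dist_norm algebra_simps)
    then show "\<exists>r. {t. c' t \<noteq> 0} \<subseteq> cball r (1/4)" ..
    fix x
    have "(\<Sum>t\<in>{t. c t \<noteq> 0}. c t * ch x t) = ch x s * (\<Sum>t\<in>{t. c' t \<noteq> 0}. c' t * ch x t)"
      unfolding supp by (subst sum.reindex[OF inj]) (simp add: c'_def ch_add_right sum_distrib_left mult_ac)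
    then have "cmod (\<Sum>t\<in>{t. c' t \<noteq> 0}. c' t * ch x t) = cmod (\<Sum>t\<in>{t. c t \<noteq> 0}. c t * ch x t)"
      by (simp add: norm_mult)
    also have "\<dots> \<le> 1" using c by (simp add: unit_trig_coeffs_def)
    finally show "cmod (\<Sum>t\<in>{t. c' t \<noteq> 0}. c' t * ch x t) \<le> 1" .
  qed
  then have "cmod (\<Sum>t\<in>{t. c' t \<noteq> 0}. c' t * f t) \<le> e" using assms unfolding normV_le_iff by blast
  also have "(\<Sum>t\<in>{t. c' t \<noteq> 0}. c' t * f t) = (\<Sum>t\<in>{t. c t \<noteq> 0}. c t * f (t - s))"
    unfolding supp by (subst sum.reindex[OF inj]) (simp add: c'_def)
  finally show "cmod (\<Sum>t\<in>{t. c t \<noteq> 0}. c t * f (t - s)) \<le> e" .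
qed

definition FT_const :: "'n::finite itself \<Rightarrow> real" where
  "FT_const _ = inverse ((2*pi) ^ CARD('n))"

lemma FT_const_pos: "FT_const TYPE('n::finite) > 0"
  by (simp add: FT_const_def)

lemma FT_eq: "FT f t = complex_of_real (FT_const TYPE('n)) * iFT_dual f (- t::real^'n)"
  by (simp add: FT_def FT_const_def iFT_dual_eq cnj_ch)

text \<open>The finite sum is, up to the constant, the integral of \<open>f\<close> against the
  polynomial evaluated at \<open>- x\<close>, and the polynomial is bounded by 1.\<close>

lemma normV_FT:
  fixes f :: "real^'n \<Rightarrow> complex"
  assumes f: "integrable lborel f"
  shows "normV (FT f) \<le> ereal (FT_const TYPE('n) * (\<integral>x. cmod (f x) \<partial>lborel))"
  unfolding normV_le_iff
proof
  fix c :: "real^'n \<Rightarrow> complex" assume c: "c \<in> unit_trig_coeffs"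
  let ?S = "{t. c t \<noteq> 0}"
  have i: "integrable lborel (\<lambda>x. c t * (ch x (- t) * f x))" for t
    by (intro integrable_mult_right integrable_ch f)
  have "(\<Sum>t\<in>?S. c t * FT f t) = complex_of_real (FT_const TYPE('n)) * (\<integral>x. (\<Sum>t\<in>?S. c t * (ch x (- t) * f x)) \<partial>lborel)"
    unfolding FT_eq iFT_dual_eq
    by (subst Bochner_Integration.integral_sum[OF i]) (simp add: sum_distrib_left mult_ac)
  also have "cmod \<dots> \<le> FT_const TYPE('n) * (\<integral>x. cmod (f x) \<partial>lborel)"
    unfolding norm_mult norm_of_real abs_of_pos[OF FT_const_pos]
  proof (intro mult_left_mono Bochner_Integration.integral_norm_bound_integral)
    show "integrable lborel (\<lambda>x. \<Sum>t\<in>?S. c t * (ch x (- t) * f x))" by (intro Bochner_Integration.integrable_sum i)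
    fix x
    have "cmod (\<Sum>t\<in>?S. c t * (ch x (- t) * f x)) = cmod (\<Sum>t\<in>?S. c t * ch (- x) t) * cmod (f x)"
      by (simp add: ch_minus sum_distrib_right mult.assoc flip: norm_mult)
    also have "\<dots> \<le> 1 * cmod (f x)"
      using c by (intro mult_right_mono) (auto simp: unit_trig_coeffs_def)
    finally show "cmod (\<Sum>t\<in>?S. c t * (ch x (- t) * f x)) \<le> cmod (f x)" by simp
  qed (use f FT_const_pos[where 'n='n] in auto)
  finally show "cmod (\<Sum>t\<in>?S. c t * FT f t) \<le> FT_const TYPE('n) * (\<integral>x. cmod (f x) \<partial>lborel)" .
qed

text \<open>The difference is the average of \<open>\<psi>(t - s) - \<psi> t\<close> with weight
  \<open>q s\<close>. This is Minkowski's inequality for \<open>normV\<close>, carried out on each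
  finite sum of coefficients.\<close>

lemma normV_conv_approx_identity:
  fixes \<psi> :: "real^'n \<Rightarrow> complex"
  assumes \<psi>: "continuous_on UNIV \<psi>" "bounded (range \<psi>)"
    and q: "integrable lborel q" "(\<integral>x. q x \<partial>lborel) = 1" "(\<integral>x. cmod (q x) \<partial>lborel) \<le> 1"
    and le: "\<And>s. q s \<noteq> 0 \<Longrightarrow> normV (\<lambda>t. \<psi> (t - s) - \<psi> t) \<le> ereal e"
  shows "normV (\<lambda>t. conv q \<psi> t - \<psi> t) \<le> ereal e"
  unfolding normV_le_iff
proof
  fix c :: "real^'n \<Rightarrow> complex" assume c: "c \<in> unit_trig_coeffs"
  let ?S = "{t. c t \<noteq> 0}"
  have [measurable]: "\<psi> \<in> borel_measurable borel" "q \<in> borel_measurable borel"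
    using \<psi> q by (auto intro: borel_measurable_continuous_onI)
  obtain B where B: "\<And>x. cmod (\<psi> x) \<le> B" using \<psi>(2) by (auto simp: bounded_iff)
  \<comment> \<open>A kernel of integral 1 is nonzero somewhere, and \<open>le\<close> at such a
    point forces \<open>e\<close> to be nonnegative.\<close>
  have "\<exists>s. q s \<noteq> 0"
  proof (rule ccontr)
    assume "\<not> ?thesis"
    then have "q = (\<lambda>_. 0)" by auto
    then show False using q(2) by simp
  qed
  then obtain s0 where "q s0 \<noteq> 0" ..
  from order.trans[OF norm_ge_zero cmod_le_normV[OF le[OF this]]] have e: "e \<ge> 0" .
  have "\<bar>B\<bar> = B" using order.trans[OF norm_ge_zero B] by simp
  then have i1: "integrable lborel (\<lambda>s. \<psi> (t - s) * q s)" for t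
    by (intro Bochner_Integration.integrable_bound[of _ "\<lambda>s. B * cmod (q s)" "\<lambda>s. \<psi> (t - s) * q s"])
      (use q B in \<open>auto simp: norm_mult abs_mult intro!: AE_I2 mult_right_mono\<close>)
  then have i: "integrable lborel (\<lambda>s. c t * ((\<psi> (t - s) - \<psi> t) * q s))" for t
    using q(1) by (intro integrable_mult_right) (simp add: left_diff_distrib)
  have "conv q \<psi> t - \<psi> t = (\<integral>s. (\<psi> (t - s) - \<psi> t) * q s \<partial>lborel)" for t
  proof -
    have "conv q \<psi> t = (\<integral>s. \<psi> (t - s) * q s \<partial>lborel)"
      unfolding conv_def using integral_lborel_shift(4)[of "\<lambda>y. q (t - y) * \<psi> y" t] by (simp add: mult.commute)
    then show ?thesis using i1[of t] q by (simp add: left_diff_distrib)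
  qed
  then have "(\<Sum>t\<in>?S. c t * (conv q \<psi> t - \<psi> t)) = (\<integral>s. (\<Sum>t\<in>?S. c t * ((\<psi> (t - s) - \<psi> t) * q s)) \<partial>lborel)"
    by (subst Bochner_Integration.integral_sum[OF i]) simp
  also have "cmod \<dots> \<le> (\<integral>s. e * cmod (q s) \<partial>lborel)"
  proof (rule Bochner_Integration.integral_norm_bound_integral)
    show "integrable lborel (\<lambda>s. \<Sum>t\<in>?S. c t * ((\<psi> (t - s) - \<psi> t) * q s))"
      by (intro Bochner_Integration.integrable_sum i)
    fix s
    have "cmod (\<Sum>t\<in>?S. c t * ((\<psi> (t - s) - \<psi> t) * q s)) = cmod (\<Sum>t\<in>?S. c t * (\<psi> (t - s) - \<psi> t)) * cmod (q s)"
      by (simp add: sum_distrib_right mult.assoc flip: norm_mult)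
    also have "\<dots> \<le> e * cmod (q s)"
    proof (cases "q s = 0")
      case False
      then show ?thesis using le[OF False] c unfolding normV_le_iff by (intro mult_right_mono) auto
    qed simp
    finally show "cmod (\<Sum>t\<in>?S. c t * ((\<psi> (t - s) - \<psi> t) * q s)) \<le> e * cmod (q s)" .
  qed (use q in auto)
  also have "\<dots> \<le> e" using q(3) e by (simp add: mult_left_le)
  finally show "cmod (\<Sum>t\<in>?S. c t * (conv q \<psi> t - \<psi> t)) \<le> e" .
qed

text \<open>Translating \<open>FT f\<close> multiplies \<open>f\<close> by a character, so for
  integrable \<open>f\<close> dominated convergence and \<open>normV_FT\<close> suffice. The general
  case follows by an \<open>e / 3\<close> argument, since \<open>normV\<close> is translation
  invariant.\<close>

lemma A_alg_translation_continuous: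
  fixes \<psi> :: "real^'n \<Rightarrow> complex"
  assumes "\<psi> \<in> A_alg" and e: "e > 0"
  obtains \<delta> where "\<delta> > 0" "\<And>s. norm s < \<delta> \<Longrightarrow> normV (\<lambda>t. \<psi> (t - s) - \<psi> t) \<le> ereal e"
proof -
  obtain F where F: "\<And>k. integrable lborel (F k)" "(\<lambda>k. normV (\<lambda>t. FT (F k) t - \<psi> t)) \<longlonglongrightarrow> 0"
    using assms(1) by (auto simp: A_alg_def)
  obtain k where k: "normV (\<lambda>t. FT (F k) t - \<psi> t) \<le> ereal (e / 3)"
    using F(2) e unfolding normV_tendsto_0_iff by (meson divide_pos_pos order_refl zero_less_numeral)
  define f where "f = F k"
  have f: "integrable lborel f" and fk: "normV (\<lambda>t. FT f t - \<psi> t) \<le> ereal (e / 3)"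
    using F(1) k by (auto simp: f_def)
  have [measurable]: "f \<in> borel_measurable borel" using f by simp
  define D where "D s = (\<integral>x. cmod ((ch x s - 1) * f x) \<partial>lborel)" for s
  have "isCont D 0"
    unfolding continuous_at_sequentially comp_def
  proof safe
    fix s :: "nat \<Rightarrow> real^'n" assume s: "s \<longlonglongrightarrow> 0"
    show "(\<lambda>n. D (s n)) \<longlonglongrightarrow> D 0" unfolding D_def
    proof (rule integral_dominated_convergence[where w="\<lambda>x. 2 * cmod (f x)"])
      show "AE x in lborel. (\<lambda>n. cmod ((ch x (s n) - 1) * f x)) \<longlonglongrightarrow> cmod ((ch x 0 - 1) * f x)"
        unfolding ch_def by (intro AE_I2 tendsto_intros s)
      have "cmod (ch x t - 1) \<le> 2" for x t :: "real^'n"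
        using norm_triangle_ineq4[of "ch x t" 1] by simp
      then show "AE x in lborel. norm (cmod ((ch x (s n) - 1) * f x)) \<le> 2 * cmod (f x)" for n
        by (intro AE_I2) (auto simp: norm_mult intro!: mult_right_mono)
    qed (use f in auto)
  qed
  moreover have "D 0 = 0" by (simp add: D_def)
  moreover have "e / (3 * FT_const TYPE('n)) > 0" using e FT_const_pos[where 'n='n] by simp
  ultimately obtain \<delta> where \<delta>: "\<delta> > 0" "\<And>s. norm s < \<delta> \<Longrightarrow> \<bar>D s\<bar> < e / (3 * FT_const TYPE('n))"
    unfolding continuous_at_eps_delta by (metis diff_zero dist_norm real_norm_def)
  have "normV (\<lambda>t. \<psi> (t - s) - \<psi> t) \<le> ereal e" if s: "norm s < \<delta>" for s
  proof -
    have "FT f (t - s) - FT f t = FT (\<lambda>x. (ch x s - 1) * f x) t" for t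
    proof -
      have "(ch x s - 1) * f x = ch x s * f x - f x" for x by (simp add: left_diff_distrib)
      then have "FT (\<lambda>x. (ch x s - 1) * f x) t =
          complex_of_real (FT_const TYPE('n)) * (iFT_dual (\<lambda>x. ch x s * f x) (- t) - iFT_dual f (- t))"
        unfolding FT_eq iFT_dual_eq using integrable_ch[OF f] integrable_ch[OF integrable_ch[OF f]]
        by (simp add: right_diff_distrib)
      then show ?thesis unfolding FT_eq iFT_dual_ch by (simp add: right_diff_distrib)
    qed
    moreover have "normV (FT (\<lambda>x. (ch x s - 1) * f x)) \<le> ereal (e / 3)"
    proof (rule order.trans[OF normV_FT])
      show "integrable lborel (\<lambda>x. (ch x s - 1) * f x)"
        using integrable_ch[OF f] f by (simp add: left_diff_distrib)
      show "ereal (FT_const TYPE('n) * (\<integral>x. cmod ((ch x s - 1) * f x) \<partial>lborel)) \<le> ereal (e / 3)"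
        using \<delta>(2)[OF s] FT_const_pos[where 'n='n] by (simp add: D_def field_simps)
    qed
    ultimately have 1: "normV (\<lambda>t. FT f (t - s) - FT f t) \<le> ereal (e / 3)" by simp
    have 2: "normV (\<lambda>t. \<psi> (t - s) - FT f (t - s)) \<le> ereal (e / 3)"
      using normV_translate[OF fk, of s] by (subst normV_minus_commute) simp
    show ?thesis using normV_add[OF normV_add[OF 2 1] fk] by simp
  qed
  then show ?thesis using that \<delta>(1) by blast
qed

section \<open>The kernels \<open>en\<close>\<close>

lemma ind_B4_bounds:
  "ind_B4 \<in> borel_measurable borel" "cmod (ind_B4 x) \<le> 1" "1/4 < norm x \<Longrightarrow> ind_B4 x = 0"
  unfolding ind_B4_def by (auto simp: indicator_def)

text \<open>The indicator of a ball is discontinuous only on a sphere, which is a null set, so the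
  integrands converge almost everywhere. The support radius is the sum of the two radii
  \<open>1/4\<close>.\<close>

lemma Cc_conv_ind_B4: "Cc (conv ind_B4 ind_B4 :: real^'n \<Rightarrow> complex)"
proof (rule CcI[where R="1/2"])
  fix x :: "real^'n" assume x: "1/2 < norm x"
  have "ind_B4 (x - y) * ind_B4 y = 0" for y
    using x norm_triangle_ineq[of "x - y" y] by (cases "1/4 < norm y") (auto simp: ind_B4_bounds)
  then show "conv ind_B4 ind_B4 x = 0" unfolding conv_def by (simp only: Bochner_Integration.integral_zero)
next
  note [measurable] = ind_B4_bounds(1)
  show "continuous_on UNIV (conv ind_B4 ind_B4 :: real^'n \<Rightarrow> complex)"
  proof (rule continuous_at_imp_continuous_on, safe)
    fix x0 :: "real^'n"
    show "isCont (conv ind_B4 ind_B4) x0"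
      unfolding continuous_at_sequentially comp_def conv_def
    proof safe
      fix x :: "nat \<Rightarrow> real^'n" assume x: "x \<longlonglongrightarrow> x0"
      show "(\<lambda>n. \<integral>y. ind_B4 (x n - y) * ind_B4 y \<partial>lborel) \<longlonglongrightarrow> (\<integral>y. ind_B4 (x0 - y) * ind_B4 y \<partial>lborel)"
      proof (rule integral_dominated_convergence[where w="\<lambda>y. indicator (cball 0 (1/4)) y"])
        show "integrable lborel (indicat_real (cball (0::real^'n) (1/4)))"
          using emeasure_lborel_cball_finite[of "0::real^'n" "1/4"] by (intro integrable_real_indicator) auto
        show "AE y in lborel. cmod (ind_B4 (x n - y) * ind_B4 y) \<le> indicator (cball 0 (1/4)) y" for n
          by (intro AE_I2) (auto simp: ind_B4_def indicator_def)
        have "sphere x0 (1/4) \<in> null_sets lborel"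
          using negligible_sphere[of x0 "1/4"]
          by (auto simp: null_sets_completion_iff negligible_iff_null_sets)
        then have "AE y in lborel. y \<notin> sphere x0 (1/4)" by (rule AE_not_in)
        then show "AE y in lborel. (\<lambda>n. ind_B4 (x n - y) * ind_B4 y) \<longlonglongrightarrow> ind_B4 (x0 - y) * ind_B4 y"
        proof eventually_elim
          fix y assume y: "y \<notin> sphere x0 (1/4)"
          have l: "(\<lambda>n. norm (x n - y)) \<longlonglongrightarrow> norm (x0 - y)" by (intro tendsto_intros x)
          have "eventually (\<lambda>n. ind_B4 (x n - y) = ind_B4 (x0 - y)) sequentially"
          proof (cases "norm (x0 - y) < 1/4")
            case True
            from order_tendstoD(2)[OF l this] show ?thesis
              by eventually_elim (use True in \<open>simp add: ind_B4_def indicator_def\<close>)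
          next
            case False
            then have "1/4 < norm (x0 - y)" using y by (auto simp: dist_norm)
            from order_tendstoD(1)[OF l this] this show ?thesis
              by (auto elim!: eventually_mono simp: ind_B4_def indicator_def)
          qed
          then show "(\<lambda>n. ind_B4 (x n - y) * ind_B4 y) \<longlonglongrightarrow> ind_B4 (x0 - y) * ind_B4 y"
            by (intro tendsto_mult tendsto_const tendsto_eventually)
        qed
      qed auto
    qed
  qed
qed

lemma Cc_e0: "Cc e0"
proof -
  have "Cc B4conv4"
    unfolding B4conv4_def
    by (intro Cc_conv_bounded[where b=1 and S="1/4"] Cc_conv_ind_B4) (auto simp: ind_B4_bounds)
  then show ?thesis unfolding e0_def[abs_def] by (rule Cc_cmult)
qed

lemma Cc_en: "n \<ge> 1 \<Longrightarrow> Cc (en n)"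
  unfolding en_def[abs_def] using Cc_affine[OF Cc_e0, of "real n" 0] by (intro Cc_cmult) simp

lemma en_supportE:
  obtains S :: real where "S > 0" "\<And>n x. n \<ge> 1 \<Longrightarrow> S < norm (x::real^'n) \<Longrightarrow> en n x = 0"
proof -
  obtain S where S: "S > 0" "\<And>x::real^'n. S < norm x \<Longrightarrow> e0 x = 0" using Cc_e0 by (rule Cc_supportE) blast
  have "en n x = 0" if "n \<ge> 1" "S < norm x" for n and x :: "real^'n"
  proof -
    have "1 * norm x \<le> real n * norm x" using that by (intro mult_right_mono) auto
    then show ?thesis using S(2)[of "real n *\<^sub>R x"] that by (simp add: en_def)
  qed
  then show ?thesis using that S(1) by blast
qed

lemma integral_norm_en:
  assumes "n \<ge> 1"
  shows "(\<integral>x. cmod (en n x) \<partial>(lborel :: (real^'n) measure)) = (\<integral>x. cmod (e0 x) \<partial>(lborel :: (real^'n) measure))"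
proof -
  have [measurable]: "e0 \<in> borel_measurable (borel :: (real^'n) measure)" by (rule Cc_measurable[OF Cc_e0])
  show ?thesis
    using integral_lborel_affine[of "\<lambda>x. cmod (e0 (x::real^'n))" "real n" 0] assms
    by (simp add: en_def norm_mult norm_power)
qed

section \<open>The function representing the multiplier applied to a kernel\<close>

context
  fixes N :: "(real^'n) measure" and \<phi> v :: "real^'n \<Rightarrow> complex" and b :: real
  assumes pair: "transform_pair lborel N \<phi> v b" and \<phi>: "continuous_on UNIV \<phi>"
begin

interpretation transform_pair lborel N \<phi> v b by (rule pair)

text \<open>For \<open>A = en n\<close> this is the function \<open>F\<close> with index
  \<open>n\<close> of the overview. The argument is \<open>z + y\<close> because the measure
  associated with \<open>\<phi>\<close> is a multiple of the reflection of
  \<open>v N\<close>.\<close>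

definition smoothing :: "(real^'n \<Rightarrow> complex) \<Rightarrow> real^'n \<Rightarrow> complex" where
  "smoothing A z = (\<integral>y. A (z + y) * v y \<partial>N)"

text \<open>For fixed \<open>t\<close>, \<open>transform_product\<close> is applied to the reflected
  \<open>A\<close> and the cutoff \<open>moll2 r (t - s)\<close>, whose transform is a character
  times the reflected transform of \<open>moll2 r\<close>. The character becomes the kernel of
  \<open>FT\<close>, and the reflections cancel.\<close>

lemma conv_moll2_eq_FT:
  assumes A: "Cc A"
  shows "conv (moll2 r) (\<lambda>t. \<phi> t * FT A t) t = FT (\<lambda>x. iFT_dual (moll2 r) x * smoothing A x) t"
proof -
  let ?c = "complex_of_real (FT_const TYPE('n))"
  define q where "q s = moll2 r (t - s)" for s
  have q: "Cc q" unfolding q_def by (rule Cc_diff_left[OF Cc_moll2])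
  have A': "Cc (\<lambda>x. A (- x))" by (rule Cc_reflect[OF A])
  have [measurable]: "A \<in> borel_measurable borel" "moll2 r \<in> borel_measurable borel"
    using A Cc_moll2 by (auto intro: Cc_measurable)
  have "iFT_dual q x = ch t x * iFT_dual (moll2 r) (- x)" for x
    unfolding q_def iFT_dual_eq using integral_lborel_shift(4)[of "\<lambda>w. ch (t - w) x * moll2 r w" t]
    by (simp add: ch_diff_left mult.assoc)
  then have Fq: "iFT_dual q = (\<lambda>x. ch t x * iFT_dual (moll2 r) (- x))" by blast
  have Fm: "integrable lborel (iFT_dual (moll2 r))"
    unfolding iFT_dual_moll2[abs_def] by (intro integrable_of_real square_integrable_iFT_dual Cc_moll)
  have Fqi: "integrable lborel (iFT_dual q)"
    unfolding Fq ch_commute[of t] by (intro integrable_ch integrable_lborel_shift(5) Fm)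
  have "continuous_on UNIV (smoothing A)"
    unfolding smoothing_def[abs_def] by (rule integral_shift_continuous[OF N A v])
  then have [measurable]: "smoothing A \<in> borel_measurable borel" by (rule borel_measurable_continuous_onI)
  have "conv (moll2 r) (\<lambda>t. \<phi> t * FT A t) t = ?c * (\<integral>s. iFT_dual (\<lambda>x. A (- x)) s * q s * \<phi> s \<partial>lborel)"
    unfolding conv_def FT_eq iFT_dual_reflect[OF \<open>A \<in> borel_measurable borel\<close>] q_def
    by (simp add: mult_ac flip: integral_mult_right_zero)
  also have "\<dots> = ?c * (\<integral>x. iFT_dual q x * (\<integral>y. A (- (x - y)) * v y \<partial>N) \<partial>lborel)"
    unfolding transform_product[OF A' q Fqi] ..
  also have "\<dots> = ?c * (\<integral>x. ch (- t) (- x) * (iFT_dual (moll2 r) (- x) * smoothing A (- x)) \<partial>lborel)"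
    unfolding Fq smoothing_def by (simp add: ch_minus mult.assoc)
  also have "\<dots> = FT (\<lambda>x. iFT_dual (moll2 r) x * smoothing A x) t"
    unfolding FT_eq iFT_dual_def
    using integral_lborel_shift(5)[of "\<lambda>x. ch (- t) x * (iFT_dual (moll2 r) x * smoothing A x)"]
    by (simp add: iFT_dual_def)
  finally show ?thesis .
qed

text \<open>\<open>smoothing A\<close> is bounded and continuous but need not be integrable. The
  first factor is integrable, bounded by 1 and tends to 1 pointwise, so integrability is gained and
  local limits are unchanged.\<close>

definition approximants :: "(real^'n \<Rightarrow> complex) \<Rightarrow> nat \<Rightarrow> real^'n \<Rightarrow> complex" where
  "approximants A k x = iFT_dual (moll2 (1 / real (Suc k))) x * smoothing A x"

lemma
  assumes A: "Cc A"
  shows integrable_approximants: "integrable lborel (approximants A k)"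
    and approximants_tendsto_L1: "Cc h \<Longrightarrow> (\<lambda>k. \<integral>x. cmod (h x * approximants A k x - h x * smoothing A x) \<partial>lborel) \<longlonglongrightarrow> 0"
    and integrable_smoothing: "Cc h \<Longrightarrow> integrable lborel (\<lambda>x. h x * smoothing A x)"
proof -
  have cont: "continuous_on UNIV (smoothing A)"
    unfolding smoothing_def[abs_def] by (rule integral_shift_continuous[OF N A v])
  then have [measurable]: "smoothing A \<in> borel_measurable borel" by (rule borel_measurable_continuous_onI)
  obtain C where C: "0 \<le> C" "\<And>z. cmod (smoothing A z) \<le> C"
    unfolding smoothing_def using integral_shift_bounded[OF N A v] by metis
  have Fm: "integrable lborel (iFT_dual (moll2 r :: real^'n \<Rightarrow> complex))" for r
    unfolding iFT_dual_moll2[abs_def] by (intro integrable_of_real square_integrable_iFT_dual Cc_moll)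
  have [measurable]: "iFT_dual (moll2 r :: real^'n \<Rightarrow> complex) \<in> borel_measurable borel" for r using Fm[of r] by auto
  show "integrable lborel (approximants A k)"
    unfolding approximants_def[abs_def]
    by (rule Bochner_Integration.integrable_bound[of _ "\<lambda>x. cmod (iFT_dual (moll2 (1 / real (Suc k))) (x::real^'n)) * C"])
      (use Fm C in \<open>auto simp: norm_mult intro!: AE_I2 mult_left_mono\<close>)
  assume h: "Cc h"
  have [measurable]: "h \<in> borel_measurable borel" using h by (rule Cc_measurable)
  show "integrable lborel (\<lambda>x. h x * smoothing A x)"
    by (intro Cc_integrable) (simp add: mult.commute[of "h _"] Cc_mult[OF h cont])
  have "(\<lambda>k. \<integral>x. cmod (h x * approximants A k x - h x * smoothing A x) \<partial>lborel) \<longlonglongrightarrow> (\<integral>x. 0 \<partial>(lborel :: (real^'n) measure))"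
  proof (rule integral_dominated_convergence[where w="\<lambda>x. cmod (h x) * (2 * C)"])
    have diff: "h x * approximants A k x - h x * smoothing A x =
        h x * ((iFT_dual (moll2 (1 / real (Suc k))) x - 1) * smoothing A x)" for k x
      by (simp add: approximants_def algebra_simps)
    have "(\<lambda>k. cmod (h x * ((iFT_dual (moll2 (1 / real (Suc k))) x - 1) * smoothing A x))) \<longlonglongrightarrow>
        cmod (h x * ((complex_of_real ((cmod 1)\<^sup>2) - 1) * smoothing A x))" for x
      unfolding iFT_dual_moll2 by (intro tendsto_intros iFT_dual_moll_tendsto)
    then show "AE x in lborel. (\<lambda>k. cmod (h x * approximants A k x - h x * smoothing A x)) \<longlonglongrightarrow> 0"
      unfolding diff by (intro AE_I2) simp
    show "AE x in lborel. norm (cmod (h x * approximants A k x - h x * smoothing A x)) \<le> cmod (h x) * (2 * C)" for k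
    proof (rule AE_I2)
      fix x :: "real^'n"
      have "cmod (iFT_dual (moll2 (1 / real (Suc k))) x) \<le> 1"
        unfolding iFT_dual_moll2 using norm_iFT_dual_moll_le[of "1 / real (Suc k)" x]
        by (simp add: norm_power power_le_one del: of_nat_Suc)
      then have "cmod (iFT_dual (moll2 (1 / real (Suc k))) x - 1) \<le> 2"
        using norm_triangle_ineq4[of "iFT_dual (moll2 (1 / real (Suc k))) x" 1] by simp
      then have "cmod (h x) * (cmod (iFT_dual (moll2 (1 / real (Suc k))) x - 1) * cmod (smoothing A x)) \<le> cmod (h x) * (2 * C)"
        using C by (intro mult_left_mono mult_mono) auto
      then show "norm (cmod (h x * approximants A k x - h x * smoothing A x)) \<le> cmod (h x) * (2 * C)"
        unfolding diff by (simp add: norm_mult)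
    qed
    show "integrable lborel (\<lambda>x. cmod (h x) * (2 * C))" using Cc_integrable[OF h] by simp
  qed (auto simp: approximants_def)
  then show "(\<lambda>k. \<integral>x. cmod (h x * approximants A k x - h x * smoothing A x) \<partial>lborel) \<longlonglongrightarrow> 0" by simp
qed

lemma loc_int_seq_approximants:
  assumes A: "Cc A" and \<psi>: "(\<lambda>t. \<phi> t * FT A t) \<in> A_alg"
  shows "loc_int_seq (\<lambda>t. \<phi> t * FT A t) (approximants A)"
  unfolding loc_int_seq_def normV_tendsto_0_iff
proof (intro conjI allI impI)
  show "integrable lborel (approximants A k)" for k by (rule integrable_approximants[OF A])
  fix e :: real assume e: "e > 0"
  let ?\<psi> = "\<lambda>t. \<phi> t * FT A t"
  have c: "continuous_on UNIV (FT A)"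
    unfolding FT_eq[abs_def]
    by (intro continuous_intros continuous_on_compose2[OF continuous_iFT_dual[OF Cc_integrable[OF A]]]) auto
  have "cmod (?\<psi> t) \<le> b * (FT_const TYPE('n) * (\<integral>x. cmod (A x) \<partial>lborel))" for t
    unfolding norm_mult using u(2) b_nonneg cmod_le_normV[OF normV_FT[OF Cc_integrable[OF A]]]
    by (intro mult_mono) auto
  then have bd: "bounded (range ?\<psi>)" by (auto simp: bounded_iff)
  obtain \<delta> where \<delta>: "\<delta> > 0" "\<And>s. norm s < \<delta> \<Longrightarrow> normV (\<lambda>t. ?\<psi> (t - s) - ?\<psi> t) \<le> ereal e"
    by (rule A_alg_translation_continuous[OF \<psi> e]) blast
  \<comment> \<open>Half of \<open>\<delta>\<close>, because \<open>moll2 r\<close> lives on the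
    ball of radius \<open>2 * r\<close>.\<close>
  obtain K where K: "1 / real (Suc K) < \<delta> / 2" using nat_approx_posE[of "\<delta> / 2"] \<delta>(1) by auto
  show "\<exists>K. \<forall>k\<ge>K. normV (\<lambda>t. FT (approximants A k) t - ?\<psi> t) \<le> ereal e"
  proof (intro exI[of _ K] allI impI)
    fix k assume k: "K \<le> k"
    let ?r = "1 / real (Suc k)"
    have "?r \<le> 1 / real (Suc K)" using k by (simp add: frac_le)
    with K have r: "2 * ?r < \<delta>" by linarith
    have "normV (\<lambda>t. conv (moll2 ?r) ?\<psi> t - ?\<psi> t) \<le> ereal e"
    proof (rule normV_conv_approx_identity[OF _ bd])
      show "continuous_on UNIV ?\<psi>" using \<phi> c by (intro continuous_intros)
      show "normV (\<lambda>t. ?\<psi> (t - s) - ?\<psi> t) \<le> ereal e" if "moll2 ?r s \<noteq> 0" for s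
        using that moll2_support[of ?r s] r by (intro \<delta>(2)) (auto simp: not_le[symmetric] simp del: of_nat_Suc)
    qed (auto intro!: Cc_integrable Cc_moll2 integral_moll2 integral_norm_moll2 simp del: of_nat_Suc)
    then show "normV (\<lambda>t. FT (approximants A k) t - ?\<psi> t) \<le> ereal e"
      unfolding conv_moll2_eq_FT[OF A] by (simp only: approximants_def[abs_def])
  qed
next
  fix h :: "real^'n \<Rightarrow> complex" and e :: real assume h: "Cc h" and e: "e > 0"
  obtain K where K: "\<And>k. k \<ge> K \<Longrightarrow> (\<integral>x. cmod (h x * approximants A k x - h x * smoothing A x) \<partial>lborel) < e / 2"
    using order_tendstoD(2)[OF approximants_tendsto_L1[OF A h], of "e / 2"] e
    unfolding eventually_sequentially by auto
  note i = integrable_Cc_mult[OF h integrable_approximants[OF A]] integrable_smoothing[OF A h]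
  show "\<exists>K. \<forall>j\<ge>K. \<forall>k\<ge>K. (\<integral>x. cmod (h x * approximants A j x - h x * approximants A k x) \<partial>lborel) < e"
  proof (intro exI[of _ K] allI impI)
    fix j k assume jk: "K \<le> j" "K \<le> k"
    have "(\<integral>x. cmod (h x * approximants A j x - h x * approximants A k x) \<partial>lborel) \<le>
       (\<integral>x. cmod (h x * approximants A j x - h x * smoothing A x) + cmod (h x * approximants A k x - h x * smoothing A x) \<partial>lborel)"
    proof (rule Bochner_Integration.integral_mono)
      show "cmod (h x * approximants A j x - h x * approximants A k x) \<le>
          cmod (h x * approximants A j x - h x * smoothing A x) + cmod (h x * approximants A k x - h x * smoothing A x)" for x
        using norm_triangle_ineq4[of "h x * approximants A j x - h x * smoothing A x" "h x * approximants A k x - h x * smoothing A x"]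
        by simp
    qed (use i in auto)
    also have "\<dots> < e" using K[OF jk(1)] K[OF jk(2)] i by simp
    finally show "(\<integral>x. cmod (h x * approximants A j x - h x * approximants A k x) \<partial>lborel) < e" .
  qed
qed

text \<open>The sequence chosen in \<open>hnorm\<close> and \<open>approximants A\<close> have the
  same \<open>normV\<close> limit, hence their difference has uniformly vanishing transforms; it is
  also locally Cauchy. \<open>local_L1_tendsto_0\<close> then identifies the local limits.\<close>

lemma hnorm_eq:
  assumes A: "Cc A" and \<psi>: "(\<lambda>t. \<phi> t * FT A t) \<in> A_alg" and h: "Cc h"
  shows "hnorm h (\<lambda>t. \<phi> t * FT A t) = (\<integral>x. cmod (h x * smoothing A x) \<partial>lborel)"
proof -
  let ?\<psi> = "\<lambda>t. \<phi> t * FT A t"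
  define g where "g = (SOME f. loc_int_seq ?\<psi> f)"
  define f where "f = approximants A"
  have f: "loc_int_seq ?\<psi> f" unfolding f_def by (rule loc_int_seq_approximants[OF A \<psi>])
  then have g: "loc_int_seq ?\<psi> g" unfolding g_def by (rule someI[of "loc_int_seq ?\<psi>"])
  define d where "d k x = g k x - f k x" for k x
  have ig: "integrable lborel (g k)" and jf: "integrable lborel (f k)" for k
    using f g by (auto simp: loc_int_seq_def)
  have d0: "(\<lambda>k. \<integral>x. cmod (h x * d k x) \<partial>lborel) \<longlonglongrightarrow> 0"
  proof (rule local_L1_tendsto_0[OF _ _ _ h])
    show "integrable lborel (d k)" for k using ig jf unfolding d_def[abs_def] by simp
    fix e :: real assume e: "e > 0"
    let ?c = "FT_const TYPE('n)"
    \<comment> \<open>\<open>FT\<close> is \<open>?c\<close> times \<open>iFT_dual\<close> at the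
      reflected point, and each of the two sequences may use half of the allowance.\<close>
    have e': "e * ?c / 2 > 0" using e FT_const_pos[where 'n='n] by simp
    obtain K where K: "\<And>k. k \<ge> K \<Longrightarrow> normV (\<lambda>t. FT (g k) t - ?\<psi> t) \<le> ereal (e * ?c / 2)"
      using g e' unfolding loc_int_seq_def normV_tendsto_0_iff by blast
    obtain K' where K': "\<And>k. k \<ge> K' \<Longrightarrow> normV (\<lambda>t. FT (f k) t - ?\<psi> t) \<le> ereal (e * ?c / 2)"
      using f e' unfolding loc_int_seq_def normV_tendsto_0_iff by blast
    show "\<exists>K. \<forall>k\<ge>K. \<forall>t. cmod (iFT_dual (d k) t) \<le> e"
    proof (intro exI[of _ "max K K'"] allI impI)
      fix k t assume k: "max K K' \<le> k"
      have "FT (g k) (- t) - FT (f k) (- t) = complex_of_real ?c * iFT_dual (d k) t"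
        unfolding FT_eq d_def iFT_dual_eq using integrable_ch[OF ig] integrable_ch[OF jf]
        by (simp add: right_diff_distrib)
      then have "?c * cmod (iFT_dual (d k) t) = cmod ((FT (g k) (- t) - ?\<psi> (- t)) - (FT (f k) (- t) - ?\<psi> (- t)))"
        using FT_const_pos[where 'n='n] by (simp add: norm_mult)
      also have "\<dots> \<le> cmod (FT (g k) (- t) - ?\<psi> (- t)) + cmod (FT (f k) (- t) - ?\<psi> (- t))"
        by (rule norm_triangle_ineq4)
      also have "\<dots> \<le> e * ?c / 2 + e * ?c / 2"
        using cmod_le_normV[OF K, of k "- t"] cmod_le_normV[OF K', of k "- t"] k by (intro add_mono) auto
      finally show "cmod (iFT_dual (d k) t) \<le> e" using FT_const_pos[where 'n='n] by (simp add: field_simps)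
    qed
  next
    fix h :: "real^'n \<Rightarrow> complex" and e :: real assume h: "Cc h" and e: "e > 0"
    obtain K where K: "\<And>j k. j \<ge> K \<Longrightarrow> k \<ge> K \<Longrightarrow> (\<integral>x. cmod (h x * g j x - h x * g k x) \<partial>lborel) < e / 2"
      using g h half_gt_zero[OF e] unfolding loc_int_seq_def by blast
    obtain K' where K': "\<And>j k. j \<ge> K' \<Longrightarrow> k \<ge> K' \<Longrightarrow> (\<integral>x. cmod (h x * f j x - h x * f k x) \<partial>lborel) < e / 2"
      using f h half_gt_zero[OF e] unfolding loc_int_seq_def by blast
    note i = integrable_Cc_mult[OF h ig] integrable_Cc_mult[OF h jf]
    show "\<exists>K. \<forall>j\<ge>K. \<forall>k\<ge>K. (\<integral>x. cmod (h x * d j x - h x * d k x) \<partial>lborel) < e"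
    proof (intro exI[of _ "max K K'"] allI impI)
      fix j k assume jk: "max K K' \<le> j" "max K K' \<le> k"
      have "(\<integral>x. cmod (h x * d j x - h x * d k x) \<partial>lborel) \<le>
         (\<integral>x. cmod (h x * g j x - h x * g k x) + cmod (h x * f j x - h x * f k x) \<partial>lborel)"
      proof (rule Bochner_Integration.integral_mono)
        show "cmod (h x * d j x - h x * d k x) \<le> cmod (h x * g j x - h x * g k x) + cmod (h x * f j x - h x * f k x)" for x
          using norm_triangle_ineq4[of "h x * g j x - h x * g k x" "h x * f j x - h x * f k x"]
          by (simp add: d_def algebra_simps)
        show "integrable lborel (\<lambda>x. cmod (h x * d j x - h x * d k x))"
          using i by (simp add: d_def right_diff_distrib)
      qed (use i in auto)
      also have "\<dots> < e" using K[of j k] K'[of j k] jk i by simp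
      finally show "(\<integral>x. cmod (h x * d j x - h x * d k x) \<partial>lborel) < e" .
    qed
  qed
  let ?L = "\<integral>x. cmod (h x * smoothing A x) \<partial>lborel"
  note i = integrable_Cc_mult[OF h ig] integrable_Cc_mult[OF h jf] integrable_smoothing[OF A h]
  have s0: "(\<lambda>k. (\<integral>x. cmod (h x * d k x) \<partial>lborel) + (\<integral>x. cmod (h x * f k x - h x * smoothing A x) \<partial>lborel)) \<longlonglongrightarrow> 0"
    unfolding f_def by (rule tendsto_add_zero[OF d0[unfolded f_def] approximants_tendsto_L1[OF A h]])
  have "norm ((\<integral>x. cmod (h x * g k x) \<partial>lborel) - ?L) \<le>
      (\<integral>x. cmod (h x * d k x) \<partial>lborel) + (\<integral>x. cmod (h x * f k x - h x * smoothing A x) \<partial>lborel)" for k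
  proof -
    have "(\<integral>x. cmod (h x * g k x) \<partial>lborel) - ?L = (\<integral>x. cmod (h x * g k x) - cmod (h x * smoothing A x) \<partial>lborel)"
      using i by simp
    also have "norm \<dots> \<le> (\<integral>x. cmod (h x * d k x) + cmod (h x * f k x - h x * smoothing A x) \<partial>lborel)"
    proof (rule Bochner_Integration.integral_norm_bound_integral)
      show "norm (cmod (h x * g k x) - cmod (h x * smoothing A x)) \<le> cmod (h x * d k x) + cmod (h x * f k x - h x * smoothing A x)" for x
        using norm_triangle_ineq3[of "h x * g k x" "h x * smoothing A x"]
          norm_triangle_ineq[of "h x * d k x" "h x * f k x - h x * smoothing A x"]
        by (simp add: d_def algebra_simps)
      show "integrable lborel (\<lambda>x. cmod (h x * d k x) + cmod (h x * f k x - h x * smoothing A x))"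
        using i by (simp add: d_def right_diff_distrib)
    qed (use i in auto)
    also have "\<dots> = (\<integral>x. cmod (h x * d k x) \<partial>lborel) + (\<integral>x. cmod (h x * f k x - h x * smoothing A x) \<partial>lborel)"
      using i by (simp add: d_def right_diff_distrib)
    finally show ?thesis .
  qed
  then have "(\<lambda>k. (\<integral>x. cmod (h x * g k x) \<partial>lborel) - ?L) \<longlonglongrightarrow> 0"
    by (intro Lim_null_comparison[OF always_eventually s0] allI)
  then have "(\<lambda>k. \<integral>x. cmod (h x * g k x) \<partial>lborel) \<longlonglongrightarrow> ?L" by (rule LIM_zero_cancel)
  then show ?thesis unfolding hnorm_def g_def[symmetric] by (rule limI)
qed

text \<open>After Tonelli the inner integral over \<open>x\<close> vanishes unless \<open>y\<close>
  lies in the ball of radius \<open>R + S\<close>, and is at most \<open>B * b * E\<close>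
  otherwise. All \<open>en n\<close> share the support radius \<open>S\<close> and the
  \<open>L^1\<close> norm \<open>E\<close> of \<open>e0\<close>, so the bound is the same for every
  \<open>n\<close>.\<close>

lemma smoothing_en_bounded:
  assumes h: "Cc h"
  obtains C where "\<And>n. n \<ge> 1 \<Longrightarrow> (\<integral>x. cmod (h x * smoothing (en n) x) \<partial>lborel) \<le> C"
proof -
  obtain R where R: "R > 0" "\<And>x. R < norm x \<Longrightarrow> h x = 0" using h by (rule Cc_supportE) blast
  obtain B where B: "B > 0" "\<And>x. cmod (h x) \<le> B" using h by (rule Cc_boundE) blast
  obtain S where S: "S > 0" "\<And>n x. n \<ge> 1 \<Longrightarrow> S < norm (x::real^'n) \<Longrightarrow> en n x = 0" by (rule en_supportE) blast
  obtain D where D: "D \<ge> 0" "\<And>x. emeasure N (cball x (R + S)) \<le> ennreal D" using trans_boundedE[OF N] by metis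
  define E where "E = (\<integral>x. cmod (e0 x) \<partial>(lborel :: (real^'n) measure))"
  have E: "E \<ge> 0" by (simp add: E_def)
  interpret N: sigma_finite_measure N by (rule trans_bounded_sigma_finite[OF N])
  interpret P: pair_sigma_finite lborel N ..
  have [measurable]: "h \<in> borel_measurable borel" using h by (rule Cc_measurable)
  have "(\<integral>x. cmod (h x * smoothing (en n) x) \<partial>lborel) \<le> B * b * E * D" if n: "n \<ge> 1" for n
  proof -
    have en: "Cc (en n :: real^'n \<Rightarrow> complex)" by (rule Cc_en[OF n])
    have [measurable]: "en n \<in> borel_measurable (borel :: (real^'n) measure)" by (rule Cc_measurable[OF en])
    have "(\<integral>\<^sup>+x. ennreal (cmod (h x * smoothing (en n) x)) \<partial>lborel) \<le>
        (\<integral>\<^sup>+x. \<integral>\<^sup>+y. ennreal (cmod (h x)) * ennreal (cmod (en n (x + y)) * b) \<partial>N \<partial>lborel)"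
    proof (rule nn_integral_mono)
      fix x :: "real^'n"
      have "ennreal (cmod (smoothing (en n) x)) \<le> (\<integral>\<^sup>+y. ennreal (cmod (en n (x + y) * v y)) \<partial>N)"
        unfolding smoothing_def by (rule integral_norm_bound_ennreal[OF integrable_shift[OF N en v]])
      also have "\<dots> \<le> (\<integral>\<^sup>+y. ennreal (cmod (en n (x + y)) * b) \<partial>N)"
        using v(2) by (intro nn_integral_mono ennreal_leI) (auto simp: norm_mult intro: mult_left_mono)
      finally have "ennreal (cmod (h x)) * ennreal (cmod (smoothing (en n) x)) \<le>
          ennreal (cmod (h x)) * (\<integral>\<^sup>+y. ennreal (cmod (en n (x + y)) * b) \<partial>N)" by (rule mult_left_mono) simp
      then show "ennreal (cmod (h x * smoothing (en n) x)) \<le> (\<integral>\<^sup>+y. ennreal (cmod (h x)) * ennreal (cmod (en n (x + y)) * b) \<partial>N)"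
        by (simp add: norm_mult ennreal_mult nn_integral_cmult)
    qed
    also have "\<dots> = (\<integral>\<^sup>+y. \<integral>\<^sup>+x. ennreal (cmod (h x)) * ennreal (cmod (en n (x + y)) * b) \<partial>lborel \<partial>N)"
      by (rule P.Fubini'[symmetric]) measurable
    also have "\<dots> \<le> (\<integral>\<^sup>+y. ennreal (B * b * E) * indicator (cball 0 (R + S)) y \<partial>N)"
    proof (rule nn_integral_mono)
      fix y :: "real^'n"
      show "(\<integral>\<^sup>+x. ennreal (cmod (h x)) * ennreal (cmod (en n (x + y)) * b) \<partial>lborel) \<le>
          ennreal (B * b * E) * indicator (cball 0 (R + S)) y"
      proof (cases "norm y \<le> R + S")
        case True
        have "cmod (h x) * (cmod (en n (x + y)) * b) \<le> B * b * cmod (en n (y + x))" for x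
          using mult_right_mono[OF B(2)[of x], of "cmod (en n (x + y)) * b"] b_nonneg by (simp add: mult_ac add.commute)
        then have "(\<integral>\<^sup>+x. ennreal (cmod (h x)) * ennreal (cmod (en n (x + y)) * b) \<partial>lborel) \<le>
            (\<integral>\<^sup>+x. ennreal (B * b) * ennreal (cmod (en n (y + x))) \<partial>lborel)"
          using B b_nonneg by (intro nn_integral_mono) (auto intro: ennreal_leI simp flip: ennreal_mult)
        also have "\<dots> = ennreal (B * b) * (\<integral>\<^sup>+x. ennreal (cmod (en n x)) \<partial>(lborel :: (real^'n) measure))"
          by (simp add: nn_integral_cmult nn_integral_lborel_shift(1)[of "\<lambda>x. ennreal (cmod (en n x))"])
        also have "(\<integral>\<^sup>+x. ennreal (cmod (en n x)) \<partial>(lborel :: (real^'n) measure)) = ennreal E"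
          unfolding E_def integral_norm_en[OF n, symmetric]
          by (rule nn_integral_eq_integral[OF integrable_norm[OF Cc_integrable[OF en]]]) simp
        finally show ?thesis using True B b_nonneg E by (simp add: ennreal_mult)
      next
        case False
        have "ennreal (cmod (h x)) * ennreal (cmod (en n (x + y)) * b) = 0" for x :: "real^'n"
        proof (cases "R < norm x")
          case nx: False
          then have "S < norm (x + y)" using False norm_triangle_ineq4[of "x + y" x] by simp
          then show ?thesis using S(2)[OF n] by simp
        qed (simp add: R)
        then show ?thesis by (simp only: nn_integral_const mult_zero_left zero_le)
      qed
    qed
    also have "\<dots> \<le> ennreal (B * b * E) * ennreal D"
      using D(2) trans_bounded_sets[OF N] by (subst nn_integral_cmult_indicator) (auto intro: mult_left_mono)
    also have "\<dots> = ennreal (B * b * E * D)" using B b_nonneg E D by (simp add: ennreal_mult)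
    finally have "(\<integral>\<^sup>+x. ennreal (cmod (h x * smoothing (en n) x)) \<partial>lborel) \<le> ennreal (B * b * E * D)" .
    then show ?thesis
      using B b_nonneg E D by (intro integral_real_bounded) auto
  qed
  then show ?thesis using that by blast
qed

lemma locally_bounded_of_transform_pair:
  assumes mult: "\<And>\<psi>. \<psi> \<in> A_alg \<Longrightarrow> (\<lambda>t. \<phi> t * \<psi> t) \<in> A_alg"
  shows "locally_bounded \<phi>"
  unfolding locally_bounded_def
proof (intro conjI allI impI)
  have \<psi>: "(\<lambda>t. \<phi> t * FT (en n) t) \<in> A_alg" if "n \<ge> 1" for n
  proof (rule mult)
    have "(\<lambda>k. normV (\<lambda>t. FT (en n :: real^'n \<Rightarrow> complex) t - FT (en n) t)) \<longlonglongrightarrow> 0"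
      unfolding normV_tendsto_0_iff normV_le_iff by simp
    then show "FT (en n :: real^'n \<Rightarrow> complex) \<in> A_alg"
      unfolding A_alg_def using Cc_integrable[OF Cc_en[OF that]]
      by (intro CollectI exI[of _ "\<lambda>_. en n"]) auto
  qed
  show "\<exists>f. loc_int_seq (\<lambda>t. \<phi> t * FT (en n) t) f" if "n \<ge> 1" for n
    by (rule exI, rule loc_int_seq_approximants[OF Cc_en[OF that] \<psi>[OF that]])
  fix h :: "real^'n \<Rightarrow> complex" assume h: "Cc h"
  obtain C where "\<And>n. n \<ge> 1 \<Longrightarrow> (\<integral>x. cmod (h x * smoothing (en n) x) \<partial>lborel) \<le> C"
    using smoothing_en_bounded[OF h] by metis
  then show "bdd_above {hnorm h (\<lambda>t. \<phi> t * FT (en n) t) |n. n \<ge> 1}"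
    using hnorm_eq[OF Cc_en \<psi> h] by (intro bdd_aboveI[of _ C]) auto
qed

end

theorem theorem8p7:
  fixes \<phi> :: "real^'n \<Rightarrow> complex"
  assumes "\<phi> \<in> mult_A"
  shows "density_transformable \<phi> \<longleftrightarrow>
         (locally_bounded \<phi> \<and> (\<exists>\<nu>. assoc_radon \<phi> \<nu> \<and> translation_bounded \<nu>))"
proof
  have \<phi>: "continuous_on UNIV \<phi>" "bounded (range \<phi>)"
    and mult: "\<And>\<psi>. \<psi> \<in> A_alg \<Longrightarrow> (\<lambda>t. \<phi> t * \<psi> t) \<in> A_alg"
    using assms by (auto simp: mult_A_def)
  {
    assume "density_transformable \<phi>"
    note d = \<phi> this
    obtain \<mu> B where "transform_pair lborel (fst \<mu>) \<phi> (snd \<mu>) B"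
      using d by (rule density_transformableE) blast
    then have "locally_bounded \<phi>" using \<phi>(1) mult by (rule locally_bounded_of_transform_pair)
    moreover obtain \<nu> where "assoc_radon \<phi> \<nu>" "translation_bounded \<nu>"
      using d by (rule density_transformable_imp_assoc_radon) blast
    ultimately show "locally_bounded \<phi> \<and> (\<exists>\<nu>. assoc_radon \<phi> \<nu> \<and> translation_bounded \<nu>)" by blast
  next
    assume "locally_bounded \<phi> \<and> (\<exists>\<nu>. assoc_radon \<phi> \<nu> \<and> translation_bounded \<nu>)"
    then show "density_transformable \<phi>"
      using assoc_radon_imp_density_transformable[OF \<phi>] by blast
  }
qed

end
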